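(* Let $M$ be a (super)manifold, $F$ a local system of finite-dimensional vector (super)spaces on $M$, $B$ a solution to the commutativity equations for $(M,F)$, and $h$ a primitive vector for $B$. Working locally, induce a flat affine structure on $M$ from a fiber $F_0$ of $F$ with the help of the map $t\mapsto B(t)h$. Then in any local flat coordinate system $(t^c)$ we can define a vector field $A=\sum_cA^c\partial_c$ such that $$\partial_bA^c=(-1)^{(|t^b|+1)(|t^b|+|t^c|)}B_b{}^c .$$ This field is a solution to the oriented associativity equations with flat identity $e$ which is the pullback of $h$ (considered as a tangent vector to a fiber of $F$) with respect to the map $t\mapsto B(t)h$.
   Context: $M$ is a (super)manifold in one of the standard categories ($C^\infty$, analytic, formal); $|t^b|$ is the parity of $t^b$. **Commutativity equations.** For a local system $F$ let $\nabla_0$ be the flat connection on $\mathcal{O}_M\otimes F$ with $\operatorname{Ker}\nabla_0=F$, extended to $\mathcal{O}_M\otimes End\,F$. An even section $B$ of $\mathcal{O}_M\otimes End\,F$ is a solution to the commutativity equations for $(M,F)$ if $\nabla_0B\wedge\nabla_0B=0$; in a basis of flat sections this says that all $\partial B/\partial t^i$ pairwise supercommute. **Primitive vector.** An even (flat) section $h\in\Gamma(M,F)$ is primitive for $B$ if, over open $U\subset M$ where $F|_U=F_0\times U$ is trivialized ($F_0$ a fiber, viewed as a (super)manifold with linear structure), the map $U\to F_0$, $t\mapsto B(t)h$, is a local isomorphism everywhere. **Affine flat structure.** A subsheaf $\mathcal{T}^f_M\subset\mathcal{T}_M$ of flat vector fields which is a local system of linear spaces and abelian Lie superalgebras with $\mathcal{T}_M=\mathcal{O}_M\otimes\mathcal{T}_M^f$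 (over constants); equivalently, an atlas with affine linear transition functions between its (flat) coordinates $(t^c)$, $\mathcal{T}_M^f$ being locally spanned by $\partial_c=\partial/\partial t^c$. Here the flat structure is the one pulled back from the linear structure of $F_0$ by the local isomorphism $t\mapsto B(t)h$; its differential identifies the flat vector fields $\partial_c$ on $M$ with a basis of $F_0$, again denoted $(\partial_c)$, and in the corresponding flat coordinates the map is $B(t)h=\sum_c(-1)^{|t^c|}(t^c+a^c)\partial_c$ with constants $a^c$. The matrix $B_b{}^c$ of $B$ is taken in this basis: $B(\partial_b)=\sum_cB_b{}^c\partial_c$. **Oriented associativity equations.** A solution is an even vector field $A=\sum_cA^c\partial_c$ such that, with $A_{ab}{}^c:=\partial_a\partial_bA^c$ in local flat coordinates, the law $\partial_a\circ\partial_b=\sum_cA_{ab}{}^c\partial_c$ extends to an associative (super)commutative $\mathcal{O}_M$-bilinear multiplication on $\mathcal{T}_M$. An even flat vector field $e=\partial_0$ is a flat identity if $A_{a0}{}^c=\delta_a^c$, i.e. $e\circ X=X$ for every vector field $X$. *)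

theory Defs
  imports
    "HOL-Analysis.Analysis"
    "HOL-Algebra.QuotRing"
    "HOL-Library.Poly_Mapping"
    "HOL-Library.Function_Algebras"
begin

section \<open>Superfunctions on superdomains\<close>

text \<open>
  The ground field is a complete real normed field, i.e. the reals or the complex numbers.
  Over the complex numbers differentiability is complex differentiability, so that both
  \<open>Smooth\<close> and \<open>Analytic\<close> then describe complex analytic supermanifolds.
\<close>

datatype category = Smooth | Analytic | Formal

text \<open>
  To treat the three categories uniformly, a superfunction is represented by its Taylor
  expansions: \<open>f x \<alpha> I\<close> is the coefficient of \<open>z^\<alpha> \<xi>\<^sub>I\<close> in the expansion of \<open>f\<close>
  at the point \<open>x\<close>, where \<open>z\<close> is the displacement from \<open>x\<close> and
  \<open>\<xi>\<^sub>I\<close> is the product of the odd coordinates \<open>\<xi>\<^sub>i\<close>, \<open>i \<in> I\<close>, in increasing order.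
  In the categories \<open>Smooth\<close> and \<open>Analytic\<close> the expansions are determined by the component
  functions \<open>\<lambda>x. f x 0 I\<close>; in the category \<open>Formal\<close> there is only one point and the expansion
  is an arbitrary formal power series.
  The points of a superdomain of dimension \<open>p|q\<close> are sequences vanishing from index \<open>p\<close> on.
\<close>

type_synonym 'k sfun = "(nat \<Rightarrow> 'k) \<Rightarrow> (nat \<Rightarrow>\<^sub>0 nat) \<Rightarrow> nat set \<Rightarrow> 'k"

definition model_space :: "category \<Rightarrow> nat \<Rightarrow> (nat \<Rightarrow> 'k::real_normed_field) set" where
  "model_space cat p = (if cat = Formal then {\<lambda>_. 0} else {x. \<forall>i\<ge>p. x i = 0})"

definition smooth_jets :: "nat \<Rightarrow> (nat \<Rightarrow> 'k::real_normed_field) set \<Rightarrow> 'k sfun \<Rightarrow> bool" where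
  "smooth_jets p D f \<longleftrightarrow>
     (\<forall>\<alpha> I. continuous_on D (\<lambda>x. f x \<alpha> I)) \<and>
     (\<forall>\<alpha> I. \<forall>i<p. \<forall>x\<in>D.
        ((\<lambda>u. f (x(i := u)) \<alpha> I) has_field_derivative
           of_nat (Poly_Mapping.lookup \<alpha> i + 1) * f x (\<alpha> + Poly_Mapping.single i 1) I) (at (x i)))"

definition analytic_jets :: "nat \<Rightarrow> (nat \<Rightarrow> 'k::real_normed_field) set \<Rightarrow> 'k sfun \<Rightarrow> bool" where
  "analytic_jets p D f \<longleftrightarrow> smooth_jets p D f \<and>
     (\<forall>x\<in>D. \<exists>\<rho>>0. \<forall>y\<in>D. (\<forall>i<p. norm (y i - x i) < \<rho>) \<longrightarrow>
        (\<forall>I. ((\<lambda>\<alpha>. f x \<alpha> I * (\<Prod>i<p. (y i - x i) ^ Poly_Mapping.lookup \<alpha> i)) has_sum f y 0 I) UNIV))"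

definition superfunctions ::
    "category \<Rightarrow> nat \<Rightarrow> nat \<Rightarrow> (nat \<Rightarrow> 'k::real_normed_field) set \<Rightarrow> 'k sfun set" where
  "superfunctions cat p q D =
     {f. (\<forall>x \<alpha> I. f x \<alpha> I \<noteq> 0 \<longrightarrow> x \<in> D \<and> Poly_Mapping.keys \<alpha> \<subseteq> {..<p} \<and> I \<subseteq> {..<q}) \<and>
         (case cat of Smooth \<Rightarrow> smooth_jets p D f | Analytic \<Rightarrow> analytic_jets p D f | Formal \<Rightarrow> True)}"

text \<open>The sign in \<open>\<xi>\<^sub>J \<xi>\<^sub>K = \<plusminus> \<xi>\<^bsub>J \<union> K\<^esub>\<close> for disjoint \<open>J\<close> and \<open>K\<close>.\<close>

definition shuffle_sign :: "nat set \<Rightarrow> nat set \<Rightarrow> 'k::comm_ring_1" where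
  "shuffle_sign J K = (-1) ^ card {(j, k). j \<in> J \<and> k \<in> K \<and> k < j}"

definition sf_mult :: "'k::real_normed_field sfun \<Rightarrow> 'k sfun \<Rightarrow> 'k sfun" where
  "sf_mult f g = (\<lambda>x \<alpha> I. \<Sum>(\<beta>, \<gamma>)\<in>{(\<beta>, \<gamma>). \<beta> + \<gamma> = \<alpha>}. \<Sum>J\<in>Pow I.
     shuffle_sign J (I - J) * f x \<beta> J * g x \<gamma> (I - J))"

definition sf_const :: "(nat \<Rightarrow> 'k::real_normed_field) set \<Rightarrow> 'k \<Rightarrow> 'k sfun" where
  "sf_const D k = (\<lambda>x \<alpha> I. if x \<in> D \<and> \<alpha> = 0 \<and> I = {} then k else 0)"

definition sf_scale :: "'k::real_normed_field \<Rightarrow> 'k sfun \<Rightarrow> 'k sfun" where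
  "sf_scale k f = (\<lambda>x \<alpha> I. k * f x \<alpha> I)"

definition sf_restrict :: "(nat \<Rightarrow> 'k::real_normed_field) set \<Rightarrow> 'k sfun \<Rightarrow> 'k sfun" where
  "sf_restrict D f = (\<lambda>x \<alpha> I. if x \<in> D then f x \<alpha> I else 0)"

definition sf_homogeneous :: "bool \<Rightarrow> 'k::real_normed_field sfun \<Rightarrow> bool" where
  "sf_homogeneous d f \<longleftrightarrow> (\<forall>x \<alpha> I. f x \<alpha> I \<noteq> 0 \<longrightarrow> odd (card I) = d)"

text \<open>
  Coordinates, homogeneous bases etc. of dimension \<open>p|q\<close> are indexed by \<open>c < p + q\<close>:
  the index \<open>c\<close> is even for \<open>c < p\<close>, and \<open>p + j\<close> is the index of the \<open>j\<close>-th odd element.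
\<close>

definition par :: "nat \<Rightarrow> nat \<Rightarrow> nat" where
  "par p c = (if c < p then 0 else 1)"

definition sf_coord :: "nat \<Rightarrow> (nat \<Rightarrow> 'k::real_normed_field) set \<Rightarrow> nat \<Rightarrow> 'k sfun" where
  "sf_coord p D c = (\<lambda>x \<alpha> I.
     if x \<notin> D then 0
     else if c < p then
       (if I = {} \<and> \<alpha> = 0 then x c else if I = {} \<and> \<alpha> = Poly_Mapping.single c 1 then 1 else 0)
     else (if I = {c - p} \<and> \<alpha> = 0 then 1 else 0))"

text \<open>The partial derivatives; those in the odd directions are left derivatives.\<close>

definition sf_deriv :: "nat \<Rightarrow> nat \<Rightarrow> 'k::real_normed_field sfun \<Rightarrow> 'k sfun" where
  "sf_deriv p c f = (\<lambda>x \<alpha> I.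
     if c < p then of_nat (Poly_Mapping.lookup \<alpha> c + 1) * f x (\<alpha> + Poly_Mapping.single c 1) I
     else if c - p \<in> I then 0
     else (-1) ^ card {i \<in> I. i < c - p} * f x \<alpha> (insert (c - p) I))"

definition superdomain_ring ::
    "category \<Rightarrow> nat \<Rightarrow> nat \<Rightarrow> (nat \<Rightarrow> 'k::real_normed_field) set \<Rightarrow> 'k sfun ring" where
  "superdomain_ring cat p q D =
     \<lparr>carrier = superfunctions cat p q D, monoid.mult = sf_mult, one = sf_const D 1,
      zero = 0, add = (+)\<rparr>"


section \<open>Supermanifolds\<close>

record ('p, 'f, 'k) superspace =
  space_of :: "'p topology"
  sheaf :: "'p set \<Rightarrow> 'f ring"
  scalar :: "'p set \<Rightarrow> 'k \<Rightarrow> 'f"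
  graded :: "'p set \<Rightarrow> bool \<Rightarrow> 'f set" \<comment> \<open>\<open>True\<close> for the odd part\<close>
  restr :: "'p set \<Rightarrow> 'p set \<Rightarrow> 'f \<Rightarrow> 'f" \<comment> \<open>\<open>restr M U V\<close> restricts from \<open>U\<close> to \<open>V\<close>\<close>

definition superalgebra_at :: "('p, 'f, 'k::real_normed_field) superspace \<Rightarrow> 'p set \<Rightarrow> bool" where
  "superalgebra_at M U \<longleftrightarrow>
     ring (sheaf M U) \<and>
     scalar M U 1 = \<one>\<^bsub>sheaf M U\<^esub> \<and>
     (\<forall>k l. scalar M U (k + l) = scalar M U k \<oplus>\<^bsub>sheaf M U\<^esub> scalar M U l) \<and>
     (\<forall>k l. scalar M U (k * l) = scalar M U k \<otimes>\<^bsub>sheaf M U\<^esub> scalar M U l) \<and>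
     range (scalar M U) \<subseteq> graded M U False \<and>
     (\<forall>d. additive_subgroup (graded M U d) (sheaf M U)) \<and>
     (\<forall>f\<in>carrier (sheaf M U). \<exists>!g. g \<in> graded M U False \<times> graded M U True \<and>
        f = fst g \<oplus>\<^bsub>sheaf M U\<^esub> snd g) \<and>
     (\<forall>d d'. \<forall>f\<in>graded M U d. \<forall>g\<in>graded M U d'.
        f \<otimes>\<^bsub>sheaf M U\<^esub> g \<in> graded M U (d \<noteq> d') \<and>
        f \<otimes>\<^bsub>sheaf M U\<^esub> g =
          (if d \<and> d' then \<ominus>\<^bsub>sheaf M U\<^esub> (g \<otimes>\<^bsub>sheaf M U\<^esub> f) else g \<otimes>\<^bsub>sheaf M U\<^esub> f))"

definition super_ringed_space :: "('p, 'f, 'k::real_normed_field) superspace \<Rightarrow> bool" where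
  "super_ringed_space M \<longleftrightarrow>
     (\<forall>U. openin (space_of M) U \<longrightarrow> superalgebra_at M U \<and>
        (\<forall>f\<in>carrier (sheaf M U). restr M U U f = f)) \<and>
     (\<forall>U V. openin (space_of M) U \<and> openin (space_of M) V \<and> V \<subseteq> U \<longrightarrow>
        restr M U V \<in> ring_hom (sheaf M U) (sheaf M V) \<and>
        (\<forall>k. restr M U V (scalar M U k) = scalar M V k) \<and>
        (\<forall>d. restr M U V ` graded M U d \<subseteq> graded M V d) \<and>
        (\<forall>W f. openin (space_of M) W \<and> W \<subseteq> V \<and> f \<in> carrier (sheaf M U) \<longrightarrow>
           restr M V W (restr M U V f) = restr M U W f)) \<and>
     (\<forall>\<U> s. (\<forall>V\<in>\<U>. openin (space_of M) V \<and> s V \<in> carrier (sheaf M V)) \<and>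
        (\<forall>V\<in>\<U>. \<forall>W\<in>\<U>. restr M V (V \<inter> W) (s V) = restr M W (V \<inter> W) (s W)) \<longrightarrow>
        (\<exists>!f. f \<in> carrier (sheaf M (\<Union>\<U>)) \<and> (\<forall>V\<in>\<U>. restr M (\<Union>\<U>) V f = s V)))"

text \<open>
  A local coordinate system of dimension \<open>p|q\<close> on \<open>V\<close>: an isomorphism of \<open>V\<close> with a superdomain,
  consisting of a homeomorphism \<open>\<phi>\<close> and algebra isomorphisms \<open>\<Phi> W\<close>, which express the
  functions on \<open>W \<subseteq> V\<close> in the coordinates.
\<close>

definition chart :: "category \<Rightarrow> ('p, 'f, 'k::real_normed_field) superspace \<Rightarrow> nat \<Rightarrow> nat \<Rightarrow>
    'p set \<Rightarrow> ('p \<Rightarrow> nat \<Rightarrow> 'k) \<Rightarrow> ('p set \<Rightarrow> 'f \<Rightarrow> 'k sfun) \<Rightarrow> bool" where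
  "chart cat M p q V \<phi> \<Phi> \<longleftrightarrow>
     openin (space_of M) V \<and>
     openin (top_of_set (model_space cat p)) (\<phi> ` V) \<and>
     homeomorphic_map (subtopology (space_of M) V) (top_of_set (\<phi> ` V)) \<phi> \<and>
     (\<forall>W. openin (space_of M) W \<and> W \<subseteq> V \<longrightarrow>
        \<Phi> W \<in> ring_iso (sheaf M W) (superdomain_ring cat p q (\<phi> ` W)) \<and>
        (\<forall>k. \<Phi> W (scalar M W k) = sf_const (\<phi> ` W) k) \<and>
        (\<forall>f\<in>carrier (sheaf M W). \<forall>d. f \<in> graded M W d \<longleftrightarrow> sf_homogeneous d (\<Phi> W f)) \<and>
        (\<forall>W' f. openin (space_of M) W' \<and> W' \<subseteq> W \<and> f \<in> carrier (sheaf M W) \<longrightarrow>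
           \<Phi> W' (restr M W W' f) = sf_restrict (\<phi> ` W') (\<Phi> W f)))"

definition supermanifold :: "category \<Rightarrow> ('p, 'f, 'k::real_normed_field) superspace \<Rightarrow> bool" where
  "supermanifold cat M \<longleftrightarrow>
     super_ringed_space M \<and>
     Hausdorff_space (space_of M) \<and>
     (\<exists>\<B>. countable \<B> \<and> (\<forall>V\<in>\<B>. openin (space_of M) V) \<and>
        (\<forall>U x. openin (space_of M) U \<and> x \<in> U \<longrightarrow> (\<exists>V\<in>\<B>. x \<in> V \<and> V \<subseteq> U))) \<and>
     (\<forall>x\<in>topspace (space_of M). \<exists>p q V \<phi> \<Phi>. x \<in> V \<and> chart cat M p q V \<phi> \<Phi>)"


section \<open>Local systems and the commutativity equations\<close>

definition locally_constant_on :: "'p topology \<Rightarrow> 'p set \<Rightarrow> ('p \<Rightarrow> 'a) \<Rightarrow> bool" where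
  "locally_constant_on X U f \<longleftrightarrow>
     (\<forall>x\<in>U. \<exists>W. openin X W \<and> x \<in> W \<and> W \<subseteq> U \<and> (\<forall>y\<in>W. f y = f x))"

text \<open>
  A local system of rank \<open>r|s\<close>, given by trivializations, i.e. homogeneous frames
  \<open>e\<^sup>i\<^sub>b\<close> (\<open>b < r + s\<close>) of flat sections over the open sets \<open>patch F i\<close>.
  The transition matrices are defined by
  \<open>e\<^sup>j\<^sub>b = \<Sum>\<^sub>c transition F i j x b c e\<^sup>i\<^sub>c\<close>.
\<close>

record ('j, 'p, 'k) local_system =
  frames :: "'j set"
  patch :: "'j \<Rightarrow> 'p set"
  transition :: "'j \<Rightarrow> 'j \<Rightarrow> 'p \<Rightarrow> nat \<Rightarrow> nat \<Rightarrow> 'k"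

definition even_matrix :: "nat \<Rightarrow> nat \<Rightarrow> (nat \<Rightarrow> nat \<Rightarrow> 'k::real_normed_field) \<Rightarrow> bool" where
  "even_matrix r s G \<longleftrightarrow> (\<forall>b c. G b c \<noteq> 0 \<longrightarrow> b < r + s \<and> c < r + s \<and> par r b = par r c)"

definition local_system :: "('p, 'f, 'k::real_normed_field) superspace \<Rightarrow> nat \<Rightarrow> nat \<Rightarrow>
    ('j, 'p, 'k) local_system \<Rightarrow> bool" where
  "local_system M r s F \<longleftrightarrow>
     (\<forall>i\<in>frames F. openin (space_of M) (patch F i)) \<and>
     topspace (space_of M) = (\<Union>i\<in>frames F. patch F i) \<and>
     (\<forall>i\<in>frames F. \<forall>j\<in>frames F.
        locally_constant_on (space_of M) (patch F i \<inter> patch F j) (transition F i j) \<and>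
        (\<forall>x\<in>patch F i \<inter> patch F j. even_matrix r s (transition F i j x))) \<and>
     (\<forall>i\<in>frames F. \<forall>x\<in>patch F i. \<forall>b<r + s. \<forall>c<r + s.
        transition F i i x b c = (if b = c then 1 else 0)) \<and>
     (\<forall>i\<in>frames F. \<forall>j\<in>frames F. \<forall>l\<in>frames F. \<forall>x\<in>patch F i \<inter> patch F j \<inter> patch F l.
        \<forall>b<r + s. \<forall>c<r + s.
        (\<Sum>d<r + s. transition F j l x b d * transition F i j x d c) = transition F i l x b c)"

text \<open>
  Convention: coefficients of sections of \<open>\<O> \<otimes> F\<close> with respect to a basis are written on the
  right.  Thus an endomorphism with matrix \<open>B\<close> acts by \<open>B(e\<^sub>b) = \<Sum>\<^sub>c e\<^sub>c B b c\<close>;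
  it is linear over functions acting from the right, so endomorphisms of any parity are
  composed without signs.  In contrast, functions precede the \<open>\<partial>\<^sub>c\<close> in vector fields.
  For a homogeneous function \<open>f\<close>, \<open>e\<^sub>c f\<close> equals \<open>f e\<^sub>c\<close> up to the sign \<open>(-1)^(|e\<^sub>c| |f|)\<close>.

  \<open>even_section\<close>: \<open>B i\<close> is the matrix of an even section of \<open>\<O> \<otimes> End F\<close> in the \<open>i\<close>-th frame.
\<close>

definition even_section :: "('p, 'f, 'k::real_normed_field) superspace \<Rightarrow> nat \<Rightarrow> nat \<Rightarrow>
    ('j, 'p, 'k) local_system \<Rightarrow> ('j \<Rightarrow> nat \<Rightarrow> nat \<Rightarrow> 'f) \<Rightarrow> bool" where
  "even_section M r s F B \<longleftrightarrow>
     (\<forall>i\<in>frames F. \<forall>b<r + s. \<forall>c<r + s. B i b c \<in> graded M (patch F i) (odd (par r b + par r c))) \<and>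
     (\<forall>i\<in>frames F. \<forall>j\<in>frames F. \<forall>W G.
        openin (space_of M) W \<and> W \<subseteq> patch F i \<inter> patch F j \<and> (\<forall>x\<in>W. transition F i j x = G) \<longrightarrow>
        (\<forall>b<r + s. \<forall>c<r + s.
          (\<Oplus>\<^bsub>sheaf M W\<^esub>d\<in>{..<r + s}. restr M (patch F j) W (B j b d) \<otimes>\<^bsub>sheaf M W\<^esub> scalar M W (G d c)) =
          (\<Oplus>\<^bsub>sheaf M W\<^esub>d\<in>{..<r + s}. scalar M W (G b d) \<otimes>\<^bsub>sheaf M W\<^esub> restr M (patch F i) W (B i d c))))"

text \<open>The matrix of \<open>B\<close> in the \<open>i\<close>-th frame, expressed in the coordinates \<open>\<Phi>\<close>.\<close>

definition local_matrix :: "('p, 'f, 'k::real_normed_field) superspace \<Rightarrow> ('j, 'p, 'k) local_system \<Rightarrow>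
    ('j \<Rightarrow> nat \<Rightarrow> nat \<Rightarrow> 'f) \<Rightarrow> 'j \<Rightarrow> ('p set \<Rightarrow> 'f \<Rightarrow> 'k sfun) \<Rightarrow> 'p set \<Rightarrow> nat \<Rightarrow> nat \<Rightarrow> 'k sfun" where
  "local_matrix M F B i \<Phi> W b c = \<Phi> W (restr M (patch F i) W (B i b c))"

text \<open>
  The matrix of \<open>\<partial>B/\<partial>t\<^sup>a\<close>, i.e. of \<open>\<nabla>\<^sub>0 B\<close> in the direction \<open>\<partial>\<^sub>a\<close>. The sign comes from
  \<open>\<partial>\<^sub>a (e\<^sub>c f) = (-1)^(|t\<^sup>a| |e\<^sub>c|) e\<^sub>c \<partial>\<^sub>a f\<close>. Here \<open>p\<close> and \<open>r\<close> are the even dimensions of the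
  base and of the fiber.
\<close>

definition endo_deriv :: "nat \<Rightarrow> nat \<Rightarrow> nat \<Rightarrow> (nat \<Rightarrow> nat \<Rightarrow> 'k::real_normed_field sfun) \<Rightarrow>
    nat \<Rightarrow> nat \<Rightarrow> 'k sfun" where
  "endo_deriv p r a X = (\<lambda>b c. sf_scale ((-1) ^ (par p a * par r c)) (sf_deriv p a (X b c)))"

definition endo_comp :: "nat \<Rightarrow> (nat \<Rightarrow> nat \<Rightarrow> 'k::real_normed_field sfun) \<Rightarrow>
    (nat \<Rightarrow> nat \<Rightarrow> 'k sfun) \<Rightarrow> nat \<Rightarrow> nat \<Rightarrow> 'k sfun" where
  "endo_comp n X Y = (\<lambda>b c. \<Sum>d<n. sf_mult (X d c) (Y b d))"

text \<open>
  The equation \<open>\<nabla>\<^sub>0 B \<and> \<nabla>\<^sub>0 B = 0\<close>: in every local coordinate system the supercommutators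
  of the \<open>\<partial>B/\<partial>t\<^sup>a\<close>, which are the coefficients of this 2-form, vanish.
\<close>

definition commutativity_solution :: "category \<Rightarrow> ('p, 'f, 'k::real_normed_field) superspace \<Rightarrow>
    nat \<Rightarrow> nat \<Rightarrow> ('j, 'p, 'k) local_system \<Rightarrow> ('j \<Rightarrow> nat \<Rightarrow> nat \<Rightarrow> 'f) \<Rightarrow> bool" where
  "commutativity_solution cat M r s F B \<longleftrightarrow>
     even_section M r s F B \<and>
     (\<forall>i\<in>frames F. \<forall>p q V \<phi> \<Phi>. chart cat M p q V \<phi> \<Phi> \<and> V \<subseteq> patch F i \<longrightarrow>
        (\<forall>a<p + q. \<forall>b<p + q. \<forall>d<r + s. \<forall>c<r + s.
           let C = (\<lambda>a. endo_deriv p r a (local_matrix M F B i \<Phi> V))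
           in endo_comp (r + s) (C a) (C b) d c =
              sf_scale ((-1) ^ (par p a * par p b)) (endo_comp (r + s) (C b) (C a) d c)))"


section \<open>Primitive vectors and flat coordinates\<close>

text \<open>\<open>h i x\<close> is the coefficient vector of an even flat section \<open>h\<close> of \<open>F\<close> in the \<open>i\<close>-th frame.\<close>

definition even_flat_section :: "('p, 'f, 'k::real_normed_field) superspace \<Rightarrow> nat \<Rightarrow> nat \<Rightarrow>
    ('j, 'p, 'k) local_system \<Rightarrow> ('j \<Rightarrow> 'p \<Rightarrow> nat \<Rightarrow> 'k) \<Rightarrow> bool" where
  "even_flat_section M r s F h \<longleftrightarrow>
     (\<forall>i\<in>frames F. locally_constant_on (space_of M) (patch F i) (h i) \<and>
        (\<forall>x\<in>patch F i. \<forall>c\<ge>r. h i x c = 0)) \<and>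
     (\<forall>i\<in>frames F. \<forall>j\<in>frames F. \<forall>x\<in>patch F i \<inter> patch F j. \<forall>c<r + s.
        h i x c = (\<Sum>b<r + s. h j x b * transition F i j x b c))"

text \<open>Right coefficients of \<open>B h\<close>, where \<open>h = \<Sum>\<^sub>b H b e\<^sub>b\<close> has constant coefficients.\<close>

definition apply_const :: "nat \<Rightarrow> (nat \<Rightarrow> nat \<Rightarrow> 'k::real_normed_field sfun) \<Rightarrow> (nat \<Rightarrow> 'k) \<Rightarrow>
    nat \<Rightarrow> 'k sfun" where
  "apply_const n X H c = (\<Sum>b<n. sf_scale (H b) (X b c))"

text \<open>
  The map \<open>t \<mapsto> B(t)h\<close> to the fiber, a superspace of dimension \<open>r|s\<close>, is the morphism
  pulling back the linear coordinates of the fiber to the left coefficients of \<open>B h\<close>. Being a local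
  isomorphism, it restricts near every point to an isomorphism with a superdomain in the fiber, which
  is given by \<open>(\<phi>, \<Phi>)\<close> up to a translation by \<open>a\<close>. (The translation is needed in the formal category,
  where the coordinates on the formal neighbourhood of a point vanish at that point.)
  As left and right coefficients of an even section differ by the sign \<open>(-1)^|t\<^sup>c|\<close>, this reads
  \<open>B(t)h = \<Sum>\<^sub>c (-1)^|t\<^sup>c| e\<^sub>c (t\<^sup>c + a\<^sup>c)\<close>.
\<close>

definition primitive :: "category \<Rightarrow> ('p, 'f, 'k::real_normed_field) superspace \<Rightarrow> nat \<Rightarrow> nat \<Rightarrow>
    ('j, 'p, 'k) local_system \<Rightarrow> ('j \<Rightarrow> nat \<Rightarrow> nat \<Rightarrow> 'f) \<Rightarrow> ('j \<Rightarrow> 'p \<Rightarrow> nat \<Rightarrow> 'k) \<Rightarrow> bool" where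
  "primitive cat M r s F B h \<longleftrightarrow>
     even_flat_section M r s F h \<and>
     (\<forall>i\<in>frames F. \<forall>x\<in>patch F i. \<exists>V \<phi> \<Phi> H a.
        x \<in> V \<and> V \<subseteq> patch F i \<and> chart cat M r s V \<phi> \<Phi> \<and> (\<forall>y\<in>V. h i y = H) \<and>
        (\<forall>c<r + s. apply_const (r + s) (local_matrix M F B i \<Phi> V) H c =
           sf_scale ((-1) ^ par r c) (sf_coord r (\<phi> ` V) c + sf_const (\<phi> ` V) (a c))))"

definition inverse_matrices :: "nat \<Rightarrow> (nat \<Rightarrow> nat \<Rightarrow> 'k::real_normed_field) \<Rightarrow>
    (nat \<Rightarrow> nat \<Rightarrow> 'k) \<Rightarrow> bool" where
  "inverse_matrices n P Q \<longleftrightarrow> (\<forall>b<n. \<forall>c<n.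
     (\<Sum>d<n. P b d * Q d c) = (if b = c then 1 else 0) \<and>
     (\<Sum>d<n. Q b d * P d c) = (if b = c then 1 else 0))"

text \<open>
  Coefficients of \<open>B\<close> and of \<open>h\<close> in the basis \<open>f\<^sub>b = \<Sum>\<^sub>c P b c e\<^sub>c\<close> of the fiber, where \<open>Q\<close> is
  inverse to \<open>P\<close>.
\<close>

definition matrix_in_basis :: "nat \<Rightarrow> (nat \<Rightarrow> nat \<Rightarrow> 'k::real_normed_field) \<Rightarrow> (nat \<Rightarrow> nat \<Rightarrow> 'k) \<Rightarrow>
    (nat \<Rightarrow> nat \<Rightarrow> 'k sfun) \<Rightarrow> nat \<Rightarrow> nat \<Rightarrow> 'k sfun" where
  "matrix_in_basis n P Q X b c = (\<Sum>d<n. \<Sum>e<n. sf_scale (P b d * Q e c) (X d e))"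

definition vector_in_basis :: "nat \<Rightarrow> (nat \<Rightarrow> nat \<Rightarrow> 'k::real_normed_field) \<Rightarrow> (nat \<Rightarrow> 'k) \<Rightarrow>
    nat \<Rightarrow> 'k" where
  "vector_in_basis n Q H c = (\<Sum>d<n. H d * Q d c)"

text \<open>
  Flat coordinates on \<open>V\<close> for the affine structure pulled back by \<open>t \<mapsto> B(t)h\<close>: in some homogeneous
  basis \<open>f\<^sub>c\<close> of the fiber, with matrix \<open>P\<close>, one has
  \<open>B(t)h = \<Sum>\<^sub>c (-1)^|t\<^sup>c| f\<^sub>c (t\<^sup>c + a\<^sup>c)\<close> with constants \<open>a\<^sup>c\<close>.
  Then \<open>\<partial>\<^sub>c (B(t)h) = f\<^sub>c\<close>, i.e. the differential of the map identifies \<open>\<partial>\<^sub>c\<close> with \<open>f\<^sub>c\<close>.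
\<close>

definition flat_coordinates :: "category \<Rightarrow> ('p, 'f, 'k::real_normed_field) superspace \<Rightarrow>
    nat \<Rightarrow> nat \<Rightarrow> ('j, 'p, 'k) local_system \<Rightarrow> ('j \<Rightarrow> nat \<Rightarrow> nat \<Rightarrow> 'f) \<Rightarrow>
    ('j \<Rightarrow> 'p \<Rightarrow> nat \<Rightarrow> 'k) \<Rightarrow> 'j \<Rightarrow> 'p set \<Rightarrow> ('p \<Rightarrow> nat \<Rightarrow> 'k) \<Rightarrow> ('p set \<Rightarrow> 'f \<Rightarrow> 'k sfun) \<Rightarrow>
    (nat \<Rightarrow> 'k) \<Rightarrow> (nat \<Rightarrow> nat \<Rightarrow> 'k) \<Rightarrow> (nat \<Rightarrow> nat \<Rightarrow> 'k) \<Rightarrow> (nat \<Rightarrow> 'k) \<Rightarrow> bool" where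
  "flat_coordinates cat M r s F B h i V \<phi> \<Phi> H P Q a \<longleftrightarrow>
     V \<subseteq> patch F i \<and> chart cat M r s V \<phi> \<Phi> \<and> (\<forall>y\<in>V. h i y = H) \<and>
     even_matrix r s P \<and> even_matrix r s Q \<and> inverse_matrices (r + s) P Q \<and>
     (\<forall>c<r + s. apply_const (r + s) (matrix_in_basis (r + s) P Q (local_matrix M F B i \<Phi> V))
          (vector_in_basis (r + s) Q H) c =
        sf_scale ((-1) ^ par r c) (sf_coord r (\<phi> ` V) c + sf_const (\<phi> ` V) (a c)))"


section \<open>Oriented associativity equations\<close>

text \<open>
  Vector fields \<open>X = \<Sum>\<^sub>c X c \<partial>\<^sub>c\<close> on a superdomain \<open>D\<close> of dimension \<open>r|s\<close> with flat coordinates.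
\<close>

definition vector_fields :: "category \<Rightarrow> nat \<Rightarrow> nat \<Rightarrow> (nat \<Rightarrow> 'k::real_normed_field) set \<Rightarrow>
    (nat \<Rightarrow> 'k sfun) set" where
  "vector_fields cat r s D =
     {X. (\<forall>c<r + s. X c \<in> superfunctions cat r s D) \<and> (\<forall>c\<ge>r + s. X c = 0)}"

definition vf_homogeneous :: "nat \<Rightarrow> nat \<Rightarrow> bool \<Rightarrow> (nat \<Rightarrow> 'k::real_normed_field sfun) \<Rightarrow> bool" where
  "vf_homogeneous r s d X \<longleftrightarrow> (\<forall>c<r + s. sf_homogeneous (d \<noteq> odd (par r c)) (X c))"

definition vf_mult :: "'k::real_normed_field sfun \<Rightarrow> (nat \<Rightarrow> 'k sfun) \<Rightarrow> nat \<Rightarrow> 'k sfun" where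
  "vf_mult f X = (\<lambda>c. sf_mult f (X c))"

definition coord_field :: "(nat \<Rightarrow> 'k::real_normed_field) set \<Rightarrow> nat \<Rightarrow> nat \<Rightarrow> 'k sfun" where
  "coord_field D a = (\<lambda>c. if c = a then sf_const D 1 else 0)"

definition super_multiplication :: "category \<Rightarrow> nat \<Rightarrow> nat \<Rightarrow> (nat \<Rightarrow> 'k::real_normed_field) set \<Rightarrow>
    ((nat \<Rightarrow> 'k sfun) \<Rightarrow> (nat \<Rightarrow> 'k sfun) \<Rightarrow> (nat \<Rightarrow> 'k sfun)) \<Rightarrow> bool" where
  "super_multiplication cat r s D m \<longleftrightarrow>
     (let T = vector_fields cat r s D; S = superfunctions cat r s D in
       (\<forall>X\<in>T. \<forall>Y\<in>T. m X Y \<in> T) \<and>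
       (\<forall>X\<in>T. \<forall>Y\<in>T. \<forall>Z\<in>T. m (X + Y) Z = m X Z + m Y Z \<and> m X (Y + Z) = m X Y + m X Z) \<and>
       (\<forall>f\<in>S. \<forall>X\<in>T. \<forall>Y\<in>T. m (vf_mult f X) Y = vf_mult f (m X Y)) \<and>
       (\<forall>d d'. \<forall>f\<in>S. \<forall>X\<in>T. \<forall>Y\<in>T. sf_homogeneous d f \<and> vf_homogeneous r s d' X \<longrightarrow>
          m X (vf_mult f Y) = vf_mult (if d \<and> d' then - f else f) (m X Y)) \<and>
       (\<forall>X\<in>T. \<forall>Y\<in>T. \<forall>Z\<in>T. m (m X Y) Z = m X (m Y Z)) \<and>
       (\<forall>d d'. \<forall>X\<in>T. \<forall>Y\<in>T. vf_homogeneous r s d X \<and> vf_homogeneous r s d' Y \<longrightarrow>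
          m X Y = (if d \<and> d' then - m Y X else m Y X)))"

text \<open>
  \<open>A\<close> is a solution to the oriented associativity equations, and \<open>m\<close> is the corresponding
  multiplication, which is determined by \<open>A\<close>.
\<close>

definition oriented_associativity :: "category \<Rightarrow> nat \<Rightarrow> nat \<Rightarrow> (nat \<Rightarrow> 'k::real_normed_field) set \<Rightarrow>
    (nat \<Rightarrow> 'k sfun) \<Rightarrow> ((nat \<Rightarrow> 'k sfun) \<Rightarrow> (nat \<Rightarrow> 'k sfun) \<Rightarrow> (nat \<Rightarrow> 'k sfun)) \<Rightarrow> bool" where
  "oriented_associativity cat r s D A m \<longleftrightarrow>
     A \<in> vector_fields cat r s D \<and> vf_homogeneous r s False A \<and>
     super_multiplication cat r s D m \<and>
     (\<forall>a<r + s. \<forall>b<r + s. m (coord_field D a) (coord_field D b) =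
        (\<lambda>c. sf_deriv r a (sf_deriv r b (A c))))"

definition flat_identity :: "category \<Rightarrow> nat \<Rightarrow> nat \<Rightarrow> (nat \<Rightarrow> 'k::real_normed_field) set \<Rightarrow>
    ((nat \<Rightarrow> 'k sfun) \<Rightarrow> (nat \<Rightarrow> 'k sfun) \<Rightarrow> (nat \<Rightarrow> 'k sfun)) \<Rightarrow> (nat \<Rightarrow> 'k sfun) \<Rightarrow> bool" where
  "flat_identity cat r s D m e \<longleftrightarrow>
     e \<in> vector_fields cat r s D \<and> vf_homogeneous r s False e \<and>
     (\<forall>c<r + s. \<exists>k. e c = sf_const D k) \<and>
     (\<forall>X\<in>vector_fields cat r s D. m e X = X)"

text \<open>\<open>A\<close> is an even vector field with \<open>\<partial>\<^sub>b A\<^sup>c = (-1)^((|t\<^sup>b| + 1)(|t\<^sup>b| + |t\<^sup>c|)) X b c\<close>.\<close>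

definition vector_potential :: "category \<Rightarrow> nat \<Rightarrow> nat \<Rightarrow> (nat \<Rightarrow> 'k::real_normed_field) set \<Rightarrow>
    (nat \<Rightarrow> nat \<Rightarrow> 'k sfun) \<Rightarrow> (nat \<Rightarrow> 'k sfun) \<Rightarrow> bool" where
  "vector_potential cat r s D X A \<longleftrightarrow>
     A \<in> vector_fields cat r s D \<and> vf_homogeneous r s False A \<and>
     (\<forall>b<r + s. \<forall>c<r + s.
        sf_deriv r b (A c) = sf_scale ((-1) ^ ((par r b + 1) * (par r b + par r c))) (X b c))"

text \<open>
  \<open>e\<close> is the pull-back of the vector \<open>h = \<Sum>\<^sub>c H c f\<^sub>c\<close>, considered as a tangent vector to the
  fiber, under \<open>t \<mapsto> B(t)h\<close>, where \<open>X\<close> is the matrix of \<open>B\<close>: the derivatives along \<open>e\<close> of the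
  pull-backs of the linear coordinates, i.e. of the left coefficients of \<open>B(t)h\<close>, are the
  coefficients of \<open>h\<close>.
\<close>

definition pullback_of_vector :: "category \<Rightarrow> nat \<Rightarrow> nat \<Rightarrow> (nat \<Rightarrow> 'k::real_normed_field) set \<Rightarrow>
    (nat \<Rightarrow> nat \<Rightarrow> 'k sfun) \<Rightarrow> (nat \<Rightarrow> 'k) \<Rightarrow> (nat \<Rightarrow> 'k sfun) \<Rightarrow> bool" where
  "pullback_of_vector cat r s D X H e \<longleftrightarrow>
     e \<in> vector_fields cat r s D \<and>
     (\<forall>c<r + s. (\<Sum>a<r + s. sf_mult (e a)
        (sf_deriv r a (sf_scale ((-1) ^ par r c) (apply_const (r + s) X H c)))) = sf_const D (H c))"

end

theory Submission
  imports Defs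
begin

text \<open>
  Write \<open>C\<^sub>a = \<partial>\<^sub>a B\<close>. Differentiating \<open>B(t)h = \<Sum>\<^sub>c (-1)^|t\<^sup>c| f\<^sub>c (t\<^sup>c + a\<^sup>c)\<close> gives \<open>C\<^sub>a h = f\<^sub>a\<close>,
  so that \<open>C\<^sub>a f\<^sub>b = C\<^sub>a C\<^sub>b h\<close>, and the commutativity equations make this expression supersymmetric
  in \<open>a\<close> and \<open>b\<close>. Up to signs this symmetry says that the 1-forms with coefficients \<open>B\<^sub>b\<^sup>c\<close> are closed,
  whence local potentials \<open>A\<^sup>c\<close>. The structure constants \<open>\<partial>\<^sub>a \<partial>\<^sub>b A\<^sup>c\<close> are up to signs the matrix entries of
  \<open>C\<^sub>a\<close>, so associativity is again the supercommutativity of the \<open>C\<^sub>a\<close>, and the constant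
  field with coefficients \<open>h\<close> is the identity because \<open>C\<^sub>b h = f\<^sub>b\<close>.

  The local analysis is uniform in the three categories except that an analytic function has to be
  recognized by its jets: a smooth system of jets is analytic if and only if locally
  \<open>|f x \<alpha> I| \<le> M K^|\<alpha>|\<close>, a condition which survives differentiation and integration.
\<close>

section \<open>Operations on superfunctions\<close>

text \<open>The ring laws of superfunctions (closure under products, associativity, units,
  supercommutativity, parity splitting) are never computed from the formula for
  \<open>sf_mult\<close>: they are carried over from the structure sheaf along the chart
  isomorphism. What such an isomorphism does not give is calculus inside the category. The analytic
  case is the obstacle, since its definition makes only the values \<open>f y 0 I\<close> sums of
  the expansion at x and says nothing about the higher jets at y. Bounding all jets at all nearby
  points repairs this, and Taylor's theorem leads back from the bound to convergence.

  The product is built from B and not from A; a potential only has to reproduce its structure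
  constants. Therefore every potential on every open subset of the chart is covered, although
  potentials are constructed only near a point.

  Coefficients of endomorphisms stand on the right and those of vector fields on the left, and each
  passage costs a sign. As parities are 0 or 1, every sign identity is a finite check once
  \<open>par\<close> is unfolded.\<close>

abbreviation mexp :: "(nat \<Rightarrow>\<^sub>0 nat) \<Rightarrow> nat \<Rightarrow> nat" where
  "mexp \<equiv> Poly_Mapping.lookup"

lemma sf_deriv_add: "sf_deriv p c (f + g) = sf_deriv p c f + sf_deriv p c g"
  by (auto simp: sf_deriv_def fun_eq_iff algebra_simps)

lemma sf_deriv_diff: "sf_deriv p c (f - g) = sf_deriv p c f - sf_deriv p c g"
  by (auto simp: sf_deriv_def fun_eq_iff algebra_simps)

lemma sf_deriv_zero [simp]: "sf_deriv p c 0 = 0"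
  by (auto simp: sf_deriv_def fun_eq_iff)

lemma sf_deriv_sum: "sf_deriv p c (sum f A) = (\<Sum>a\<in>A. sf_deriv p c (f a))"
  by (induction A rule: infinite_finite_induct)
      (simp_all only: sum.infinite sum.empty sum.insert not_False_eq_True sf_deriv_add sf_deriv_zero)

lemma sf_deriv_scale: "sf_deriv p c (sf_scale k f) = sf_scale k (sf_deriv p c f)"
  by (auto simp: sf_deriv_def sf_scale_def fun_eq_iff algebra_simps)

lemma sf_scale_scale [simp]: "sf_scale k (sf_scale l f) = sf_scale (k * l) f"
  by (auto simp: sf_scale_def fun_eq_iff)

lemma sf_scale_one [simp]: "sf_scale 1 f = f"
  by (auto simp: sf_scale_def)

lemma sf_scale_zero [simp]: "sf_scale k 0 = 0"
  by (auto simp: sf_scale_def fun_eq_iff)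

lemma sf_scale_zero_left [simp]: "sf_scale 0 f = 0"
  by (auto simp: sf_scale_def fun_eq_iff)

lemma sf_scale_minus_one: "sf_scale (- 1) f = - f"
  by (auto simp: sf_scale_def fun_eq_iff)

lemma sf_scale_add: "sf_scale k (f + g) = sf_scale k f + sf_scale k g"
  by (auto simp: sf_scale_def fun_eq_iff algebra_simps)

lemma sf_scale_add_left: "sf_scale (k + l) f = sf_scale k f + sf_scale l f"
  by (auto simp: sf_scale_def fun_eq_iff algebra_simps)

lemma sf_scale_sum: "sf_scale k (sum f A) = (\<Sum>a\<in>A. sf_scale k (f a))"
  by (induction A rule: infinite_finite_induct)
      (simp_all only: sum.infinite sum.empty sum.insert not_False_eq_True sf_scale_add sf_scale_zero)

lemma sf_scale_sum_left: "sf_scale (sum k A) f = (\<Sum>a\<in>A. sf_scale (k a) f)"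
  by (induction A rule: infinite_finite_induct)
      (simp_all only: sum.infinite sum.empty sum.insert not_False_eq_True sf_scale_add_left sf_scale_zero_left)

lemma sf_scale_const: "sf_scale k (sf_const D l) = sf_const D (k * l)"
  by (auto simp: sf_scale_def sf_const_def fun_eq_iff)

lemma sf_mult_add_left: "sf_mult (f + g) h = sf_mult f h + sf_mult g h"
  by (auto simp: sf_mult_def fun_eq_iff sum.distrib[symmetric] algebra_simps intro!: sum.cong)

lemma sf_mult_add_right: "sf_mult h (f + g) = sf_mult h f + sf_mult h g"
  by (auto simp: sf_mult_def fun_eq_iff sum.distrib[symmetric] algebra_simps intro!: sum.cong)

lemma sf_mult_zero_left [simp]: "sf_mult 0 f = 0"
  by (auto simp: sf_mult_def fun_eq_iff intro!: sum.neutral)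

lemma sf_mult_zero_right [simp]: "sf_mult f 0 = 0"
  by (auto simp: sf_mult_def fun_eq_iff intro!: sum.neutral)

lemma sf_mult_sum_left: "sf_mult (sum f A) g = (\<Sum>a\<in>A. sf_mult (f a) g)"
  by (induction A rule: infinite_finite_induct)
      (simp_all only: sum.infinite sum.empty sum.insert not_False_eq_True sf_mult_add_left sf_mult_zero_left)

lemma sf_mult_sum_right: "sf_mult g (sum f A) = (\<Sum>a\<in>A. sf_mult g (f a))"
  by (induction A rule: infinite_finite_induct)
      (simp_all only: sum.infinite sum.empty sum.insert not_False_eq_True sf_mult_add_right sf_mult_zero_right)

lemma sf_mult_scale_left: "sf_mult (sf_scale k f) g = sf_scale k (sf_mult f g)"
  by (auto simp: sf_mult_def sf_scale_def fun_eq_iff sum_distrib_left mult_ac intro!: sum.cong)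

lemma sf_mult_scale_right: "sf_mult f (sf_scale k g) = sf_scale k (sf_mult f g)"
  by (auto simp: sf_mult_def sf_scale_def fun_eq_iff sum_distrib_left mult_ac intro!: sum.cong)

text \<open>The parity involution, applied \<open>a\<close> times. It is what moving a symbol of
  parity \<open>a\<close> past a function does to that function, and it makes sense for
  inhomogeneous functions, where a single sign would not do.\<close>

definition sf_twist :: "nat \<Rightarrow> 'k::real_normed_field sfun \<Rightarrow> 'k sfun" where
  "sf_twist a f = (\<lambda>x \<alpha> I. (- 1) ^ (a * card I) * f x \<alpha> I)"

lemma sf_twist_add: "sf_twist a (f + g) = sf_twist a f + sf_twist a g"
  by (auto simp: sf_twist_def fun_eq_iff algebra_simps)

lemma sf_twist_zero [simp]: "sf_twist a 0 = 0"
  by (auto simp: sf_twist_def fun_eq_iff)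

lemma sf_twist_sum: "sf_twist a (sum f A) = (\<Sum>b\<in>A. sf_twist a (f b))"
  by (induction A rule: infinite_finite_induct)
      (simp_all only: sum.infinite sum.empty sum.insert not_False_eq_True sf_twist_add sf_twist_zero)

lemma sf_twist_twist: "sf_twist a (sf_twist b f) = sf_twist (a + b) f"
  by (auto simp: sf_twist_def fun_eq_iff power_add algebra_simps)

lemma sf_twist_cong: "even a = even b \<Longrightarrow> sf_twist a f = sf_twist b f"
  by (auto simp: sf_twist_def fun_eq_iff uminus_power_if)

lemma sf_twist_homogeneous:
  "sf_homogeneous d f \<Longrightarrow> sf_twist a f = sf_scale ((- 1) ^ (a * of_bool d)) f"
  by (auto simp: sf_twist_def fun_eq_iff sf_homogeneous_def sf_scale_def uminus_power_if)

lemma sf_twist_mult: "sf_twist a (sf_mult f g) = sf_mult (sf_twist a f) (sf_twist a g)"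
proof -
  have "(- 1) ^ (a * card I) * (\<Sum>J\<in>Pow I. shuffle_sign J (I - J) * f x \<beta> J * g x \<gamma> (I - J)) =
    (\<Sum>J\<in>Pow I. shuffle_sign J (I - J) * ((- 1) ^ (a * card J) * f x \<beta> J) *
      ((- 1) ^ (a * card (I - J)) * g x \<gamma> (I - J)))" for x \<beta> \<gamma> I
  proof (cases "finite I")
    case True
    have "(- 1::'a) ^ (a * card I) = (- 1) ^ (a * card J) * (- 1) ^ (a * card (I - J))" if "J \<subseteq> I" for J
      using True that by (simp flip: power_add distrib_left add: card_Diff_subset finite_subset card_mono)
    then show ?thesis by (auto simp: sum_distrib_left intro!: sum.cong)
  next
    \<comment> \<open>\<open>Pow I\<close> is infinite too, so both sums are 0 by
      convention.\<close>
    case False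
    then show ?thesis by simp
  qed
  then show ?thesis
    by (auto simp: sf_twist_def sf_mult_def fun_eq_iff sum_distrib_left intro!: sum.cong)
qed

lemma sf_deriv_commute:
  "sf_deriv p a (sf_deriv p b f) = sf_scale ((- 1) ^ (par p a * par p b)) (sf_deriv p b (sf_deriv p a f))"
proof -
  \<comment> \<open>For u < v, inserting u puts one more element in front of v, whereas inserting v
    puts none in front of u. This asymmetry is the whole sign.\<close>
  have sgn: "(- 1) ^ card {i\<in>I. i < u} * (- 1) ^ card {i\<in>insert u I. i < v} =
     - ((- 1) ^ card {i\<in>I. i < v} * (- 1::'a) ^ card {i\<in>insert v I. i < u})"
    if "u < v" "u \<notin> I" for u v :: nat and I
  proof -
    have "{i\<in>insert u I. i < v} = insert u {i\<in>I. i < v}" "{i\<in>insert v I. i < u} = {i\<in>I. i < u}"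
      using that by auto
    then show ?thesis using that by simp
  qed
  consider "a < p" "b < p" | "a < p" "\<not> b < p" | "\<not> a < p" "b < p" | "\<not> a < p" "\<not> b < p" by blast
  then show ?thesis
  proof cases
    case 1
    then show ?thesis
      by (cases "a = b") (auto simp: sf_deriv_def par_def sf_scale_def fun_eq_iff lookup_add lookup_single_not_eq add_ac mult_ac)
  next
    case 4
    have "sf_deriv p a (sf_deriv p b f) x \<alpha> I = - sf_deriv p b (sf_deriv p a f) x \<alpha> I" for x \<alpha> I
    proof (cases "a = b \<or> a - p \<in> I \<or> b - p \<in> I")
      case True
      then show ?thesis using 4 by (auto simp: sf_deriv_def)
    next
      case False
      then have "a - p < b - p \<or> b - p < a - p" using 4 by linarith
      with sgn[of "a - p" "b - p" I] sgn[of "b - p" "a - p" I]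
      show ?thesis using 4 False by (auto simp: sf_deriv_def insert_commute mult_ac)
    qed
    then show ?thesis using 4 by (auto simp: par_def sf_scale_def fun_eq_iff)
  qed (auto simp: sf_deriv_def par_def sf_scale_def fun_eq_iff)
qed

text \<open>The clause of \<open>superfunctions\<close> common to the three categories. Besides
  localizing f it makes the relevant I finite, without which \<open>card\<close> says nothing about
  parity.\<close>

definition sf_supported :: "nat \<Rightarrow> nat \<Rightarrow> (nat \<Rightarrow> 'k) set \<Rightarrow> 'k::real_normed_field sfun \<Rightarrow> bool" where
  "sf_supported p q D f \<longleftrightarrow>
     (\<forall>x \<alpha> I. f x \<alpha> I \<noteq> 0 \<longrightarrow> x \<in> D \<and> Poly_Mapping.keys \<alpha> \<subseteq> {..<p} \<and> I \<subseteq> {..<q})"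

lemma sf_supportedD:
  assumes "sf_supported p q D f"
  shows "x \<notin> D \<Longrightarrow> f x \<alpha> I = 0" "\<not> Poly_Mapping.keys \<alpha> \<subseteq> {..<p} \<Longrightarrow> f x \<alpha> I = 0"
    "\<not> I \<subseteq> {..<q} \<Longrightarrow> f x \<alpha> I = 0"
  using assms unfolding sf_supported_def by blast+

lemma superfunctions_supported: "f \<in> superfunctions cat p q D \<Longrightarrow> sf_supported p q D f"
  unfolding superfunctions_def sf_supported_def by blast

lemma sf_supported_zero: "sf_supported p q D 0"
  by (simp add: sf_supported_def)

lemma sf_supported_add: "sf_supported p q D f \<Longrightarrow> sf_supported p q D g \<Longrightarrow> sf_supported p q D (f + g)"
  unfolding sf_supported_def by (metis add.right_neutral plus_fun_def)

lemma sf_supported_scale: "sf_supported p q D f \<Longrightarrow> sf_supported p q D (sf_scale k f)"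
  unfolding sf_supported_def sf_scale_def by force

lemma keys_add_single_subset:
  "Poly_Mapping.keys (\<alpha> + Poly_Mapping.single c (1::nat)) \<subseteq> A \<longleftrightarrow> Poly_Mapping.keys \<alpha> \<subseteq> A \<and> c \<in> A"
  by (auto simp: Poly_Mapping.keys_def lookup_add lookup_single when_def split: if_splits)

lemma sf_supported_deriv:
  assumes "sf_supported p q D f"
  shows "sf_supported p q D (sf_deriv p c f)"
  using assms unfolding sf_supported_def sf_deriv_def
  by (smt (verit) keys_add_single_subset insert_subset mult_zero_right)

lemma sf_homogeneous_zero [simp]: "sf_homogeneous d 0"
  by (simp add: sf_homogeneous_def)

lemma sf_homogeneous_add: "sf_homogeneous d f \<Longrightarrow> sf_homogeneous d g \<Longrightarrow> sf_homogeneous d (f + g)"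
  unfolding sf_homogeneous_def by (metis add.right_neutral plus_fun_def)

lemma sf_homogeneous_scale: "sf_homogeneous d f \<Longrightarrow> sf_homogeneous d (sf_scale k f)"
  unfolding sf_homogeneous_def sf_scale_def by force

lemma sf_homogeneous_sum: "(\<And>a. a \<in> A \<Longrightarrow> sf_homogeneous d (f a)) \<Longrightarrow> sf_homogeneous d (sum f A)"
  by (induction A rule: infinite_finite_induct) (auto simp: sf_homogeneous_add)

lemma sf_homogeneous_const: "sf_homogeneous False (sf_const D k)"
  by (auto simp: sf_homogeneous_def sf_const_def)

lemma sf_homogeneous_deriv:
  assumes "sf_supported p q D f" "sf_homogeneous d f"
  shows "sf_homogeneous (d \<noteq> odd (par p c)) (sf_deriv p c f)"
proof -
  have "odd (card I) = (\<not> d)" if "c - p \<notin> I" "f x \<alpha> (insert (c - p) I) \<noteq> 0" for x \<alpha> I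
  proof -
    have "insert (c - p) I \<subseteq> {..<q}" using assms that unfolding sf_supported_def by blast
    then have "finite I" using finite_subset by fastforce
    then show ?thesis using assms(2) that unfolding sf_homogeneous_def by fastforce
  qed
  then show ?thesis
    using assms(2) by (auto simp: sf_homogeneous_def sf_deriv_def par_def)
qed

section \<open>Antiderivatives and the super Poincare lemma\<close>

text \<open>Products of discs instead of balls: moving one coordinate within its disc never leaves
  the set, which is all that integration along a single coordinate requires.\<close>

definition polydisc :: "nat \<Rightarrow> (nat \<Rightarrow> 'k::real_normed_field) \<Rightarrow> real \<Rightarrow> (nat \<Rightarrow> 'k) set" where
  "polydisc p x0 e = {x. (\<forall>i\<ge>p. x i = 0) \<and> (\<forall>i<p. norm (x i - x0 i) < e)}"

text \<open>On jets, integration along an even coordinate is an index shift, except for the coefficients without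
  that coordinate, which are integrated along the segment from the centre. In an odd direction it is
  multiplication by the coordinate, which inverts the derivative on functions not depending on it.\<close>

definition sf_antideriv :: "nat \<Rightarrow> (nat \<Rightarrow> 'k::{real_normed_field,banach}) \<Rightarrow> (nat \<Rightarrow> 'k) set \<Rightarrow> nat \<Rightarrow>
    'k sfun \<Rightarrow> 'k sfun" where
  "sf_antideriv p x0 D k f = (\<lambda>x \<alpha> I.
     if k < p then
       if x \<notin> D then 0
       else if mexp \<alpha> k > 0 then
         f x (\<alpha> - Poly_Mapping.single k 1) I / of_nat (mexp \<alpha> k)
       else integral {0..1} (\<lambda>\<tau>. (x k - x0 k) * f (x(k := x0 k + of_real \<tau> * (x k - x0 k))) \<alpha> I)
     else if k - p \<in> I then (- 1) ^ card {i \<in> I. i < k - p} * f x \<alpha> (I - {k - p})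
     else 0)"

lemma polydisc_upd:
  assumes "x \<in> polydisc p x0 e" "i < p" "u \<in> ball (x0 i) e"
  shows "x(i := u) \<in> polydisc p x0 e"
  using assms by (auto simp: polydisc_def dist_norm norm_minus_commute)

lemma polydisc_ball: "x \<in> polydisc p x0 e \<Longrightarrow> i < p \<Longrightarrow> x i \<in> ball (x0 i) e"
  by (auto simp: polydisc_def dist_norm norm_minus_commute)

lemma ball_segment:
  fixes c :: "'k::real_normed_field"
  assumes "u \<in> ball c e" "\<tau> \<in> {0..1}"
  shows "c + of_real \<tau> * (u - c) \<in> ball c e"
proof -
  have "\<tau> * norm (u - c) \<le> 1 * norm (u - c)" using assms by (intro mult_right_mono) auto
  then show ?thesis using assms by (auto simp: dist_norm norm_mult norm_minus_commute)
qed

text \<open>Differentiation under the integral reduces the claim to the fundamental theorem on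
  [0,1]. Only a continuous derivative in the sense of the ground field is used, so real and complex
  primitives are obtained alike, without Cauchy's theorem.\<close>

lemma segment_integral_deriv:
  fixes g g' :: "'k::{real_normed_field,banach} \<Rightarrow> 'k"
  assumes g: "\<And>u. u \<in> ball c e \<Longrightarrow> (g has_field_derivative g' u) (at u)"
    and g': "continuous_on (ball c e) g'" and u: "u \<in> ball c e"
  shows "((\<lambda>u. integral {0..1} (\<lambda>\<tau>. (u - c) * g (c + of_real \<tau> * (u - c)))) has_field_derivative g u) (at u)"
proof -
  have cg: "continuous_on (ball c e) g"
    using g by (meson DERIV_isCont continuous_at_imp_continuous_on)
  let ?s = "\<lambda>u \<tau>. c + of_real \<tau> * (u - c)"
  have cs: "continuous_on (ball c e \<times> cbox 0 (1::real)) (\<lambda>z. ?s (fst z) (snd z))"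
    by (intro continuous_intros)
  have ss: "(\<lambda>z. ?s (fst z) (snd z)) ` (ball c e \<times> cbox 0 1) \<subseteq> ball c e"
    using ball_segment by fastforce
  let ?fx = "\<lambda>u \<tau>. g (?s u \<tau>) + (u - c) * (of_real \<tau> * g' (?s u \<tau>))"
  have deriv: "((\<lambda>u. integral (cbox 0 1) (\<lambda>\<tau>. (u - c) * g (?s u \<tau>))) has_field_derivative
      integral (cbox 0 1) (?fx u)) (at u within ball c e)"
  proof (rule leibniz_rule_field_derivative)
    fix v and t :: real assume v: "v \<in> ball c e" "t \<in> cbox 0 1"
    then have "?s v t \<in> ball c e" using ball_segment by fastforce
    then have "((\<lambda>x. (x - c) * g (?s x t)) has_field_derivative ?fx v t) (at v)"
      by (auto intro!: derivative_eq_intros DERIV_chain2[OF g] simp: algebra_simps)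
    then show "((\<lambda>x. (x - c) * g (?s x t)) has_field_derivative ?fx v t) (at v within ball c e)"
      by (rule has_field_derivative_at_within)
  next
    fix v assume v: "v \<in> ball c e"
    have "continuous_on (cbox 0 1) (\<lambda>\<tau>. g (?s v \<tau>))"
      by (rule continuous_on_compose2[OF cg]) (use ball_segment[OF v] in \<open>auto intro!: continuous_intros\<close>)
    then show "(\<lambda>\<tau>. (v - c) * g (?s v \<tau>)) integrable_on cbox 0 1"
      by (intro integrable_continuous continuous_intros)
  next
    have "continuous_on (ball c e \<times> cbox 0 1) (\<lambda>z. g (?s (fst z) (snd z)))"
      "continuous_on (ball c e \<times> cbox 0 1) (\<lambda>z. g' (?s (fst z) (snd z)))"
      using continuous_on_compose2[OF cg cs ss] continuous_on_compose2[OF g' cs ss] by simp_all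
    then show "continuous_on (ball c e \<times> cbox 0 1) (\<lambda>(u, \<tau>). ?fx u \<tau>)"
      unfolding split_def by (intro continuous_intros)
  qed (use u in auto)
  \<comment> \<open>The differentiated integrand is itself the derivative of
    \<open>\<tau> * g (c + \<tau> * (u - c))\<close> in \<tau>, so its integral is the value of this
    function at \<tau> = 1.\<close>
  have "(?fx u has_integral (of_real 1 * g (?s u 1) - of_real 0 * g (?s u 0))) {0..1}"
  proof (rule fundamental_theorem_of_calculus)
    fix t :: real assume t: "t \<in> {0..1}"
    have "((\<lambda>z. z * g (c + z * (u - c))) has_field_derivative ?fx u t) (at (of_real t))"
      using ball_segment[OF u t]
      by (auto intro!: derivative_eq_intros DERIV_chain2[OF g] simp: algebra_simps)
    moreover have "((of_real :: real \<Rightarrow> 'k) has_vector_derivative 1) (at t)"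
      by (auto intro!: derivative_eq_intros)
    ultimately have "((\<lambda>z. z * g (c + z * (u - c))) \<circ> of_real has_vector_derivative 1 * ?fx u t) (at t)"
      by (intro field_vector_diff_chain_at)
    then show "((\<lambda>\<tau>. of_real \<tau> * g (?s u \<tau>)) has_vector_derivative ?fx u t) (at t within {0..1})"
      by (auto simp: o_def intro: has_vector_derivative_at_within)
  qed simp
  then have "integral {0..1} (?fx u) = g u" by (simp add: integral_unique)
  then show ?thesis using deriv at_within_open[OF u open_ball] by simp
qed

lemma continuous_on_upd:
  fixes x :: "'a::topological_space \<Rightarrow> nat \<Rightarrow> 'k::topological_space"
  assumes "continuous_on S x" "continuous_on S u"
  shows "continuous_on S (\<lambda>z. (x z)(i := u z))"
proof (rule continuous_on_coordinatewise_then_product)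
  fix j
  show "continuous_on S (\<lambda>z. ((x z)(i := u z)) j)"
    using assms by (cases "j = i") (auto intro: continuous_on_product_then_coordinatewise)
qed

lemma one_plus_of_nat_neq_0 [simp]: "1 + of_nat n \<noteq> (0::'k::real_normed_field)"
  using of_nat_neq_0[of n, where 'a = 'k] by simp

section \<open>Smooth systems of jets\<close>

lemma smooth_jetsI:
  assumes "\<And>\<alpha> I. continuous_on D (\<lambda>x. f x \<alpha> I)"
    and "\<And>\<alpha> I i x. i < p \<Longrightarrow> x \<in> D \<Longrightarrow> ((\<lambda>u. f (x(i := u)) \<alpha> I) has_field_derivative
      of_nat (mexp \<alpha> i + 1) * f x (\<alpha> + Poly_Mapping.single i 1) I) (at (x i))"
  shows "smooth_jets p D f"
  using assms unfolding smooth_jets_def by blast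

lemma smooth_jetsD:
  assumes "smooth_jets p D f"
  shows "continuous_on D (\<lambda>x. f x \<alpha> I)"
    and "i < p \<Longrightarrow> x \<in> D \<Longrightarrow> ((\<lambda>u. f (x(i := u)) \<alpha> I) has_field_derivative
      of_nat (mexp \<alpha> i + 1) * f x (\<alpha> + Poly_Mapping.single i 1) I) (at (x i))"
  using assms unfolding smooth_jets_def by blast+

lemma smooth_jets_add:
  assumes "smooth_jets p D f" "smooth_jets p D g"
  shows "smooth_jets p D (f + g)"
proof (rule smooth_jetsI)
  show "continuous_on D (\<lambda>x. (f + g) x \<alpha> I)" for \<alpha> I
    unfolding plus_fun_apply by (intro continuous_intros smooth_jetsD(1)[OF assms(1)] smooth_jetsD(1)[OF assms(2)])
  show "((\<lambda>u. (f + g) (x(i := u)) \<alpha> I) has_field_derivative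
      of_nat (mexp \<alpha> i + 1) * (f + g) x (\<alpha> + Poly_Mapping.single i 1) I) (at (x i))"
    if "i < p" "x \<in> D" for \<alpha> I i x
    unfolding plus_fun_apply distrib_left by (intro DERIV_add smooth_jetsD(2)[OF assms(1)] smooth_jetsD(2)[OF assms(2)] that)
qed

text \<open>Factors depending on I alone and changes of I commute with the even derivatives.
  Scalings, odd derivatives, odd antiderivatives and parity twists are all of this form.\<close>

lemma smooth_jets_coeff_mult:
  assumes "smooth_jets p D f"
  shows "smooth_jets p D (\<lambda>x \<alpha> I. k I * f x \<alpha> (h I))"
proof (rule smooth_jetsI)
  show "continuous_on D (\<lambda>x. k I * f x \<alpha> (h I))" for \<alpha> I
    by (intro continuous_intros smooth_jetsD[OF assms])
  show "((\<lambda>u. k I * f (x(i := u)) \<alpha> (h I)) has_field_derivative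
      of_nat (mexp \<alpha> i + 1) * (k I * f x (\<alpha> + Poly_Mapping.single i 1) (h I))) (at (x i))"
    if "i < p" "x \<in> D" for \<alpha> I i x
    unfolding mult.left_commute[of _ "k I"] by (intro DERIV_cmult smooth_jetsD[OF assms] that)
qed

lemma smooth_jets_scale: "smooth_jets p D f \<Longrightarrow> smooth_jets p D (sf_scale k f)"
  unfolding sf_scale_def by (rule smooth_jets_coeff_mult)

lemma smooth_jets_deriv:
  assumes "smooth_jets p D f"
  shows "smooth_jets p D (sf_deriv p c f)"
proof (cases "c < p")
  case True
  let ?l = mexp and ?s = "\<lambda>i. Poly_Mapping.single i (1::nat)"
  have cont: "\<And>\<alpha> I. continuous_on D (\<lambda>x. f x \<alpha> I)"
    and der: "\<And>\<alpha> I i x. i < p \<Longrightarrow> x \<in> D \<Longrightarrow>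
      ((\<lambda>u. f (x(i := u)) \<alpha> I) has_field_derivative of_nat (?l \<alpha> i + 1) * f x (\<alpha> + ?s i) I) (at (x i))"
    using smooth_jetsD[OF assms] by blast+
  have "((\<lambda>u. of_nat (?l \<alpha> c + 1) * f (x(i := u)) (\<alpha> + ?s c) I) has_field_derivative
      of_nat (?l \<alpha> i + 1) * (of_nat (?l (\<alpha> + ?s i) c + 1) * f x (\<alpha> + ?s i + ?s c) I)) (at (x i))"
    if "i < p" "x \<in> D" for \<alpha> I i x
  proof (rule DERIV_cong[OF DERIV_cmult[OF der[OF that]]])
    have "\<alpha> + ?s c + ?s i = \<alpha> + ?s i + ?s c" by (simp only: add_ac)
    then show "of_nat (?l \<alpha> c + 1) * (of_nat (?l (\<alpha> + ?s c) i + 1) * f x (\<alpha> + ?s c + ?s i) I) =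
        of_nat (?l \<alpha> i + 1) * (of_nat (?l (\<alpha> + ?s i) c + 1) * f x (\<alpha> + ?s i + ?s c) I)"
      by (cases "i = c") (simp_all only: lookup_add lookup_single_not_eq add_0_right mult.left_commute not_False_eq_True)
  qed
  then show ?thesis
    using True by (intro smooth_jetsI) (simp_all only: sf_deriv_def if_True, intro continuous_intros cont)
next
  case False
  have "sf_deriv p c f = (\<lambda>x \<alpha> I. (if c - p \<in> I then 0 else (- 1) ^ card {i \<in> I. i < c - p}) *
      f x \<alpha> (insert (c - p) I))"
    using False by (auto simp: sf_deriv_def fun_eq_iff)
  then show ?thesis
    using smooth_jets_coeff_mult[OF assms, of "\<lambda>I. if c - p \<in> I then 0 else (- 1) ^ card {i \<in> I. i < c - p}"
        "insert (c - p)"] by simp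
qed

lemma smooth_jets_antideriv:
  fixes f :: "'k::{real_normed_field,banach} sfun"
  assumes f: "smooth_jets p (polydisc p x0 e) f"
  shows "smooth_jets p (polydisc p x0 e) (sf_antideriv p x0 (polydisc p x0 e) k f)"
proof (cases "k < p")
  case k: True
  let ?l = mexp and ?s = "\<lambda>i. Poly_Mapping.single i (1::nat)" and ?D = "polydisc p x0 e"
  let ?J = "sf_antideriv p x0 ?D k f"
  let ?int = "\<lambda>x \<alpha> I. integral {0..1} (\<lambda>\<tau>. (x k - x0 k) * f (x(k := x0 k + of_real \<tau> * (x k - x0 k))) \<alpha> I)"
  have cont: "\<And>\<alpha> I. continuous_on ?D (\<lambda>x. f x \<alpha> I)"
    and der: "\<And>\<alpha> I i x. i < p \<Longrightarrow> x \<in> ?D \<Longrightarrow>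
      ((\<lambda>u. f (x(i := u)) \<alpha> I) has_field_derivative of_nat (?l \<alpha> i + 1) * f x (\<alpha> + ?s i) I) (at (x i))"
    using smooth_jetsD[OF f] by blast+
  have Jpos: "?J x \<alpha> I = f x (\<alpha> - ?s k) I / of_nat (?l \<alpha> k)" if "x \<in> ?D" "?l \<alpha> k > 0" for x \<alpha> I
    using that k by (simp add: sf_antideriv_def)
  have Jzero: "?J x \<alpha> I = ?int x \<alpha> I" if "x \<in> ?D" "?l \<alpha> k = 0" for x \<alpha> I
    using that k by (simp add: sf_antideriv_def)
  have seg: "x(k := x0 k + of_real \<tau> * (x k - x0 k)) \<in> ?D" if "x \<in> ?D" "\<tau> \<in> {0..1}" for x \<tau>
    using that k by (intro polydisc_upd ball_segment polydisc_ball)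
  have cseg: "continuous_on (S \<times> T) (\<lambda>z. f ((y (fst z))(k := x0 k + of_real (snd z) * (y (fst z) k - x0 k))) \<alpha> I)"
    if "continuous_on S y" "y ` S \<subseteq> ?D" "T \<subseteq> {0..1}"
    for S :: "'c::topological_space set" and T y \<alpha> I
  proof (rule continuous_on_compose2[OF cont])
    have "continuous_on (S \<times> T) (\<lambda>z. y (fst z))"
      by (rule continuous_on_compose2[OF that(1)]) (auto intro!: continuous_intros)
    then show "continuous_on (S \<times> T) (\<lambda>z. (y (fst z))(k := x0 k + of_real (snd z) * (y (fst z) k - x0 k)))"
      by (intro continuous_on_upd continuous_intros) (auto intro: continuous_on_product_then_coordinatewise)
    have "y (fst z) \<in> ?D" "snd z \<in> {0..1}" if "z \<in> S \<times> T" for z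
      using that \<open>y ` S \<subseteq> ?D\<close> \<open>T \<subseteq> {0..1}\<close> by auto
    then show "(\<lambda>z. (y (fst z))(k := x0 k + of_real (snd z) * (y (fst z) k - x0 k))) ` (S \<times> T) \<subseteq> ?D"
      by (intro image_subsetI seg)
  qed
  have co: "continuous_on S (\<lambda>x. x i)" for S :: "(nat \<Rightarrow> 'k) set" and i
    by (rule continuous_on_subset[OF continuous_on_product_coordinates]) simp
  have "continuous_on ?D (\<lambda>x. ?J x \<alpha> I)" for \<alpha> I
  proof (cases "?l \<alpha> k > 0")
    case True
    have "continuous_on ?D (\<lambda>x. f x (\<alpha> - ?s k) I / of_nat (?l \<alpha> k))"
      using True cont by (intro continuous_intros) auto
    then show ?thesis by (rule continuous_on_eq) (use Jpos True in simp)
  next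
    case False
    have "continuous_on ?D (\<lambda>x. integral (cbox 0 1)
        (\<lambda>\<tau>. (x k - x0 k) * f (x(k := x0 k + of_real \<tau> * (x k - x0 k))) \<alpha> I))"
    proof (rule integral_continuous_on_param)
      have "continuous_on (?D \<times> cbox 0 1) (\<lambda>z. f ((fst z)(k := x0 k + of_real (snd z) * (fst z k - x0 k))) \<alpha> I)"
        using cseg[of ?D "\<lambda>x. x" "cbox 0 1" \<alpha> I] by simp
      moreover have "continuous_on (?D \<times> cbox 0 (1::real)) (\<lambda>z. fst z k)"
        by (rule continuous_on_compose2[OF co[of UNIV k] continuous_on_fst[OF continuous_on_id]]) simp
      ultimately show "continuous_on (?D \<times> cbox 0 1)
          (\<lambda>(x, \<tau>). (x k - x0 k) * f (x(k := x0 k + of_real \<tau> * (x k - x0 k))) \<alpha> I)"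
        unfolding split_def by (intro continuous_intros)
    qed
    then show ?thesis by (rule continuous_on_eq) (use Jzero False in simp)
  qed
  moreover have "((\<lambda>u. ?J (x(i := u)) \<alpha> I) has_field_derivative of_nat (?l \<alpha> i + 1) * ?J x (\<alpha> + ?s i) I) (at (x i))"
    if i: "i < p" and x: "x \<in> ?D" for \<alpha> I i x
  proof -
    \<comment> \<open>\<open>?J\<close> is 0 off the polydisc. \<open>?G\<close> is the same formula
      without this cutoff; both agree while coordinate i stays in its disc, so they have the same
      derivative at \<open>x i\<close>.\<close>
    let ?G = "\<lambda>x. if ?l \<alpha> k > 0 then f x (\<alpha> - ?s k) I / of_nat (?l \<alpha> k) else ?int x \<alpha> I"
    have xb: "x i \<in> ball (x0 i) e" using polydisc_ball[OF x i] .
    have "((\<lambda>u. ?G (x(i := u))) has_field_derivative of_nat (?l \<alpha> i + 1) * ?J x (\<alpha> + ?s i) I) (at (x i))"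
    proof (cases "?l \<alpha> k > 0")
      case True
      have "?s i + (\<alpha> - ?s k) = \<alpha> + ?s i - ?s k"
        using True by (intro poly_mapping_eqI) (auto simp: lookup_add lookup_minus lookup_single when_def)
      then have "of_nat (?l (\<alpha> - ?s k) i + 1) * f x (\<alpha> - ?s k + ?s i) I / of_nat (?l \<alpha> k) =
          of_nat (?l \<alpha> i + 1) * ?J x (\<alpha> + ?s i) I"
        using True x Jpos[of x "\<alpha> + ?s i"]
        by (cases "i = k") (auto simp: lookup_add lookup_minus lookup_single_not_eq add_ac)
      then have "((\<lambda>u. f (x(i := u)) (\<alpha> - ?s k) I / of_nat (?l \<alpha> k)) has_field_derivative
          of_nat (?l \<alpha> i + 1) * ?J x (\<alpha> + ?s i) I) (at (x i))"
        using DERIV_cdivide[OF der[OF i x, of "\<alpha> - ?s k" I]] by metis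
      then show ?thesis using True by simp
    next
      case False
      show ?thesis
      proof (cases "i = k")
        \<comment> \<open>The jet on the right has exponent 1 in direction k and is therefore a
          shifted coefficient of f, while the left side is the primitive along the segment.\<close>
        case ik: True
        have "((\<lambda>u. integral {0..1} (\<lambda>\<tau>. (u - x0 k) * f (x(k := x0 k + of_real \<tau> * (u - x0 k))) \<alpha> I))
          has_field_derivative f (x(k := x k)) \<alpha> I) (at (x k))"
        proof (rule segment_integral_deriv)
          show "x k \<in> ball (x0 k) e" using xb ik by simp
          show "((\<lambda>u. f (x(k := u)) \<alpha> I) has_field_derivative of_nat (?l \<alpha> k + 1) * f (x(k := u)) (\<alpha> + ?s k) I) (at u)"
            if "u \<in> ball (x0 k) e" for u
            using der[OF k polydisc_upd[OF x k that], of \<alpha> I] by simp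
          show "continuous_on (ball (x0 k) e) (\<lambda>u. of_nat (?l \<alpha> k + 1) * f (x(k := u)) (\<alpha> + ?s k) I)"
            by (intro continuous_intros continuous_on_compose2[OF cont] continuous_on_upd)
              (use polydisc_upd[OF x k] in auto)
        qed
        then show ?thesis using False ik Jpos[OF x, of "\<alpha> + ?s k"] by (simp add: lookup_add)
      next
        \<comment> \<open>Moving another coordinate displaces the whole segment within the polydisc.
          The derivative is taken under the integral, and the next jet of f is the continuous
          derivative of the integrand.\<close>
        case ik: False
        let ?y = "\<lambda>u. x(i := u)"
        have yD: "?y ` ball (x0 i) e \<subseteq> ?D" using polydisc_upd[OF x i] by auto
        have cy: "continuous_on (ball (x0 i) e) ?y" by (intro continuous_on_upd continuous_intros)
        let ?g = "\<lambda>\<beta> u \<tau>. f ((?y u)(k := x0 k + of_real \<tau> * (?y u k - x0 k))) \<beta> I"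
        have cg: "continuous_on (ball (x0 i) e \<times> cbox 0 1) (\<lambda>z. ?g \<beta> (fst z) (snd z))" for \<beta>
          using cseg[OF cy yD, of "cbox 0 1" \<beta> I] by simp
        have "((\<lambda>u. integral (cbox 0 1) (\<lambda>\<tau>. (?y u k - x0 k) * ?g \<alpha> u \<tau>)) has_field_derivative
            integral (cbox 0 1) (\<lambda>\<tau>. (x k - x0 k) * (of_nat (?l \<alpha> i + 1) * ?g (\<alpha> + ?s i) (x i) \<tau>)))
            (at (x i) within ball (x0 i) e)"
        proof (rule leibniz_rule_field_derivative
            [where fx = "\<lambda>u \<tau>. (x k - x0 k) * (of_nat (?l \<alpha> i + 1) * ?g (\<alpha> + ?s i) u \<tau>)"])
          fix u and t :: real assume u: "u \<in> ball (x0 i) e" "t \<in> cbox 0 1"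
          let ?z = "x(k := x0 k + of_real t * (x k - x0 k))"
          have "?z(i := u) \<in> ?D"
            using u by (intro polydisc_upd[OF seg i]) (auto simp: x)
          then have "((\<lambda>v. f ((?z(i := u))(i := v)) \<alpha> I) has_field_derivative
              of_nat (?l \<alpha> i + 1) * f (?z(i := u)) (\<alpha> + ?s i) I) (at ((?z(i := u)) i))"
            by (rule der[OF i])
          moreover have "?z(i := v) = (?y v)(k := x0 k + of_real t * (?y v k - x0 k))" for v
            using ik by (auto simp: fun_upd_twist)
          ultimately have "((\<lambda>v. ?g \<alpha> v t) has_field_derivative of_nat (?l \<alpha> i + 1) * ?g (\<alpha> + ?s i) u t) (at u)"
            using ik by simp
          from DERIV_cmult[OF this, of "x k - x0 k"]
          show "((\<lambda>v. (?y v k - x0 k) * ?g \<alpha> v t) has_field_derivative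
              (x k - x0 k) * (of_nat (?l \<alpha> i + 1) * ?g (\<alpha> + ?s i) u t)) (at u within ball (x0 i) e)"
            using ik by (auto intro: has_field_derivative_at_within)
        next
          fix u assume u: "u \<in> ball (x0 i) e"
          have "continuous_on (cbox 0 1) (\<lambda>\<tau>. ?g \<alpha> (fst (u, \<tau>)) (snd (u, \<tau>)))"
            by (rule continuous_on_compose2[OF cg]) (use u in \<open>auto intro!: continuous_intros\<close>)
          then show "(\<lambda>\<tau>. (?y u k - x0 k) * ?g \<alpha> u \<tau>) integrable_on cbox 0 1"
            by (intro integrable_continuous continuous_intros) simp
        next
          show "continuous_on (ball (x0 i) e \<times> cbox 0 1)
              (\<lambda>(u, \<tau>). (x k - x0 k) * (of_nat (?l \<alpha> i + 1) * ?g (\<alpha> + ?s i) u \<tau>))"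
            unfolding split_def by (intro continuous_intros cg)
        qed (use xb in auto)
        moreover have "integral (cbox 0 1) (\<lambda>\<tau>. (x k - x0 k) * (of_nat (?l \<alpha> i + 1) * ?g (\<alpha> + ?s i) (x i) \<tau>))
            = of_nat (?l \<alpha> i + 1) * ?J x (\<alpha> + ?s i) I"
          using Jzero[OF x, of "\<alpha> + ?s i" I] ik False
          by (simp add: lookup_add lookup_single_not_eq mult.left_commute[of "x k - x0 k"]
              flip: integral_mult_right del: of_nat_Suc of_nat_add)
        ultimately have "((\<lambda>u. integral (cbox 0 1) (\<lambda>\<tau>. (?y u k - x0 k) * ?g \<alpha> u \<tau>)) has_field_derivative
            of_nat (?l \<alpha> i + 1) * ?J x (\<alpha> + ?s i) I) (at (x i))"
          by (simp only: at_within_open[OF xb open_ball])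
        then show ?thesis by (simp only: False if_False cbox_interval)
      qed
    qed
    moreover have "?G (x(i := u)) = ?J (x(i := u)) \<alpha> I" if "u \<in> ball (x0 i) e" for u
      using polydisc_upd[OF x i that] Jpos Jzero by auto
    ultimately show ?thesis
      by (rule has_field_derivative_transform_within_open[OF _ open_ball xb])
  qed
  ultimately show ?thesis by (intro smooth_jetsI)
next
  case False
  have "sf_antideriv p x0 D k f = (\<lambda>x \<alpha> I. (if k - p \<in> I then (- 1) ^ card {i \<in> I. i < k - p} else 0) *
      f x \<alpha> (I - {k - p}))" for D
    using False by (auto simp: sf_antideriv_def fun_eq_iff)
  then show ?thesis
    using smooth_jets_coeff_mult[OF f, of "\<lambda>I. if k - p \<in> I then (- 1) ^ card {i \<in> I. i < k - p} else 0"
        "\<lambda>I. I - {k - p}"] by simp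
qed

text \<open>The derivative only sees coefficients with a positive exponent of k, hence only the
  shift branch of the antiderivative. The integral branch is there to make the jets at different
  points compatible. As the antiderivative is cut off outside D, so must f be.\<close>

lemma deriv_antideriv_even:
  assumes "k < p" "\<And>x \<alpha> I. x \<notin> D \<Longrightarrow> f x \<alpha> I = 0"
  shows "sf_deriv p k (sf_antideriv p x0 D k f) = f"
  using assms by (auto simp: sf_deriv_def sf_antideriv_def lookup_add fun_eq_iff)

lemma deriv_antideriv_odd:
  assumes k: "\<not> k < p" and f: "sf_deriv p k f = 0"
  shows "sf_deriv p k (sf_antideriv p x0 D k f) = f"
proof -
  have "f x \<alpha> (insert (k - p) I) = 0" if "k - p \<notin> I" for x \<alpha> I
    using fun_cong[OF fun_cong[OF fun_cong[OF f]], of x \<alpha> I] k that by (simp add: sf_deriv_def)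
  then have f0: "f x \<alpha> I = 0" if "k - p \<in> I" for x \<alpha> I
    using that by (metis Diff_iff insertI1 insert_Diff)
  have "{i. (i = k - p \<or> i \<in> I) \<and> i < k - p} = {i \<in> I. i < k - p}" for I by auto
  then show ?thesis
    using k f0 by (auto simp: sf_deriv_def sf_antideriv_def fun_eq_iff)
qed

text \<open>On jets, a vanishing derivative in direction i means that all coefficients involving
  coordinate i are 0, and this at every point. The integrand is then identically 0, so no exchange
  of derivative and integral occurs.\<close>

lemma deriv_antideriv_other:
  assumes ik: "i \<noteq> k" and f: "sf_deriv p i f = 0"
  shows "sf_deriv p i (sf_antideriv p x0 D k f) = 0"
proof -
  have d0: "sf_deriv p i f x \<alpha> I = 0" for x \<alpha> I using f by (simp add: zero_fun_def)
  show ?thesis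
  proof (cases "i < p")
    case i: True
    have "(1 + of_nat (mexp \<alpha> i)) * f x (\<alpha> + Poly_Mapping.single i 1) I = 0" for x \<alpha> I
      using d0[of x \<alpha> I] i by (simp add: sf_deriv_def)
    then have f0: "f x (\<alpha> + Poly_Mapping.single i (Suc 0)) I = 0" for x \<alpha> I
      using one_plus_of_nat_neq_0 by (metis One_nat_def mult_eq_0_iff)
    have "\<alpha> + Poly_Mapping.single i (Suc 0) - Poly_Mapping.single k (Suc 0) =
        \<alpha> - Poly_Mapping.single k (Suc 0) + Poly_Mapping.single i (Suc 0)" for \<alpha> :: "nat \<Rightarrow>\<^sub>0 nat"
      using ik by (intro poly_mapping_eqI) (auto simp: lookup_add lookup_minus lookup_single when_def)
    then show ?thesis using i f0 by (auto simp: sf_deriv_def sf_antideriv_def fun_eq_iff)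
  next
    case i: False
    have f0: "f x \<alpha> (insert (i - p) I) = 0" if "i - p \<notin> I" for x \<alpha> I
      using d0[of x \<alpha> I] i that by (simp add: sf_deriv_def)
    have "f x \<alpha> (insert (i - p) I - {k - p}) = 0" if "i - p \<notin> I" "\<not> k < p" for x \<alpha> I
      using f0[of "I - {k - p}" x \<alpha>] i ik that by (auto simp: insert_Diff_if)
    then have "sf_deriv p i (sf_antideriv p x0 D k f) x \<alpha> I = 0" for x \<alpha> I
      by (cases "k < p"; cases "i - p \<in> I") (simp_all add: sf_deriv_def sf_antideriv_def i f0)
    then show ?thesis by (simp add: fun_eq_iff)
  qed
qed

lemma sf_supported_antideriv:
  assumes f: "sf_supported p q D f" and k: "k < p + q"
  shows "sf_supported p q D (sf_antideriv p x0 D k f)"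
  unfolding sf_supported_def
proof (intro allI impI)
  fix x \<alpha> I assume nz: "sf_antideriv p x0 D k f x \<alpha> I \<noteq> 0"
  note f0 = sf_supportedD[OF f]
  show "x \<in> D \<and> Poly_Mapping.keys \<alpha> \<subseteq> {..<p} \<and> I \<subseteq> {..<q}"
  proof (cases "k < p")
    case True
    show ?thesis
    proof (cases "mexp \<alpha> k > 0")
      case l: True
      then have "\<alpha> = \<alpha> - Poly_Mapping.single k 1 + Poly_Mapping.single k 1"
        by (intro poly_mapping_eqI) (auto simp: lookup_add lookup_minus lookup_single when_def)
      moreover have "x \<in> D \<and> Poly_Mapping.keys (\<alpha> - Poly_Mapping.single k 1) \<subseteq> {..<p} \<and> I \<subseteq> {..<q}"
      proof -
        have "x \<in> D \<and> f x (\<alpha> - Poly_Mapping.single k 1) I \<noteq> 0"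
          using nz True l by (simp add: sf_antideriv_def split: if_splits)
        then show ?thesis using f0 by blast
      qed
      ultimately show ?thesis using True by (metis keys_add_single_subset lessThan_iff)
    next
      case False
      have "\<exists>y. f y \<alpha> I \<noteq> 0"
      proof (rule ccontr)
        assume "\<not> (\<exists>y. f y \<alpha> I \<noteq> 0)"
        then have "sf_antideriv p x0 D k f x \<alpha> I = 0" using True False by (simp add: sf_antideriv_def)
        with nz show False by simp
      qed
      moreover have "x \<in> D" using nz True by (simp add: sf_antideriv_def split: if_splits)
      ultimately show ?thesis using f0(2,3) by blast
    qed
  next
    case False
    then have "k - p \<in> I" "f x \<alpha> (I - {k - p}) \<noteq> 0"
      using nz by (auto simp: sf_antideriv_def split: if_splits)
    then have "x \<in> D" "Poly_Mapping.keys \<alpha> \<subseteq> {..<p}" "I - {k - p} \<subseteq> {..<q}" using f0 by blast+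
    then show ?thesis using False k by auto
  qed
qed

lemma sf_homogeneous_antideriv:
  assumes f: "sf_supported p q D f" and d: "sf_homogeneous (d \<noteq> odd (par p k)) f"
  shows "sf_homogeneous d (sf_antideriv p x0 D k f)"
proof (cases "k < p")
  case True
  then have f0: "f x \<alpha> I = 0" if "odd (card I) \<noteq> d" for x \<alpha> I
    using d that by (auto simp: sf_homogeneous_def par_def)
  have "sf_antideriv p x0 D k f x \<alpha> I = 0" if "odd (card I) \<noteq> d" for x \<alpha> I
    using True by (simp add: sf_antideriv_def f0[OF that])
  then show ?thesis unfolding sf_homogeneous_def by blast
next
  case False
  have "odd (card I) = d" if "k - p \<in> I" "f x \<alpha> (I - {k - p}) \<noteq> 0" for x \<alpha> I
  proof -
    have "I - {k - p} \<subseteq> {..<q}" using that f unfolding sf_supported_def by blast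
    then have "finite (I - {k - p})" using finite_subset by blast
    moreover have "odd (card (I - {k - p})) = (d \<noteq> odd (par p k))"
      using that(2) d unfolding sf_homogeneous_def by blast
    moreover have "Suc (card (I - {k - p})) = card I"
      using calculation(1) that by (intro card_Suc_Diff1) auto
    ultimately show ?thesis using False by (auto simp: par_def simp flip: even_Suc)
  qed
  then show ?thesis using False by (auto simp: sf_homogeneous_def sf_antideriv_def split: if_splits)
qed

section \<open>Geometric bounds on jets\<close>

definition multi_degree :: "nat \<Rightarrow> (nat \<Rightarrow>\<^sub>0 nat) \<Rightarrow> nat" where
  "multi_degree p \<alpha> = (\<Sum>i<p. mexp \<alpha> i)"

lemma multi_degree_add: "multi_degree p (\<alpha> + \<beta>) = multi_degree p \<alpha> + multi_degree p \<beta>"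
  by (simp add: multi_degree_def lookup_add sum.distrib)

lemma multi_degree_single: "multi_degree p (Poly_Mapping.single i n) = (if i < p then n else 0)"
  by (simp add: multi_degree_def lookup_single when_def sum.delta)

lemma lookup_le_multi_degree: "i < p \<Longrightarrow> mexp \<alpha> i \<le> multi_degree p \<alpha>"
  unfolding multi_degree_def by (intro member_le_sum) auto

text \<open>K is an inverse radius of convergence. It is chosen before I because
  \<open>analytic_jets\<close> asks for one radius for all I, and it is at least 1 so that its
  powers grow with the degree.\<close>

definition sf_bounded :: "nat \<Rightarrow> (nat \<Rightarrow> 'k) set \<Rightarrow> 'k::real_normed_field sfun \<Rightarrow> bool" where
  "sf_bounded p D f \<longleftrightarrow>
     (\<exists>K\<ge>1. \<forall>I. \<exists>M\<ge>0. \<forall>x\<in>D. \<forall>\<alpha>. norm (f x \<alpha> I) \<le> M * K ^ multi_degree p \<alpha>)"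

lemma sf_bounded_coeff_mult:
  assumes "sf_bounded p D f"
  shows "sf_bounded p D (\<lambda>x \<alpha> I. k I * f x \<alpha> (h I))"
proof -
  obtain K where K: "K \<ge> 1" "\<And>I. \<exists>M\<ge>0. \<forall>x\<in>D. \<forall>\<alpha>. norm (f x \<alpha> I) \<le> M * K ^ multi_degree p \<alpha>"
    using assms unfolding sf_bounded_def by blast
  have "\<exists>M\<ge>0. \<forall>x\<in>D. \<forall>\<alpha>. norm (k I * f x \<alpha> (h I)) \<le> M * K ^ multi_degree p \<alpha>" for I
  proof -
    obtain M where M: "M \<ge> 0" "\<forall>x\<in>D. \<forall>\<alpha>. norm (f x \<alpha> (h I)) \<le> M * K ^ multi_degree p \<alpha>" using K by blast
    then show ?thesis
      by (intro exI[of _ "norm (k I) * M"]) (auto simp: norm_mult mult.assoc intro!: mult_left_mono)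
  qed
  then show ?thesis using K(1) unfolding sf_bounded_def by blast
qed

lemma sf_bounded_add:
  assumes "sf_bounded p D f" "sf_bounded p D g"
  shows "sf_bounded p D (f + g)"
proof -
  obtain K where K: "K \<ge> 1" "\<And>I. \<exists>M\<ge>0. \<forall>x\<in>D. \<forall>\<alpha>. norm (f x \<alpha> I) \<le> M * K ^ multi_degree p \<alpha>"
    using assms unfolding sf_bounded_def by blast
  obtain L where L: "L \<ge> 1" "\<And>I. \<exists>M\<ge>0. \<forall>x\<in>D. \<forall>\<alpha>. norm (g x \<alpha> I) \<le> M * L ^ multi_degree p \<alpha>"
    using assms unfolding sf_bounded_def by blast
  have "\<exists>M\<ge>0. \<forall>x\<in>D. \<forall>\<alpha>. norm ((f + g) x \<alpha> I) \<le> M * max K L ^ multi_degree p \<alpha>" for I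
  proof -
    obtain M N where M: "M \<ge> 0" "\<forall>x\<in>D. \<forall>\<alpha>. norm (f x \<alpha> I) \<le> M * K ^ multi_degree p \<alpha>"
      and N: "N \<ge> 0" "\<forall>x\<in>D. \<forall>\<alpha>. norm (g x \<alpha> I) \<le> N * L ^ multi_degree p \<alpha>" using K L by metis
    have "norm (f x \<alpha> I + g x \<alpha> I) \<le> (M + N) * max K L ^ multi_degree p \<alpha>" if "x \<in> D" for x \<alpha>
    proof -
      have "norm (f x \<alpha> I + g x \<alpha> I) \<le> M * K ^ multi_degree p \<alpha> + N * L ^ multi_degree p \<alpha>"
        using M N that by (intro norm_triangle_le add_mono) auto
      also have "\<dots> \<le> M * max K L ^ multi_degree p \<alpha> + N * max K L ^ multi_degree p \<alpha>"
        using M N K(1) L(1) by (intro add_mono mult_left_mono power_mono) auto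
      finally show ?thesis by (simp add: distrib_right)
    qed
    then show ?thesis using M N by (intro exI[of _ "M + N"]) auto
  qed
  moreover have "max K L \<ge> 1" using K(1) by simp
  ultimately show ?thesis unfolding sf_bounded_def by blast
qed

lemma sf_bounded_deriv:
  assumes f: "sf_bounded p D f"
  shows "sf_bounded p D (sf_deriv p c f)"
proof (cases "c < p")
  case True
  obtain K where K: "K \<ge> 1" "\<And>I. \<exists>M\<ge>0. \<forall>x\<in>D. \<forall>\<alpha>. norm (f x \<alpha> I) \<le> M * K ^ multi_degree p \<alpha>"
    using assms unfolding sf_bounded_def by blast
  \<comment> \<open>The factor produced by differentiation is at most 2^|\<alpha>|, which doubling K
    absorbs; the extra unit of degree goes into the constant \<open>M * K\<close>.\<close>
  have "\<exists>M\<ge>0. \<forall>x\<in>D. \<forall>\<alpha>. norm (sf_deriv p c f x \<alpha> I) \<le> M * (2 * K) ^ multi_degree p \<alpha>" for I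
  proof -
    obtain M where M: "M \<ge> 0" "\<forall>x\<in>D. \<forall>\<alpha>. norm (f x \<alpha> I) \<le> M * K ^ multi_degree p \<alpha>" using K by blast
    have "norm (sf_deriv p c f x \<alpha> I) \<le> M * K * (2 * K) ^ multi_degree p \<alpha>" if "x \<in> D" for x \<alpha>
    proof -
      let ?n = "mexp \<alpha> c + 1"
      have "?n \<le> 2 ^ mexp \<alpha> c" by (simp add: Suc_leI)
      then have "real ?n \<le> real (2 ^ mexp \<alpha> c)" by (rule of_nat_mono)
      also have "\<dots> = 2 ^ mexp \<alpha> c" by simp
      also have "\<dots> \<le> 2 ^ multi_degree p \<alpha>" using lookup_le_multi_degree[OF True] by (intro power_increasing) auto
      finally have n: "real ?n \<le> 2 ^ multi_degree p \<alpha>" .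
      have "norm (sf_deriv p c f x \<alpha> I) = real ?n * norm (f x (\<alpha> + Poly_Mapping.single c 1) I)"
        using True by (simp only: sf_deriv_def if_True norm_mult norm_of_nat)
      also have "\<dots> \<le> 2 ^ multi_degree p \<alpha> * (M * K ^ multi_degree p (\<alpha> + Poly_Mapping.single c 1))"
        using n M that by (intro mult_mono) auto
      also have "\<dots> = M * K * (2 * K) ^ multi_degree p \<alpha>"
        using True by (simp add: multi_degree_add multi_degree_single power_mult_distrib)
      finally show ?thesis .
    qed
    then show ?thesis using M K(1) by (intro exI[of _ "M * K"]) auto
  qed
  moreover have "2 * K \<ge> 1" using K(1) by simp
  ultimately show ?thesis unfolding sf_bounded_def by blast
next
  case False
  have "sf_deriv p c f = (\<lambda>x \<alpha> I. (if c - p \<in> I then 0 else (- 1) ^ card {i \<in> I. i < c - p}) *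
      f x \<alpha> (insert (c - p) I))"
    using False by (auto simp: sf_deriv_def fun_eq_iff)
  then show ?thesis
    using sf_bounded_coeff_mult[OF f, of "\<lambda>I. if c - p \<in> I then 0 else (- 1) ^ card {i \<in> I. i < c - p}"
        "insert (c - p)"] by simp
qed

text \<open>Integrability need not be assumed, since the integral of a non-integrable function is 0
  by convention. Thus the bounds on antiderivatives are independent of continuity.\<close>

lemma norm_integral_unit_interval_le:
  fixes f :: "real \<Rightarrow> 'a::banach"
  assumes "\<And>t. t \<in> {0..1} \<Longrightarrow> norm (f t) \<le> B"
  shows "norm (integral {0..1} f) \<le> B"
proof -
  have "0 \<le> B" using order_trans[OF norm_ge_zero assms[of 0]] by simp
  show ?thesis
  proof (cases "f integrable_on cbox 0 1")
    case True
    from has_integral_bound[OF \<open>0 \<le> B\<close> integrable_integral[OF this]] assms show ?thesis by simp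
  next
    case False
    then show ?thesis using \<open>0 \<le> B\<close> by (simp add: not_integrable_integral)
  qed
qed

lemma sf_bounded_antideriv:
  fixes f :: "'k::{real_normed_field,banach} sfun"
  assumes f: "sf_bounded p (polydisc p x0 e) f"
  shows "sf_bounded p (polydisc p x0 e) (sf_antideriv p x0 (polydisc p x0 e) k f)"
proof (cases "k < p")
  case k: True
  let ?D = "polydisc p x0 e"
  obtain K where K: "K \<ge> 1" "\<And>I. \<exists>M\<ge>0. \<forall>x\<in>?D. \<forall>\<alpha>. norm (f x \<alpha> I) \<le> M * K ^ multi_degree p \<alpha>"
    using assms unfolding sf_bounded_def by blast
  have "\<exists>M\<ge>0. \<forall>x\<in>?D. \<forall>\<alpha>. norm (sf_antideriv p x0 ?D k f x \<alpha> I) \<le> M * K ^ multi_degree p \<alpha>" for I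
  proof -
    obtain M where M: "M \<ge> 0" "\<And>x \<alpha>. x \<in> ?D \<Longrightarrow> norm (f x \<alpha> I) \<le> M * K ^ multi_degree p \<alpha>" using K by blast
    \<comment> \<open>One constant for both branches: the index shift needs M, and integration
      contributes the length of the segment, which is less than e.\<close>
    let ?N = "M * (1 + \<bar>e\<bar>)"
    have MN: "M * t \<le> ?N * t" "\<bar>e\<bar> * (M * t) \<le> ?N * t" if "t \<ge> 0" for t
      using M(1) that by (auto simp: algebra_simps)
    have "norm (sf_antideriv p x0 ?D k f x \<alpha> I) \<le> ?N * K ^ multi_degree p \<alpha>" if x: "x \<in> ?D" for x \<alpha>
    proof (cases "mexp \<alpha> k > 0")
      case True
      let ?\<beta> = "\<alpha> - Poly_Mapping.single k 1"
      have "\<alpha> = ?\<beta> + Poly_Mapping.single k 1"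
        using True by (intro poly_mapping_eqI) (auto simp: lookup_add lookup_minus lookup_single when_def)
      then have "multi_degree p ?\<beta> \<le> multi_degree p \<alpha>" by (metis le_add1 multi_degree_add)
      have "norm (sf_antideriv p x0 ?D k f x \<alpha> I) = norm (f x ?\<beta> I) / mexp \<alpha> k"
        using True k x by (simp add: sf_antideriv_def norm_divide)
      also have "\<dots> \<le> norm (f x ?\<beta> I) / 1" using True by (intro divide_left_mono) auto
      also have "\<dots> \<le> M * K ^ multi_degree p ?\<beta>" using M(2)[OF x] by simp
      also have "\<dots> \<le> M * K ^ multi_degree p \<alpha>"
        using M(1) K(1) \<open>multi_degree p ?\<beta> \<le> _\<close> by (intro mult_left_mono power_increasing) auto
      also have "\<dots> \<le> ?N * K ^ multi_degree p \<alpha>" using MN(1) K(1) by simp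
      finally show ?thesis .
    next
      case False
      have "norm (integral {0..1} (\<lambda>\<tau>. (x k - x0 k) * f (x(k := x0 k + of_real \<tau> * (x k - x0 k))) \<alpha> I)) \<le>
          \<bar>e\<bar> * (M * K ^ multi_degree p \<alpha>)"
      proof (rule norm_integral_unit_interval_le)
        fix \<tau> :: real assume "\<tau> \<in> {0..1}"
        then have "x(k := x0 k + of_real \<tau> * (x k - x0 k)) \<in> ?D"
          using x k by (intro polydisc_upd ball_segment polydisc_ball)
        moreover have "norm (x k - x0 k) \<le> \<bar>e\<bar>" using x k by (auto simp: polydisc_def)
        ultimately show "norm ((x k - x0 k) * f (x(k := x0 k + of_real \<tau> * (x k - x0 k))) \<alpha> I) \<le>
            \<bar>e\<bar> * (M * K ^ multi_degree p \<alpha>)"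
          unfolding norm_mult by (intro mult_mono M(2)) auto
      qed
      also have "\<dots> \<le> ?N * K ^ multi_degree p \<alpha>" using MN(2) K(1) by simp
      finally show ?thesis using False k x by (simp add: sf_antideriv_def)
    qed
    moreover have "?N \<ge> 0" using M(1) by simp
    ultimately show ?thesis by blast
  qed
  then show ?thesis using K(1) unfolding sf_bounded_def by blast
next
  case False
  have "sf_antideriv p x0 D k f = (\<lambda>x \<alpha> I. (if k - p \<in> I then (- 1) ^ card {i \<in> I. i < k - p} else 0) *
      f x \<alpha> (I - {k - p}))" for D
    using False by (auto simp: sf_antideriv_def fun_eq_iff)
  then show ?thesis
    using sf_bounded_coeff_mult[OF f, of "\<lambda>I. if k - p \<in> I then (- 1) ^ card {i \<in> I. i < k - p} else 0"
        "\<lambda>I. I - {k - p}"] by simp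
qed

text \<open>In the analytic category the bounds are uniform on \<open>D\<close>, so that they survive integration along
  segments that leave the neighbourhood of a point.\<close>

definition tame :: "category \<Rightarrow> nat \<Rightarrow> nat \<Rightarrow> (nat \<Rightarrow> 'k) set \<Rightarrow> 'k::real_normed_field sfun \<Rightarrow> bool" where
  "tame cat p q D f \<longleftrightarrow> sf_supported p q D f \<and> (cat \<noteq> Formal \<longrightarrow> smooth_jets p D f) \<and>
     (cat = Analytic \<longrightarrow> sf_bounded p D f)"

lemma tame_zero: "tame cat p q D 0"
proof -
  have "smooth_jets p D 0" by (simp add: smooth_jets_def)
  moreover have "sf_bounded p D 0"
    unfolding sf_bounded_def by (rule exI[of _ 1]) (auto intro: exI[of _ 0])
  ultimately show ?thesis by (simp add: tame_def sf_supported_zero)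
qed

lemma tame_add: "tame cat p q D f \<Longrightarrow> tame cat p q D g \<Longrightarrow> tame cat p q D (f + g)"
  by (simp add: tame_def sf_supported_add smooth_jets_add sf_bounded_add)

lemma tame_scale: "tame cat p q D f \<Longrightarrow> tame cat p q D (sf_scale k f)"
  using sf_bounded_coeff_mult[of p D f "\<lambda>_. k" "\<lambda>I. I"]
  by (simp add: tame_def sf_supported_scale smooth_jets_scale) (simp add: sf_scale_def)

lemma tame_diff:
  assumes "tame cat p q D f" "tame cat p q D g"
  shows "tame cat p q D (f - g)"
proof -
  have "f - g = f + sf_scale (- 1) g" by (auto simp: sf_scale_def fun_eq_iff)
  then show ?thesis using assms by (simp only: tame_add tame_scale)
qed

lemma tame_deriv: "tame cat p q D f \<Longrightarrow> tame cat p q D (sf_deriv p c f)"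
  by (simp add: tame_def sf_supported_deriv smooth_jets_deriv sf_bounded_deriv)

lemma tame_antideriv:
  assumes "tame cat p q D f" "k < p + q" "cat = Formal \<or> D = polydisc p x0 e"
  shows "tame cat p q D (sf_antideriv p x0 D k f)"
  using assms by (auto simp: tame_def sf_supported_antideriv smooth_jets_antideriv sf_bounded_antideriv)

lemma sf_homogeneous_diff:
  assumes "sf_homogeneous d f" "sf_homogeneous d g"
  shows "sf_homogeneous d (f - g)"
proof -
  have "f - g = f + sf_scale (- 1) g" by (auto simp: sf_scale_def fun_eq_iff)
  then show ?thesis using assms by (simp only: sf_homogeneous_add sf_homogeneous_scale)
qed

text \<open>The coordinates are treated one after the other, the even and the odd ones alike: when
  \<open>\<partial>\<^sub>b A = \<omega> b\<close> holds for \<open>b < n\<close>, the derivatives of \<open>\<omega> n - \<partial>\<^sub>n A\<close> along these \<open>b\<close> vanish,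
  and they still vanish after integration along the \<open>n\<close>-th coordinate.\<close>

lemma super_poincare:
  fixes \<omega> :: "nat \<Rightarrow> 'k::{real_normed_field,banach} sfun"
  assumes D: "cat = Formal \<or> D = polydisc p x0 e"
    and \<omega>: "\<And>b. b < p + q \<Longrightarrow> tame cat p q D (\<omega> b)"
    and hom: "\<And>b. b < p + q \<Longrightarrow> sf_homogeneous (d \<noteq> odd (par p b)) (\<omega> b)"
    and closed: "\<And>a b. a < p + q \<Longrightarrow> b < p + q \<Longrightarrow>
      sf_deriv p a (\<omega> b) = sf_scale ((- 1) ^ (par p a * par p b)) (sf_deriv p b (\<omega> a))"
  obtains A where "tame cat p q D A" "sf_homogeneous d A" "\<And>b. b < p + q \<Longrightarrow> sf_deriv p b A = \<omega> b"
proof -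
  have "\<exists>A. tame cat p q D A \<and> sf_homogeneous d A \<and> (\<forall>b<n. sf_deriv p b A = \<omega> b)" if "n \<le> p + q" for n
    using that
  proof (induction n)
    case 0
    show ?case by (intro exI[of _ 0] conjI tame_zero sf_homogeneous_zero) simp
  next
    case (Suc n)
    then obtain A where A: "tame cat p q D A" "sf_homogeneous d A" "\<And>b. b < n \<Longrightarrow> sf_deriv p b A = \<omega> b"
      by auto
    have n: "n < p + q" using Suc by simp
    define g where "g = \<omega> n - sf_deriv p n A"
    have g: "tame cat p q D g" unfolding g_def by (intro tame_diff tame_deriv \<omega> n A)
    have sg: "sf_supported p q D g" "sf_supported p q D A" using g A by (simp_all add: tame_def)
    have hg: "sf_homogeneous (d \<noteq> odd (par p n)) g"
      unfolding g_def by (intro sf_homogeneous_diff hom n sf_homogeneous_deriv[OF sg(2)] A)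
    let ?J = "sf_antideriv p x0 D n g"
    have "sf_deriv p n ?J = g"
    proof (cases "n < p")
      case True
      then show ?thesis using sf_supportedD(1)[OF sg(1)] by (rule deriv_antideriv_even)
    next
      case False
      \<comment> \<open>For an odd index, closedness with both indices equal to n says that a
        function is its own negative, and so does anticommutation for the second derivative of A. In
        characteristic 0 both vanish.\<close>
      have neg: "f = sf_scale (- 1) f \<Longrightarrow> f = 0" for f :: "'k sfun"
        by (auto simp: fun_eq_iff sf_scale_def equal_neg_zero) 
      have "sf_deriv p n (\<omega> n) = 0" "sf_deriv p n (sf_deriv p n A) = 0"
        using closed[OF n n] sf_deriv_commute[of p n n A] False by (auto intro!: neg simp: par_def)
      then have "sf_deriv p n g = 0" by (simp add: g_def sf_deriv_diff)
      with False show ?thesis by (rule deriv_antideriv_odd)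
    qed
    moreover have "sf_deriv p b ?J = 0" if "b < n" for b
    proof (rule deriv_antideriv_other)
      have "b < p + q" using that n by simp
      \<comment> \<open>Closedness and the commutation of derivatives carry the same sign, so both
        terms of the difference equal that sign times the n-th derivative of
        \<open>\<omega> b\<close>.\<close>
      then show "sf_deriv p b g = 0"
        unfolding g_def sf_deriv_diff using closed[of b n] n sf_deriv_commute[of p b n A] A(3)[OF that] by simp
    qed (use that in simp)
    ultimately have "sf_deriv p b (A + ?J) = \<omega> b" if "b < Suc n" for b
      using A(3) that by (cases "b = n") (simp_all add: sf_deriv_add g_def)
    moreover have "tame cat p q D (A + ?J)" by (intro tame_add A tame_antideriv[OF g n D])
    moreover have "sf_homogeneous d (A + ?J)"
      by (intro sf_homogeneous_add A sf_homogeneous_antideriv[OF sg(1) hg])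
    ultimately show ?case by blast
  qed
  then show ?thesis using that by blast
qed

section \<open>Power series and Taylor expansions\<close>

text \<open>General index sets J: convergence is proved by adding one variable at a time, and series
  are sliced by taking one variable out.\<close>

definition multi_indices :: "nat set \<Rightarrow> (nat \<Rightarrow>\<^sub>0 nat) set" where
  "multi_indices J = {\<alpha>. Poly_Mapping.keys \<alpha> \<subseteq> J}"

definition monomial :: "nat set \<Rightarrow> (nat \<Rightarrow> 'a) \<Rightarrow> (nat \<Rightarrow>\<^sub>0 nat) \<Rightarrow> 'a::comm_monoid_mult" where
  "monomial J z \<alpha> = (\<Prod>j\<in>J. z j ^ mexp \<alpha> j)"

lemma multi_indices_lookup: "\<alpha> \<in> multi_indices J \<longleftrightarrow> (\<forall>j. j \<notin> J \<longrightarrow> mexp \<alpha> j = 0)"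
  by (auto simp: multi_indices_def in_keys_iff subset_iff)

lemma multi_indices_empty: "multi_indices {} = {0}"
  by (simp add: multi_indices_def)

lemma monomial_cong: "(\<And>j. j \<in> J \<Longrightarrow> y j = z j) \<Longrightarrow> monomial J y \<alpha> = monomial J z \<alpha>"
  unfolding monomial_def by (intro prod.cong) auto

lemma monomial_const: "monomial {..<p} (\<lambda>_. c) \<alpha> = c ^ multi_degree p \<alpha>"
  by (simp add: monomial_def multi_degree_def power_sum)

lemma norm_monomial: "norm (monomial J z \<alpha>) = monomial J (\<lambda>j. norm (z j)) \<alpha>"
  for z :: "nat \<Rightarrow> 'a::real_normed_field"
  by (simp add: monomial_def norm_power flip: prod_norm)

lemma monomial_mult: "monomial J (\<lambda>j. y j * z j) \<alpha> = monomial J y \<alpha> * monomial J z \<alpha>"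
  by (simp add: monomial_def power_mult_distrib prod.distrib)

lemma monomial_nonneg: "(\<And>j. j \<in> J \<Longrightarrow> t j \<ge> (0::real)) \<Longrightarrow> monomial J t \<alpha> \<ge> 0"
  unfolding monomial_def by (intro prod_nonneg) auto

lemma monomial_mono:
  "(\<And>j. j \<in> J \<Longrightarrow> 0 \<le> s j \<and> s j \<le> (t j::real)) \<Longrightarrow> monomial J s \<alpha> \<le> monomial J t \<alpha>"
  unfolding monomial_def by (intro prod_mono) (auto intro: power_mono)

lemma monomial_add_single:
  assumes "finite J" "i \<notin> J" "\<beta> \<in> multi_indices J"
  shows "monomial (insert i J) z (\<beta> + Poly_Mapping.single i n) = monomial J z \<beta> * z i ^ n"
proof -
  have "monomial J z (\<beta> + Poly_Mapping.single i n) = monomial J z \<beta>"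
    unfolding monomial_def using assms(2)
    by (intro prod.cong refl) (auto simp: lookup_add lookup_single when_def)
  then show ?thesis
    using assms by (simp add: monomial_def lookup_add multi_indices_lookup mult.commute)
qed

text \<open>Singling out the exponent of i turns a sum over multi-indices into a double sum, which
  can then be evaluated iteratively.\<close>

lemma bij_betw_multi_indices_insert:
  assumes "i \<notin> J"
  shows "bij_betw (\<lambda>(n, \<beta>). \<beta> + Poly_Mapping.single i n) (UNIV \<times> multi_indices J) (multi_indices (insert i J))"
proof (rule bij_betw_byWitness[where f' = "\<lambda>\<alpha>. (mexp \<alpha> i, \<alpha> - Poly_Mapping.single i (mexp \<alpha> i))"])
  show "\<forall>a\<in>UNIV \<times> multi_indices J. (mexp (case a of (n, \<beta>) \<Rightarrow> \<beta> + Poly_Mapping.single i n) i,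
      (case a of (n, \<beta>) \<Rightarrow> \<beta> + Poly_Mapping.single i n) - Poly_Mapping.single i
      (mexp (case a of (n, \<beta>) \<Rightarrow> \<beta> + Poly_Mapping.single i n) i)) = a"
    using assms by (auto simp: multi_indices_lookup lookup_add)
  show "\<forall>\<alpha>\<in>multi_indices (insert i J). (case (mexp \<alpha> i, \<alpha> - Poly_Mapping.single i (mexp \<alpha> i)) of
      (n, \<beta>) \<Rightarrow> \<beta> + Poly_Mapping.single i n) = \<alpha>"
    by (auto intro!: poly_mapping_eqI simp: lookup_add lookup_minus lookup_single when_def)
qed (auto simp: multi_indices_lookup lookup_add lookup_minus lookup_single when_def)

lemma monomial_summable:
  fixes t :: "nat \<Rightarrow> real"
  assumes "finite J" "\<And>j. j \<in> J \<Longrightarrow> 0 \<le> t j \<and> t j < 1"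
  shows "monomial J t summable_on multi_indices J"
  using assms
proof (induction J rule: finite_induct)
  case empty
  then show ?case by (simp add: multi_indices_empty)
next
  case (insert i J)
  let ?b = "\<lambda>(n, \<beta>). \<beta> + Poly_Mapping.single i n"
  have J: "monomial J t summable_on multi_indices J" using insert by simp
  have "(\<lambda>(n, \<beta>). monomial J t \<beta> * t i ^ n) summable_on (SIGMA n:UNIV. multi_indices J)"
  proof (rule summable_on_SigmaI)
    show "((\<lambda>\<beta>. case (n, \<beta>) of (n, \<beta>) \<Rightarrow> monomial J t \<beta> * t i ^ n) has_sum
        infsum (monomial J t) (multi_indices J) * t i ^ n) (multi_indices J)" for n
      using J by (auto intro!: has_sum_cmult_left)
    have "(\<lambda>n. t i ^ n) summable_on UNIV"
      using insert.prems by (subst summable_on_UNIV_nonneg_real_iff) (auto intro: summable_geometric)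
    then show "(\<lambda>n. infsum (monomial J t) (multi_indices J) * t i ^ n) summable_on UNIV"
      by (rule summable_on_cmult_right)
    show "0 \<le> (case (n, \<beta>) of (n, \<beta>) \<Rightarrow> monomial J t \<beta> * t i ^ n)" for n \<beta>
      using insert.prems by (auto intro!: mult_nonneg_nonneg monomial_nonneg)
  qed
  then have "(\<lambda>x. monomial (insert i J) t (?b x)) summable_on (UNIV \<times> multi_indices J)"
    using insert.hyps by (subst summable_on_cong[where g = "\<lambda>(n, \<beta>). monomial J t \<beta> * t i ^ n"])
      (auto simp: monomial_add_single)
  then show ?case
    using summable_on_reindex_bij_betw[OF bij_betw_multi_indices_insert[OF insert.hyps(2)], of "monomial (insert i J) t"]
    by simp
qed

lemma dominated_abs_summable:
  fixes g :: "'a \<Rightarrow> 'b::banach"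
  assumes "h summable_on A" "\<And>x. x \<in> A \<Longrightarrow> norm (g x) \<le> h x"
  shows "g abs_summable_on A"
  by (rule summable_on_comparison_test[OF assms(1)]) (simp_all add: assms(2))

text \<open>Comparison with the product of geometric series of ratios
  \<open>norm (z j) * K\<close>.\<close>

lemma power_series_abs_summable:
  fixes d :: "(nat \<Rightarrow>\<^sub>0 nat) \<Rightarrow> 'k::{real_normed_field,banach}"
  assumes d: "\<And>\<beta>. norm (d \<beta>) \<le> M * K ^ multi_degree p \<beta>" and "K \<ge> 0"
    and z: "\<And>j. j < p \<Longrightarrow> norm (z j) * K < 1"
  shows "(\<lambda>\<beta>. d \<beta> * monomial {..<p} z \<beta>) abs_summable_on multi_indices {..<p}"
proof (rule dominated_abs_summable)
  show "(\<lambda>\<beta>. M * monomial {..<p} (\<lambda>j. norm (z j) * K) \<beta>) summable_on multi_indices {..<p}"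
    using assms by (intro summable_on_cmult_right monomial_summable) auto
  show "norm (d \<beta> * monomial {..<p} z \<beta>) \<le> M * monomial {..<p} (\<lambda>j. norm (z j) * K) \<beta>" for \<beta>
    using mult_right_mono[OF d[of \<beta>], of "monomial {..<p} (\<lambda>j. norm (z j)) \<beta>"]
    by (simp add: norm_mult norm_monomial monomial_mult monomial_const monomial_nonneg mult_ac)
qed

text \<open>For J without i this is the coefficient of \<open>z i ^ n\<close> after the other
  variables have been summed. The value \<open>z i\<close> does not enter it.\<close>

definition slice_coeff :: "nat set \<Rightarrow> nat \<Rightarrow> ((nat \<Rightarrow>\<^sub>0 nat) \<Rightarrow> 'k) \<Rightarrow> (nat \<Rightarrow> 'k::real_normed_field) \<Rightarrow> nat \<Rightarrow> 'k" where
  "slice_coeff J i d z n = (\<Sum>\<^sub>\<infinity>\<beta>\<in>multi_indices J. d (\<beta> + Poly_Mapping.single i n) * monomial J z \<beta>)"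

lemma power_series_slice:
  fixes d :: "(nat \<Rightarrow>\<^sub>0 nat) \<Rightarrow> 'k::{real_normed_field,banach}"
  assumes d: "\<And>\<beta>. norm (d \<beta>) \<le> M * K ^ multi_degree p \<beta>" and K: "K \<ge> 0"
    and z: "\<And>j. j < p \<Longrightarrow> norm (z j) * K < 1" and i: "i < p"
  defines "a \<equiv> slice_coeff ({..<p} - {i}) i d z"
  shows "summable (\<lambda>n. a n * z i ^ n)"
    and "((\<lambda>\<beta>. d \<beta> * monomial {..<p} z \<beta>) has_sum (suminf (\<lambda>n. a n * z i ^ n))) (multi_indices {..<p})"
proof -
  define J where "J = {..<p} - {i}"
  have J: "finite J" "i \<notin> J" "insert i J = {..<p}" using i by (auto simp: J_def)
  let ?f = "\<lambda>(n, \<beta>). d (\<beta> + Poly_Mapping.single i n) * monomial J z \<beta> * z i ^ n"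
  let ?b = "\<lambda>(n, \<beta>). \<beta> + Poly_Mapping.single i n"
  have "(\<lambda>\<beta>. d \<beta> * monomial {..<p} z \<beta>) summable_on multi_indices {..<p}"
    by (rule abs_summable_summable, rule power_series_abs_summable[OF d K z])
  then obtain S where S: "((\<lambda>\<beta>. d \<beta> * monomial {..<p} z \<beta>) has_sum S) (multi_indices {..<p})"
    unfolding summable_on_def by blast
  have bij: "bij_betw ?b (UNIV \<times> multi_indices J) (multi_indices {..<p})"
    using bij_betw_multi_indices_insert[OF J(2)] unfolding J(3) .
  from S have S': "((\<lambda>x. d (?b x) * monomial {..<p} z (?b x)) has_sum S) (UNIV \<times> multi_indices J)"
    by (rule has_sum_reindex_bij_betw[OF bij, THEN iffD2])
  have eq: "d (?b x) * monomial {..<p} z (?b x) = ?f x" if "x \<in> UNIV \<times> multi_indices J" for x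
  proof (cases x)
    case (Pair n \<beta>)
    with that have "\<beta> \<in> multi_indices J" by simp
    from monomial_add_single[OF J(1,2) this, of z n] show ?thesis by (simp add: Pair J(3))
  qed
  have "((\<lambda>x. d (?b x) * monomial {..<p} z (?b x)) has_sum S) (UNIV \<times> multi_indices J) \<longleftrightarrow>
      (?f has_sum S) (UNIV \<times> multi_indices J)"
    by (intro has_sum_cong eq)
  with S' have f: "(?f has_sum S) (UNIV \<times> multi_indices J)" by (rule iffD1[rotated])
  have "((\<lambda>\<beta>. ?f (n, \<beta>)) has_sum a n * z i ^ n) (multi_indices J)" for n
  proof -
    have "(\<lambda>\<beta>. d (\<beta> + Poly_Mapping.single i n) * monomial J z \<beta> * z i ^ n) summable_on multi_indices J"
    proof -
      have "?f summable_on Pair n ` multi_indices J"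
        by (rule summable_on_subset_banach[OF has_sum_imp_summable[OF f]]) auto
      then show ?thesis by (subst (asm) summable_on_reindex) (auto simp: o_def inj_on_def)
    qed
    from has_sum_infsum[OF this] show ?thesis
      by (simp add: infsum_cmult_left' a_def slice_coeff_def J_def)
  qed
  from has_sum_SigmaD[OF f this] have "((\<lambda>n. a n * z i ^ n) has_sum S) UNIV" by simp
  then have "(\<lambda>n. a n * z i ^ n) sums S" by (rule has_sum_imp_sums)
  then show "summable (\<lambda>n. a n * z i ^ n)"
    "((\<lambda>\<beta>. d \<beta> * monomial {..<p} z \<beta>) has_sum (suminf (\<lambda>n. a n * z i ^ n))) (multi_indices {..<p})"
    using S by (auto simp: sums_iff)
qed

lemma Suc_le_two_power: "real (n + 1) \<le> 2 ^ n"
proof -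
  have "n + 1 \<le> 2 ^ n" by (simp add: Suc_leI)
  then have "real (n + 1) \<le> real (2 ^ n)" by (rule of_nat_mono)
  then show ?thesis by simp
qed

text \<open>Freezing all variables but one leaves a power series in one variable, since the slice
  coefficients do not change when \<open>z i\<close> is replaced by u. Termwise differentiation in
  one variable then applies, and slicing the differentiated series identifies the result.\<close>

lemma power_series_deriv:
  fixes d :: "(nat \<Rightarrow>\<^sub>0 nat) \<Rightarrow> 'k::{real_normed_field,banach}"
  assumes d: "\<And>\<beta>. norm (d \<beta>) \<le> M * K ^ multi_degree p \<beta>" and K: "K \<ge> 1" and M: "M \<ge> 0"
    and z: "\<And>j. j < p \<Longrightarrow> norm (z j) * (2 * K) < 1" and i: "i < p"
    and S: "open S" "z i \<in> S"
    and G: "\<And>u. u \<in> S \<Longrightarrow> ((\<lambda>\<beta>. d \<beta> * monomial {..<p} (z(i := u)) \<beta>) has_sum G u) (multi_indices {..<p})"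
  obtains G' where "(G has_field_derivative G') (at (z i))"
    "((\<lambda>\<beta>. of_nat (mexp \<beta> i + 1) * d (\<beta> + Poly_Mapping.single i 1) * monomial {..<p} z \<beta>)
      has_sum G') (multi_indices {..<p})"
proof
  let ?J = "{..<p} - {i}"
  define a where "a = slice_coeff ?J i d z"
  have z1: "norm (z j) * K < 1" if "j < p" for j
    using z[OF that] mult_nonneg_nonneg[of "norm (z j)" K] K by (simp add: mult_ac)
  have a_upd: "slice_coeff ?J i d (z(i := w)) = a" for w
  proof -
    have "monomial ?J (z(i := w)) \<beta> = monomial ?J z \<beta>" for \<beta> by (rule monomial_cong) simp
    then show ?thesis by (simp add: a_def slice_coeff_def fun_eq_iff)
  qed
  have w: "\<And>j. j < p \<Longrightarrow> norm ((z(i := w)) j) * K < 1" if "norm w < 1 / K" for w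
    using that z1 K by (auto simp: field_simps)
  have sm: "summable (\<lambda>n. a n * w ^ n)" if "norm w < 1 / K" for w
    using power_series_slice(1)[where z = "z(i := w)", OF d _ w[OF that] i] K by (simp add: a_upd)
  have "norm (z i) < 1 / K" using z1[OF i] K by (simp add: field_simps)
  then have D: "((\<lambda>w. suminf (\<lambda>n. a n * w ^ n)) has_field_derivative (suminf (\<lambda>n. diffs a n * z i ^ n))) (at (z i))"
    using sm by (intro termdiffs_strong'[of "1 / K"])
  show "(G has_field_derivative (suminf (\<lambda>n. diffs a n * z i ^ n))) (at (z i))"
  proof (rule has_field_derivative_transform_within_open[OF D])
    show "open (S \<inter> ball 0 (1 / K))" "z i \<in> S \<inter> ball 0 (1 / K)"
      using S \<open>norm (z i) < 1 / K\<close> by auto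
    fix u assume u: "u \<in> S \<inter> ball 0 (1 / K)"
    then have "((\<lambda>\<beta>. d \<beta> * monomial {..<p} (z(i := u)) \<beta>) has_sum (suminf (\<lambda>n. a n * u ^ n))) (multi_indices {..<p})"
      using power_series_slice(2)[where z = "z(i := u)", OF d _ w i] K by (simp add: a_upd)
    with G[of u] u show "(suminf (\<lambda>n. a n * u ^ n)) = G u" by (meson IntD1 has_sum_unique)
  qed
  \<comment> \<open>The factor \<beta>_i + 1 costs a factor 2 per degree; hence the 2 in the
    assumption on z, under which this series converges as well.\<close>
  let ?d' = "\<lambda>\<beta>. of_nat (mexp \<beta> i + 1) * d (\<beta> + Poly_Mapping.single i 1)"
  have "norm (?d' \<beta>) \<le> M * K * (2 * K) ^ multi_degree p \<beta>" for \<beta>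
  proof -
    have "real (mexp \<beta> i + 1) \<le> 2 ^ multi_degree p \<beta>"
      using Suc_le_two_power power_increasing[OF lookup_le_multi_degree[OF i], of "2::real" \<beta>]
      by (meson one_le_numeral order_trans)
    then have "real (mexp \<beta> i + 1) * norm (d (\<beta> + Poly_Mapping.single i 1)) \<le>
        2 ^ multi_degree p \<beta> * (M * K ^ multi_degree p (\<beta> + Poly_Mapping.single i 1))"
      using d by (intro mult_mono) auto
    also have "\<dots> = M * K * (2 * K) ^ multi_degree p \<beta>"
      using i by (simp add: multi_degree_add multi_degree_single power_mult_distrib)
    finally show ?thesis by (simp only: norm_mult norm_of_nat)
  qed
  from power_series_slice(2)[where z = z, OF this _ z i]
  have "((\<lambda>\<beta>. ?d' \<beta> * monomial {..<p} z \<beta>) has_sum (suminf (\<lambda>n. slice_coeff ?J i ?d' z n * z i ^ n))) (multi_indices {..<p})"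
    using K by simp
  moreover have "slice_coeff ?J i ?d' z n = diffs a n" for n
  proof -
    have "slice_coeff ?J i ?d' z n = (\<Sum>\<^sub>\<infinity>\<beta>\<in>multi_indices ?J.
        of_nat (Suc n) * (d (\<beta> + Poly_Mapping.single i (Suc n)) * monomial ?J z \<beta>))"
      unfolding slice_coeff_def
      by (intro infsum_cong) (simp add: multi_indices_lookup lookup_add add.assoc flip: single_add)
    then show ?thesis by (simp only: infsum_cmult_right' diffs_def a_def slice_coeff_def)
  qed
  ultimately show "((\<lambda>\<beta>. ?d' \<beta> * monomial {..<p} z \<beta>) has_sum (suminf (\<lambda>n. diffs a n * z i ^ n))) (multi_indices {..<p})"
    by simp
qed

lemma has_sum_imp_bounded:
  fixes f :: "'a \<Rightarrow> 'b::real_normed_vector"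
  assumes "(f has_sum s) A"
  obtains B where "B \<ge> 0" "\<And>x. x \<in> A \<Longrightarrow> norm (f x) \<le> B"
proof -
  have "eventually (\<lambda>F. dist (sum f F) s < 1) (finite_subsets_at_top A)"
    using assms unfolding has_sum_def by (rule tendstoD) simp
  then obtain F where F: "finite F" "F \<subseteq> A" "\<And>G. finite G \<Longrightarrow> F \<subseteq> G \<Longrightarrow> G \<subseteq> A \<Longrightarrow> dist (sum f G) s < 1"
    unfolding eventually_finite_subsets_at_top by metis
  show thesis
  proof
    \<comment> \<open>A term outside F is the difference of two partial sums, each within 1 of s; a
      term in F is dominated by the finite sum of norms.\<close>
    show "2 + (\<Sum>x\<in>F. norm (f x)) \<ge> 0" by (simp add: sum_nonneg add_nonneg_nonneg)
    fix x assume x: "x \<in> A"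
    show "norm (f x) \<le> 2 + (\<Sum>x\<in>F. norm (f x))"
    proof (cases "x \<in> F")
      case True
      then show ?thesis using F(1) member_le_sum[of x F "\<lambda>x. norm (f x)"] by fastforce
    next
      case False
      have "norm (f x) = dist (sum f (insert x F)) (sum f F)" using False F(1) by (simp add: dist_norm)
      also have "\<dots> \<le> 2" using F(3)[of F] F(3)[of "insert x F"] F(1,2) x
        by (smt (verit) dist_commute dist_triangle finite.insertI insert_subset order_refl subset_insertI)
      also have "\<dots> \<le> 2 + (\<Sum>x\<in>F. norm (f x))" by (simp add: sum_nonneg)
      finally show ?thesis .
    qed
  qed
qed

text \<open>\<open>g n\<close> stands for the n-th derivative divided by n!, which is how jets store
  it. The remainder is estimated by the mean value inequality instead of a point of the segment or a
  contour, so that the real and the complex case need no distinction.\<close>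

lemma taylor_sums:
  fixes g :: "nat \<Rightarrow> 'k::{real_normed_field,banach} \<Rightarrow> 'k"
  assumes g: "\<And>n u. u \<in> ball c e \<Longrightarrow> (g n has_field_derivative of_nat (n + 1) * g (Suc n) u) (at u)"
    and bd: "\<And>n u. u \<in> ball c e \<Longrightarrow> norm (g n u) \<le> M * K ^ n"
    and M: "M \<ge> 0" and K: "K \<ge> 0" and uv: "u \<in> ball c e" "v \<in> ball c e" "norm (v - u) * K < 1"
  shows "(\<lambda>n. g n u * (v - u) ^ n) sums g 0 v"
proof -
  let ?w = "\<lambda>z. u + z * (v - u)"
  \<comment> \<open>The Taylor polynomial with N terms at the moving point \<open>?w z\<close>,
    evaluated at v. In its derivative with respect to z consecutive terms cancel and only
    \<open>h' N z\<close> is left. It runs from the polynomial at u (z = 0) to the value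
    \<open>g 0 v\<close> (z = 1).\<close>
  define h where "h N z = (\<Sum>n<N. g n (?w z) * (v - u) ^ n * (1 - z) ^ n)" for N z
  define h' where "h' N z = of_nat N * g N (?w z) * (v - u) ^ N * (1 - z) ^ (N - 1)" for N z
  have seg: "\<exists>t\<in>{0..1}. z = of_real t" if "z \<in> closed_segment (0::'k) 1" for z
    using that by (auto simp: in_segment scaleR_conv_of_real)
  have w: "?w z \<in> ball c e" if z: "z \<in> closed_segment 0 1" for z
  proof -
    obtain t where t: "t \<in> {0..1}" "z = of_real t" using seg[OF z] by blast
    then have "(1 - t) *\<^sub>R u + t *\<^sub>R v \<in> ball c e" using uv by (intro convexD_alt[OF convex_ball]) auto
    also have "(1 - t) *\<^sub>R u + t *\<^sub>R v = ?w z" by (simp add: t(2) scaleR_conv_of_real algebra_simps)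
    finally show ?thesis .
  qed
  have deriv: "(h N has_field_derivative h' N z) (at z)" if z: "z \<in> closed_segment 0 1" for N z
  proof (induction N)
    case 0
    then show ?case by (simp add: h_def[abs_def] h'_def)
  next
    case (Suc N)
    have "((\<lambda>z. g N (?w z)) has_field_derivative of_nat (N + 1) * g (Suc N) (?w z) * (v - u)) (at z)"
    proof (rule DERIV_chain2[where f = "g N" and g = ?w, OF g[OF w[OF z]]])
      show "(?w has_field_derivative v - u) (at z)" by (auto intro!: derivative_eq_intros)
    qed
    then have "((\<lambda>z. g N (?w z) * (v - u) ^ N * (1 - z) ^ N) has_field_derivative
        of_nat (N + 1) * g (Suc N) (?w z) * (v - u) * (v - u) ^ N * (1 - z) ^ N
        - of_nat N * g N (?w z) * (v - u) ^ N * (1 - z) ^ (N - 1)) (at z)"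
      by (auto intro!: derivative_eq_intros simp: algebra_simps)
    from DERIV_add[OF Suc this] show ?case by (simp add: h_def[abs_def] h'_def algebra_simps)
  qed
  have b: "norm (h N 1 - h N 0) \<le> (M * (real N * (norm (v - u) * K) ^ N)) * norm (1 - 0 :: 'k)" for N
  proof (rule field_differentiable_bound[where f' = "h' N" and S = "closed_segment 0 1"])
    fix z :: 'k assume z: "z \<in> closed_segment 0 1"
    show "(h N has_field_derivative h' N z) (at z within closed_segment 0 1)"
      by (rule has_field_derivative_at_within[OF deriv[OF z]])
    obtain t where t: "t \<in> {0..1}" "z = of_real t" using seg[OF z] by blast
    have "norm (1 - z) = norm (of_real (1 - t) :: 'k)" by (simp add: t(2))
    also have "\<dots> \<le> 1" using t by (simp del: of_real_diff)
    finally have "norm (1 - z) ^ (N - 1) \<le> 1" by (intro power_le_one) auto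
    then have "norm (h' N z) \<le> real N * (M * K ^ N) * norm (v - u) ^ N * 1"
      unfolding h'_def norm_mult norm_power norm_of_nat
      using bd[OF w[OF z]] M K by (intro mult_mono) auto
    then show "norm (h' N z) \<le> M * (real N * (norm (v - u) * K) ^ N)"
      by (simp add: power_mult_distrib mult_ac)
  qed auto
  have h0: "h N 0 = (\<Sum>n<N. g n u * (v - u) ^ n)" for N by (simp add: h_def)
  \<comment> \<open>At z = 1 all powers of 1 - z vanish except the zeroth, which is present only if
    N > 0.\<close>
  have h1: "h N 1 = g 0 v" if "N > 0" for N
  proof -
    have "h N 1 = (\<Sum>n<N. if n = 0 then g 0 v else 0)"
      unfolding h_def by (intro sum.cong refl) auto
    then show ?thesis using that by (simp add: sum.delta)
  qed
  have le: "norm ((\<Sum>n<N. g n u * (v - u) ^ n) - g 0 v) \<le> M * (real N * (norm (v - u) * K) ^ N)"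
    if "N > 0" for N
    using b[of N] unfolding h0 h1[OF that] by (simp add: norm_minus_commute)
  have "(\<lambda>N. (\<Sum>n<N. g n u * (v - u) ^ n) - g 0 v) \<longlonglongrightarrow> 0"
  proof (rule Lim_null_comparison)
    show "\<forall>\<^sub>F N in sequentially. norm ((\<Sum>n<N. g n u * (v - u) ^ n) - g 0 v) \<le> M * (real N * (norm (v - u) * K) ^ N)"
      using le by (auto intro: eventually_sequentiallyI[of 1])
    have "(\<lambda>N. real N * (norm (v - u) * K) ^ N) \<longlonglongrightarrow> 0"
      using uv K by (intro powser_times_n_limit_0) (simp add: norm_mult)
    from tendsto_mult_right_zero[OF this] show "(\<lambda>N. M * (real N * (norm (v - u) * K) ^ N)) \<longlonglongrightarrow> 0" .
  qed
  then show ?thesis unfolding sums_def by (rule LIM_zero_cancel)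
qed

lemma taylor_has_sum:
  fixes f :: "'k::{real_normed_field,banach} sfun"
  assumes f: "smooth_jets p (polydisc p x0 e) f"
    and bd: "\<And>x \<alpha>. x \<in> polydisc p x0 e \<Longrightarrow> norm (f x \<alpha> I) \<le> M * K ^ multi_degree p \<alpha>"
    and K: "K \<ge> 1" and M: "M \<ge> 0" and x: "x \<in> polydisc p x0 e"
    and y: "y \<in> polydisc p x0 e" "\<And>i. i < p \<Longrightarrow> norm (y i - x i) * K < 1"
  shows "((\<lambda>\<alpha>. f x \<alpha> I * monomial {..<p} (\<lambda>i. y i - x i) \<alpha>) has_sum f y 0 I) (multi_indices {..<p})"
proof -
  let ?s = "\<lambda>i. Poly_Mapping.single i :: nat \<Rightarrow> _"
  \<comment> \<open>Coordinates are moved one at a time. Only jets \<gamma> without components in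
    the directions already moved are expanded; their exponent in the next direction starts at 0, so
    no binomial coefficients arise.\<close>
  have "((\<lambda>\<alpha>. f x (\<gamma> + \<alpha>) I * monomial {..<p} (\<lambda>i. y i - x i) \<alpha>) has_sum f y \<gamma> I) (multi_indices {..<m})"
    if "m \<le> p" "y \<in> polydisc p x0 e" "\<And>i. i < p \<Longrightarrow> norm (y i - x i) * K < 1"
      "\<And>i. i \<ge> m \<Longrightarrow> y i = x i" "\<And>j. j < m \<Longrightarrow> mexp \<gamma> j = 0" for m y \<gamma>
    using that
  proof (induction m arbitrary: y \<gamma>)
    case 0
    then have "y = x" by auto
    then show ?case by (simp add: multi_indices_empty monomial_def has_sum_finiteI)
  next
    case (Suc m)
    note y = Suc.prems(2) and yx = Suc.prems(3)
    \<comment> \<open>An intermediate point: the induction hypothesis expands the jets at z around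
      x, and the Taylor series in coordinate m leads from z to y.\<close>
    define z where "z = y(m := x m)"
    let ?q = "norm (y m - x m) * K"
    have m: "m < p" using Suc.prems by simp
    have xm: "x m \<in> ball (x0 m) e" "y m \<in> ball (x0 m) e"
      using polydisc_ball[OF _ m] x y by auto
    have z: "z \<in> polydisc p x0 e" unfolding z_def by (rule polydisc_upd[OF y m xm(1)])
    have "(\<lambda>n. f (y(m := x m)) (\<gamma> + ?s m n) I * (y m - x m) ^ n) sums f (y(m := y m)) (\<gamma> + ?s m 0) I"
    proof (rule taylor_sums)
      fix n u assume "u \<in> ball (x0 m) e"
      then have yu: "y(m := u) \<in> polydisc p x0 e" by (rule polydisc_upd[OF y m])
      have "\<gamma> + ?s m n + ?s m 1 = \<gamma> + ?s m (Suc n)" by (simp add: add.assoc flip: single_add)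
      with smooth_jetsD(2)[OF f m yu, of "\<gamma> + ?s m n" I]
      show "((\<lambda>u. f (y(m := u)) (\<gamma> + ?s m n) I) has_field_derivative
          of_nat (n + 1) * f (y(m := u)) (\<gamma> + ?s m (Suc n)) I) (at u)"
        using Suc.prems(5)[of m] by (simp add: lookup_add)
      show "norm (f (y(m := u)) (\<gamma> + ?s m n) I) \<le> M * K ^ multi_degree p \<gamma> * K ^ n"
        using bd[OF yu, of "\<gamma> + ?s m n"] m by (simp add: multi_degree_add multi_degree_single power_add mult.assoc)
    qed (use xm yx[OF m] K M in auto)
    then have sums: "(\<lambda>n. f z (\<gamma> + ?s m n) I * (y m - x m) ^ n) sums f y \<gamma> I" by (simp add: z_def)
    have "summable (\<lambda>n. norm (f z (\<gamma> + ?s m n) I * (y m - x m) ^ n))"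
    proof (rule summable_comparison_test')
      show "summable (\<lambda>n. M * K ^ multi_degree p \<gamma> * ?q ^ n)"
        using yx[OF m] K by (intro summable_mult summable_geometric) (simp add: norm_mult)
      show "norm (norm (f z (\<gamma> + ?s m n) I * (y m - x m) ^ n)) \<le> M * K ^ multi_degree p \<gamma> * ?q ^ n" for n
        using mult_right_mono[OF bd[OF z, of "\<gamma> + ?s m n"], of "norm (y m - x m) ^ n"] m
        by (simp add: multi_degree_add multi_degree_single power_add norm_mult norm_power power_mult_distrib mult_ac)
    qed
    from norm_summable_imp_has_sum[OF this sums]
    have outer: "((\<lambda>n. f z (\<gamma> + ?s m n) I * (y m - x m) ^ n) has_sum f y \<gamma> I) UNIV" .
    let ?yd = "\<lambda>i. y i - x i" and ?zd = "\<lambda>i. z i - x i"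
    let ?F = "\<lambda>(n, \<alpha>). f x (\<gamma> + (\<alpha> + ?s m n)) I * monomial {..<p} ?yd (\<alpha> + ?s m n)"
    have inner: "((\<lambda>\<alpha>. ?F (n, \<alpha>)) has_sum f z (\<gamma> + ?s m n) I * (y m - x m) ^ n) (multi_indices {..<m})" for n
    proof -
      have "((\<lambda>\<alpha>. f x (\<gamma> + ?s m n + \<alpha>) I * monomial {..<p} ?zd \<alpha>) has_sum f z (\<gamma> + ?s m n) I) (multi_indices {..<m})"
      proof (rule Suc.IH)
        show "norm (z i - x i) * K < 1" if "i < p" for i using yx[OF that] by (simp add: z_def)
        show "z i = x i" if "m \<le> i" for i using Suc.prems(4)[of i] that by (cases "i = m") (auto simp: z_def)
        show "mexp (\<gamma> + ?s m n) j = 0" if "j < m" for j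
          using Suc.prems(5)[of j] that by (simp add: lookup_add lookup_single_not_eq)
      qed (use m z in auto)
      from has_sum_cmult_left[OF this, of "(y m - x m) ^ n"] show ?thesis
      proof (rule has_sum_cong[THEN iffD1, rotated])
        fix \<alpha> assume "\<alpha> \<in> multi_indices {..<m}"
        then have \<alpha>: "\<alpha> \<in> multi_indices ({..<p} - {m})" using m by (auto simp: multi_indices_lookup)
        have p: "insert m ({..<p} - {m}) = {..<p}" using m by auto
        note split = monomial_add_single[OF _ _ \<alpha>, of m, unfolded p]
        have "monomial ({..<p} - {m}) ?zd \<alpha> = monomial ({..<p} - {m}) ?yd \<alpha>"
          by (rule monomial_cong) (auto simp: z_def)
        then have "monomial {..<p} ?zd \<alpha> * (y m - x m) ^ n = monomial {..<p} ?yd (\<alpha> + ?s m n)"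
          using split[of ?zd 0] split[of ?yd n] by simp
        moreover have "\<gamma> + ?s m n + \<alpha> = \<gamma> + (\<alpha> + ?s m n)" by (simp only: add_ac)
        ultimately show "f x (\<gamma> + ?s m n + \<alpha>) I * monomial {..<p} ?zd \<alpha> * (y m - x m) ^ n = ?F (n, \<alpha>)"
          by (simp add: mult.assoc)
      qed
    qed
    have bij: "bij_betw (\<lambda>(n, \<beta>). \<beta> + ?s m n) (UNIV \<times> multi_indices {..<m}) (multi_indices {..<Suc m})"
      using bij_betw_multi_indices_insert[of m "{..<m}"] by (simp add: lessThan_Suc)
    let ?G = "\<lambda>\<alpha>. f x (\<gamma> + \<alpha>) I * monomial {..<p} ?yd \<alpha>"
    have FG: "?F = (\<lambda>a. ?G (case a of (n, \<beta>) \<Rightarrow> \<beta> + ?s m n))" by auto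
    have d: "norm (f x (\<gamma> + \<alpha>) I) \<le> M * K ^ multi_degree p \<gamma> * K ^ multi_degree p \<alpha>" for \<alpha>
      using bd[OF x, of "\<gamma> + \<alpha>"] by (simp add: multi_degree_add power_add mult.assoc)
    have "?G abs_summable_on multi_indices {..<p}"
      by (rule power_series_abs_summable[OF d]) (use K yx in auto)
    then have "?G summable_on multi_indices {..<Suc m}"
      by (rule summable_on_subset_banach[OF abs_summable_summable]) (use m in \<open>auto simp: multi_indices_def\<close>)
    then have "?F summable_on UNIV \<times> multi_indices {..<m}"
      unfolding FG by (rule summable_on_reindex_bij_betw[OF bij, THEN iffD2])
    from has_sum_SigmaI[OF inner outer this] show ?case
      unfolding FG by (rule has_sum_reindex_bij_betw[OF bij, THEN iffD1])
  qed
  from this[of p y 0] show ?thesis using x y by (simp add: polydisc_def)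
qed

text \<open>One half of the description of analytic functions by bounds: the radius 1/K works for
  all I because K does.\<close>

lemma sf_bounded_expansion:
  fixes f :: "'k::{real_normed_field,banach} sfun"
  assumes f: "smooth_jets p (polydisc p x0 e) f" "sf_bounded p (polydisc p x0 e) f"
    and supp: "sf_supported p q D f" and x: "x \<in> polydisc p x0 e"
  obtains \<rho> where "\<rho> > 0" "\<And>y I. y \<in> polydisc p x0 e \<Longrightarrow> (\<And>i. i < p \<Longrightarrow> norm (y i - x i) < \<rho>) \<Longrightarrow>
    ((\<lambda>\<alpha>. f x \<alpha> I * (\<Prod>i<p. (y i - x i) ^ mexp \<alpha> i)) has_sum f y 0 I) UNIV"
proof -
  obtain K where K: "K \<ge> 1"
      "\<And>I. \<exists>M\<ge>0. \<forall>x\<in>polydisc p x0 e. \<forall>\<alpha>. norm (f x \<alpha> I) \<le> M * K ^ multi_degree p \<alpha>"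
    using f(2) unfolding sf_bounded_def by blast
  show thesis
  proof
    show "1 / K > 0" using K(1) by simp
    fix y I assume y: "y \<in> polydisc p x0 e" "\<And>i. i < p \<Longrightarrow> norm (y i - x i) < 1 / K"
    obtain M where M: "M \<ge> 0" "\<And>x \<alpha>. x \<in> polydisc p x0 e \<Longrightarrow> norm (f x \<alpha> I) \<le> M * K ^ multi_degree p \<alpha>"
      using K(2)[of I] by blast
    have "((\<lambda>\<alpha>. f x \<alpha> I * monomial {..<p} (\<lambda>i. y i - x i) \<alpha>) has_sum f y 0 I) (multi_indices {..<p})"
    proof (rule taylor_has_sum[OF f(1) M(2) K(1) M(1) x y(1)])
      show "norm (y i - x i) * K < 1" if "i < p" for i using y(2)[OF that] K(1) by (simp add: field_simps)
    qed
    then have "((\<lambda>\<alpha>. f x \<alpha> I * monomial {..<p} (\<lambda>i. y i - x i) \<alpha>) has_sum f y 0 I) UNIV"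
      by (rule has_sum_cong_neutral[THEN iffD1, rotated 3])
        (auto simp: multi_indices_def sf_supportedD(2)[OF supp])
    then show "((\<lambda>\<alpha>. f x \<alpha> I * (\<Prod>i<p. (y i - x i) ^ mexp \<alpha> i)) has_sum f y 0 I) UNIV"
      by (simp add: monomial_def)
  qed
qed

section \<open>Re-expansion of higher jets\<close>

definition multi_binomial :: "nat \<Rightarrow> (nat \<Rightarrow>\<^sub>0 nat) \<Rightarrow> (nat \<Rightarrow>\<^sub>0 nat) \<Rightarrow> nat" where
  "multi_binomial p \<alpha> \<beta> =
     (\<Prod>i<p. (mexp \<alpha> i + mexp \<beta> i) choose mexp \<alpha> i)"

lemma multi_binomial_le: "multi_binomial p \<alpha> \<beta> \<le> 2 ^ multi_degree p \<alpha> * 2 ^ multi_degree p \<beta>"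
proof -
  have "multi_binomial p \<alpha> \<beta> \<le> (\<Prod>i<p. 2 ^ (mexp \<alpha> i + mexp \<beta> i))"
    unfolding multi_binomial_def by (intro prod_mono) (auto simp: binomial_le_pow2)
  also have "\<dots> = 2 ^ multi_degree p \<alpha> * 2 ^ multi_degree p \<beta>"
    by (simp add: multi_degree_def power_sum power_add prod.distrib)
  finally show ?thesis .
qed

lemma real_multi_binomial_le: "real (multi_binomial p \<alpha> \<beta>) \<le> 2 ^ multi_degree p \<alpha> * 2 ^ multi_degree p \<beta>"
proof -
  have "real (multi_binomial p \<alpha> \<beta>) \<le> real (2 ^ multi_degree p \<alpha> * 2 ^ multi_degree p \<beta>)"
    using multi_binomial_le by (rule of_nat_mono)
  then show ?thesis by simp
qed

lemma smooth_jets_subset: "smooth_jets p D f \<Longrightarrow> E \<subseteq> D \<Longrightarrow> smooth_jets p E f"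
  by (rule smooth_jetsI) (auto intro: continuous_on_subset smooth_jetsD(1) dest: smooth_jetsD(2))

lemma binomial_shift: "(b + 1) * ((a + (b + 1)) choose a) = (a + 1) * ((a + 1 + b) choose (a + 1))"
proof -
  have "(a + b + 1) * ((a + b) choose a) = (a + 1) * ((a + 1 + b) choose (a + 1))"
    using Suc_times_binomial_eq[of "a + b" a] by (simp add: mult.commute)
  moreover have "(a + b + 1) * ((a + b) choose b) = (b + 1) * ((a + b + 1) choose (b + 1))"
    using Suc_times_binomial_eq[of "a + b" b] by (simp add: mult.commute)
  moreover have "(a + b) choose b = (a + b) choose a" "(a + b + 1) choose (b + 1) = (a + (b + 1)) choose a"
    using binomial_symmetric[of b "a + b"] binomial_symmetric[of "b + 1" "a + b + 1"] by (simp_all add: add_ac)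
  ultimately show ?thesis by simp
qed

text \<open>\<open>multi_binomial p \<alpha> \<beta>\<close> is (\<alpha>+\<beta>)!/(\<alpha>!
  \<beta>!), the weight with which the jet \<alpha>+\<beta> at the centre enters the jet \<alpha>
  nearby. Passing a unit from \<beta> to \<alpha> matches the factor of termwise differentiation
  with the factor in the jet relation.\<close>

lemma multi_binomial_shift:
  assumes "i < p"
  shows "(mexp \<beta> i + 1) * multi_binomial p \<alpha> (\<beta> + Poly_Mapping.single i 1) =
    (mexp \<alpha> i + 1) * multi_binomial p (\<alpha> + Poly_Mapping.single i 1) \<beta>"
proof -
  let ?l = mexp and ?s = "Poly_Mapping.single i (1::nat)"
  have i: "i \<in> {..<p}" using assms by simp
  have "(\<Prod>j\<in>{..<p} - {i}. (?l \<alpha> j + ?l (\<beta> + ?s) j) choose ?l \<alpha> j) =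
      (\<Prod>j\<in>{..<p} - {i}. (?l (\<alpha> + ?s) j + ?l \<beta> j) choose ?l (\<alpha> + ?s) j)"
    by (intro prod.cong refl) (simp add: lookup_add lookup_single_not_eq)
  then show ?thesis
    using binomial_shift[of "?l \<beta> i" "?l \<alpha> i"]
    unfolding multi_binomial_def prod.remove[OF finite_lessThan i]
    by (simp only: lookup_add lookup_single_eq mult.assoc[symmetric])
qed

text \<open>Cauchy's estimate without an integral: convergence at the single point whose
  displacements all equal R bounds the terms there, and hence the coefficients.\<close>

lemma analytic_coeff_bound:
  fixes c :: "(nat \<Rightarrow>\<^sub>0 nat) \<Rightarrow> 'k::real_normed_field"
  assumes hs: "((\<lambda>\<alpha>. c \<alpha> * (\<Prod>i<p. of_real R ^ mexp \<alpha> i)) has_sum s) UNIV" and R: "R > 0"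
  obtains M where "M \<ge> 0" "\<And>\<alpha>. norm (c \<alpha>) \<le> M * (1 / R) ^ multi_degree p \<alpha>"
proof -
  obtain M where M: "M \<ge> 0" "\<And>\<alpha>. norm (c \<alpha> * (\<Prod>i<p. of_real R ^ mexp \<alpha> i)) \<le> M"
    by (rule has_sum_imp_bounded[OF hs]) blast
  have "norm (c \<alpha>) \<le> M * (1 / R) ^ multi_degree p \<alpha>" for \<alpha>
  proof -
    have "(\<Prod>i<p. of_real R ^ mexp \<alpha> i) = (of_real R :: 'k) ^ multi_degree p \<alpha>"
      by (simp add: multi_degree_def power_sum)
    then have "norm (c \<alpha>) * R ^ multi_degree p \<alpha> \<le> M"
      using M(2)[of \<alpha>] R by (simp add: norm_mult norm_power)
    then show ?thesis using R by (simp add: power_one_over field_simps)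
  qed
  with M(1) show thesis by (rule that)
qed

text \<open>Analyticity provides expansions of function values only. Those of the jets follow by
  termwise differentiation, by induction on the degree of \<alpha>.\<close>

lemma jets_has_sum:
  fixes f :: "'k::{real_normed_field,banach} sfun"
  assumes f: "smooth_jets p (polydisc p x0 \<delta>) f" and supp: "sf_supported p q D f"
    and c: "\<And>\<alpha>. norm (f x0 \<alpha> I) \<le> M * K ^ multi_degree p \<alpha>" and K: "K \<ge> 1" and M: "M \<ge> 0"
    and \<delta>: "\<delta> * (8 * K) \<le> 1"
    and hs: "\<And>y. y \<in> polydisc p x0 \<delta> \<Longrightarrow>
      ((\<lambda>\<alpha>. f x0 \<alpha> I * monomial {..<p} (\<lambda>i. y i - x0 i) \<alpha>) has_sum f y 0 I) (multi_indices {..<p})"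
    and y: "y \<in> polydisc p x0 \<delta>" and \<alpha>: "Poly_Mapping.keys \<alpha> \<subseteq> {..<p}"
  shows "((\<lambda>\<beta>. of_nat (multi_binomial p \<alpha> \<beta>) * f x0 (\<alpha> + \<beta>) I * monomial {..<p} (\<lambda>i. y i - x0 i) \<beta>)
    has_sum f y \<alpha> I) (multi_indices {..<p})"
  using \<alpha> y
proof (induction "multi_degree p \<alpha>" arbitrary: \<alpha> y)
  case 0
  then have "mexp \<alpha> i = 0" for i
    by (cases "i < p") (auto simp: multi_degree_def subset_iff in_keys_iff)
  then have "\<alpha> = 0" by (intro poly_mapping_eqI) simp
  then show ?case using hs[OF 0(3)] by (simp add: multi_binomial_def)
next
  case (Suc n)
  let ?s = "\<lambda>i. Poly_Mapping.single i (1::nat)"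
  let ?b = "\<lambda>\<alpha> \<beta>. of_nat (multi_binomial p \<alpha> \<beta>) * f x0 (\<alpha> + \<beta>) I"
  note y = Suc.prems(2)
  have "\<exists>i<p. mexp \<alpha> i > 0"
  proof (rule ccontr)
    assume "\<not> (\<exists>i<p. mexp \<alpha> i > 0)"
    then have "multi_degree p \<alpha> = 0" by (simp add: multi_degree_def)
    then show False using Suc.hyps(2) by simp
  qed
  then obtain i where i: "i < p" "mexp \<alpha> i > 0" by blast
  define \<alpha>' where "\<alpha>' = \<alpha> - ?s i"
  have \<alpha>: "\<alpha> = \<alpha>' + ?s i"
    using i unfolding \<alpha>'_def by (intro poly_mapping_eqI) (auto simp: lookup_add lookup_minus lookup_single when_def)
  have "multi_degree p \<alpha> = multi_degree p \<alpha>' + 1"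
    by (subst \<alpha>) (simp add: multi_degree_add multi_degree_single i(1))
  then have n: "n = multi_degree p \<alpha>'" using Suc.hyps(2) by simp
  have keys: "Poly_Mapping.keys \<alpha>' \<subseteq> {..<p}"
    using Suc.prems(1) by (subst (asm) \<alpha>) (simp only: keys_add_single_subset)
  define z where "z = (\<lambda>j. y j - x0 j)"
  define G where "G u = f (y(i := u + x0 i)) \<alpha>' I" for u
  have bd: "norm (?b \<alpha>' \<beta>) \<le> M * (2 * K) ^ multi_degree p \<alpha>' * (2 * K) ^ multi_degree p \<beta>" for \<beta>
  proof -
    have "norm (?b \<alpha>' \<beta>) \<le> (2 ^ multi_degree p \<alpha>' * 2 ^ multi_degree p \<beta>) * (M * K ^ multi_degree p (\<alpha>' + \<beta>))"
      unfolding norm_mult norm_of_nat by (rule mult_mono[OF real_multi_binomial_le c]) auto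
    then show ?thesis by (simp add: multi_degree_add power_add power_mult_distrib mult_ac)
  qed
  \<comment> \<open>Of the factor 8, one 2 pays for the binomial coefficients in \<open>bd\<close>,
    one for termwise differentiation, and one makes the inequality strict.\<close>
  have z1: "norm (z j) * (2 * (2 * K)) < 1" if "j < p" for j
  proof -
    have "norm (z j) * (8 * K) \<le> \<delta> * (8 * K)"
      using y that K unfolding z_def polydisc_def by (intro mult_right_mono) (auto intro: less_imp_le)
    then have "norm (z j) * K * 8 \<le> 1" using \<delta> by simp
    moreover have "norm (z j) * K \<ge> 0" using K by simp
    ultimately show ?thesis by simp
  qed
  have Gs: "((\<lambda>\<beta>. ?b \<alpha>' \<beta> * monomial {..<p} (z(i := u)) \<beta>) has_sum G u) (multi_indices {..<p})"
    if "u \<in> ball 0 \<delta>" for u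
  proof -
    have "y(i := u + x0 i) \<in> polydisc p x0 \<delta>" using that by (intro polydisc_upd[OF y i(1)]) (simp add: dist_norm)
    from Suc.hyps(1)[OF n keys this]
    have "((\<lambda>\<beta>. ?b \<alpha>' \<beta> * monomial {..<p} (\<lambda>j. (y(i := u + x0 i)) j - x0 j) \<beta>) has_sum G u) (multi_indices {..<p})"
      unfolding G_def .
    moreover have "(\<lambda>j. (y(i := u + x0 i)) j - x0 j) = z(i := u)" by (auto simp: z_def)
    ultimately show ?thesis by simp
  qed
  have zi: "z i \<in> ball 0 \<delta>" using y i by (auto simp: z_def polydisc_def)
  have KM: "2 * K \<ge> 1" "M * (2 * K) ^ multi_degree p \<alpha>' \<ge> 0" using K M by auto
  obtain G' where G': "(G has_field_derivative G') (at (z i))"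
    "((\<lambda>\<beta>. of_nat (mexp \<beta> i + 1) * ?b \<alpha>' (\<beta> + ?s i) * monomial {..<p} z \<beta>) has_sum G') (multi_indices {..<p})"
    using power_series_deriv[where d = "?b \<alpha>'" and z = z and G = G, OF bd KM z1 i(1) open_ball zi Gs] by blast
  \<comment> \<open>The derivative of G is now known twice, termwise and through the jet relation.
    Uniqueness identifies the two, and the factor \<open>mexp \<alpha>' i + 1\<close> can be divided
    out in characteristic 0.\<close>
  have "((\<lambda>u. f (y(i := u)) \<alpha>' I) has_field_derivative of_nat (mexp \<alpha>' i + 1) * f y \<alpha> I) (at (z i + x0 i))"
    using smooth_jetsD(2)[OF f i(1) y, of \<alpha>' I] by (simp add: z_def \<alpha>)
  then have "(G has_field_derivative of_nat (mexp \<alpha>' i + 1) * f y \<alpha> I) (at (z i))"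
    unfolding DERIV_shift G_def[abs_def] .
  then have G'_eq: "G' = of_nat (mexp \<alpha>' i + 1) * f y \<alpha> I" using G'(1) DERIV_unique by blast
  let ?N = "of_nat (mexp \<alpha>' i + 1) :: 'k"
  have N: "?N \<noteq> 0" by (simp only: of_nat_eq_0_iff)
  have "of_nat (mexp \<beta> i + 1) * ?b \<alpha>' (\<beta> + ?s i) = ?N * ?b \<alpha> \<beta>" for \<beta>
  proof -
    have "\<alpha>' + (\<beta> + ?s i) = \<alpha> + \<beta>" unfolding \<alpha> by (simp only: add_ac)
    then show ?thesis
      using multi_binomial_shift[OF i(1), of \<beta> \<alpha>'] unfolding \<alpha>
      by (simp only: mult.assoc[symmetric] of_nat_mult[symmetric])
  qed
  with G'(2) have "((\<lambda>\<beta>. ?N * (?b \<alpha> \<beta> * monomial {..<p} z \<beta>)) has_sum ?N * f y \<alpha> I) (multi_indices {..<p})"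
    unfolding G'_eq by (simp only: mult.assoc)
  from has_sum_cmult_right[OF this, of "inverse ?N"] show ?case
    unfolding z_def by (simp only: mult.assoc[symmetric] left_inverse[OF N] mult_1_left)
qed

text \<open>The other half: the expansion at the one point x0 has to bound the jets at all points
  nearby. Cauchy's estimate bounds the jets at x0, re-expansion transports them, and a geometric
  series sums the estimates.\<close>

lemma analytic_imp_locally_bounded:
  fixes f :: "'k::{real_normed_field,banach} sfun"
  assumes f: "smooth_jets p D f" and supp: "sf_supported p q D f"
    and D: "polydisc p x0 e \<subseteq> D" "e > 0" "\<And>i. i \<ge> p \<Longrightarrow> x0 i = 0" and \<rho>: "\<rho> > 0"
    and hs: "\<And>y I. y \<in> D \<Longrightarrow> (\<And>i. i < p \<Longrightarrow> norm (y i - x0 i) < \<rho>) \<Longrightarrow>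
      ((\<lambda>\<alpha>. f x0 \<alpha> I * (\<Prod>i<p. (y i - x0 i) ^ mexp \<alpha> i)) has_sum f y 0 I) UNIV"
  obtains \<delta> where "\<delta> > 0" "\<delta> \<le> e" "sf_bounded p (polydisc p x0 \<delta>) f"
proof -
  \<comment> \<open>Halving puts the test point with all displacements equal to R inside both the
    polydisc and the range of the expansion.\<close>
  define R where "R = min e \<rho> / 2"
  have R: "R > 0" "R < e" "R < \<rho>" using D \<rho> by (auto simp: R_def)
  define K where "K = max 1 (1 / R)"
  \<comment> \<open>From 8 K \<delta> \<le> 1 one gets the re-expansion of jets, and 2 K \<delta>
    \<le> 1/4 makes the majorant below a geometric series of ratio 1/4. K comes from R alone and so
    serves every I.\<close>
  define \<delta> where "\<delta> = min R (1 / (8 * K))"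
  have K: "K \<ge> 1" "1 / R \<le> K" by (auto simp: K_def)
  have \<delta>: "\<delta> > 0" "\<delta> \<le> R" "\<delta> * (8 * K) \<le> 1" using R K by (auto simp: \<delta>_def min_def field_simps)
  have sub: "polydisc p x0 \<delta> \<subseteq> D" using D(1) \<delta>(2) R(2) by (force simp: polydisc_def)
  have f\<delta>: "smooth_jets p (polydisc p x0 \<delta>) f"
    by (rule smooth_jets_subset[OF f sub])
  have "\<exists>M\<ge>0. \<forall>y\<in>polydisc p x0 \<delta>. \<forall>\<alpha>. norm (f y \<alpha> I) \<le> M * (2 * K) ^ multi_degree p \<alpha>" for I
  proof -
    let ?y = "\<lambda>i. if i < p then x0 i + of_real R else 0"
    have "?y \<in> D" using D(1) R by (auto simp: polydisc_def)
    from hs[OF this, of I] have hs0: "((\<lambda>\<alpha>. f x0 \<alpha> I * (\<Prod>i<p. of_real R ^ mexp \<alpha> i)) has_sum f ?y 0 I) UNIV"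
      using R by simp
    obtain M where M: "M \<ge> 0" "\<And>\<alpha>. norm (f x0 \<alpha> I) \<le> M * (1 / R) ^ multi_degree p \<alpha>"
      using analytic_coeff_bound[OF hs0 R(1)] by blast
    have c: "norm (f x0 \<alpha> I) \<le> M * K ^ multi_degree p \<alpha>" for \<alpha>
      using M(2)[of \<alpha>] mult_left_mono[OF power_mono[OF K(2), of "multi_degree p \<alpha>"] M(1)] R(1) by simp
    have hs': "((\<lambda>\<alpha>. f x0 \<alpha> I * monomial {..<p} (\<lambda>i. y i - x0 i) \<alpha>) has_sum f y 0 I) (multi_indices {..<p})"
      if y: "y \<in> polydisc p x0 \<delta>" for y
    proof -
      have "((\<lambda>\<alpha>. f x0 \<alpha> I * (\<Prod>i<p. (y i - x0 i) ^ mexp \<alpha> i)) has_sum f y 0 I) UNIV"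
      proof (rule hs)
        show "norm (y i - x0 i) < \<rho>" if "i < p" for i
          using y that \<delta>(2) R(3) by (force simp: polydisc_def)
      qed (use y sub in auto)
      then show ?thesis
        by (rule has_sum_cong_neutral[THEN iffD1, rotated 3])
          (auto simp: multi_indices_def monomial_def sf_supportedD(2)[OF supp])
    qed
    define T where "T = infsum (monomial {..<p} (\<lambda>_. 1 / 4 :: real)) (multi_indices {..<p})"
    have mono: "monomial {..<p} (\<lambda>_. 1 / 4 :: real) summable_on multi_indices {..<p}"
      by (rule monomial_summable) auto
    have T: "T \<ge> 0" unfolding T_def by (intro infsum_nonneg monomial_nonneg) auto
    have "norm (f y \<alpha> I) \<le> (M * T) * (2 * K) ^ multi_degree p \<alpha>" if y: "y \<in> polydisc p x0 \<delta>" for y \<alpha>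
    proof (cases "Poly_Mapping.keys \<alpha> \<subseteq> {..<p}")
      case False
      then show ?thesis using sf_supportedD(2)[OF supp] M(1) T K(1) by simp
    next
      case True
      let ?z = "\<lambda>i. y i - x0 i"
      let ?B = "\<lambda>\<beta>. M * (2 * K) ^ multi_degree p \<alpha> * monomial {..<p} (\<lambda>_. 1 / 4) \<beta>"
      have "((\<lambda>\<beta>. of_nat (multi_binomial p \<alpha> \<beta>) * f x0 (\<alpha> + \<beta>) I * monomial {..<p} ?z \<beta>)
          has_sum f y \<alpha> I) (multi_indices {..<p})"
        by (rule jets_has_sum[OF f\<delta> supp c K(1) M(1) \<delta>(3) hs' y True])
      moreover have "(?B has_sum M * (2 * K) ^ multi_degree p \<alpha> * T) (multi_indices {..<p})"
        unfolding T_def by (intro has_sum_cmult_right has_sum_infsum mono)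
      moreover have "norm (of_nat (multi_binomial p \<alpha> \<beta>) * f x0 (\<alpha> + \<beta>) I * monomial {..<p} ?z \<beta>) \<le> ?B \<beta>" for \<beta>
      proof -
        have 1: "real (multi_binomial p \<alpha> \<beta>) * norm (f x0 (\<alpha> + \<beta>) I) \<le>
            (2 ^ multi_degree p \<alpha> * 2 ^ multi_degree p \<beta>) * (M * K ^ multi_degree p (\<alpha> + \<beta>))"
          by (rule mult_mono[OF real_multi_binomial_le c]) auto
        have 2: "monomial {..<p} (\<lambda>i. norm (?z i)) \<beta> \<le> monomial {..<p} (\<lambda>_. \<delta>) \<beta>"
          using y by (intro monomial_mono) (auto simp: polydisc_def intro: less_imp_le)
        have "(2 * K) ^ multi_degree p \<beta> * monomial {..<p} (\<lambda>_. \<delta>) \<beta> = monomial {..<p} (\<lambda>_. 2 * K * \<delta>) \<beta>"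
          by (simp add: monomial_const power_mult_distrib)
        also have "\<dots> \<le> monomial {..<p} (\<lambda>_. 1 / 4) \<beta>"
          using \<delta> K by (intro monomial_mono) (auto simp: field_simps)
        finally have 3: "(2 * K) ^ multi_degree p \<beta> * monomial {..<p} (\<lambda>_. \<delta>) \<beta> \<le> monomial {..<p} (\<lambda>_. 1 / 4) \<beta>" .
        have "norm (of_nat (multi_binomial p \<alpha> \<beta>) * f x0 (\<alpha> + \<beta>) I * monomial {..<p} ?z \<beta>) \<le>
            (2 ^ multi_degree p \<alpha> * 2 ^ multi_degree p \<beta>) * (M * K ^ multi_degree p (\<alpha> + \<beta>)) * monomial {..<p} (\<lambda>_. \<delta>) \<beta>"
          unfolding norm_mult norm_of_nat norm_monomial
          using M(1) K(1) by (intro mult_mono[OF 1 2]) (auto intro: monomial_nonneg)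
        also have "\<dots> = M * (2 * K) ^ multi_degree p \<alpha> * ((2 * K) ^ multi_degree p \<beta> * monomial {..<p} (\<lambda>_. \<delta>) \<beta>)"
          by (simp add: multi_degree_add power_add power_mult_distrib mult_ac)
        also have "\<dots> \<le> ?B \<beta>" using M(1) K(1) by (intro mult_left_mono[OF 3]) auto
        finally show ?thesis .
      qed
      ultimately have "norm (f y \<alpha> I) \<le> M * (2 * K) ^ multi_degree p \<alpha> * T" by (rule norm_infsum_le)
      then show ?thesis by (simp add: mult_ac)
    qed
    then show ?thesis using M(1) T by (intro exI[of _ "M * T"]) auto
  qed
  moreover have "2 * K \<ge> 1" using K(1) by simp
  ultimately have "sf_bounded p (polydisc p x0 \<delta>) f" unfolding sf_bounded_def by blast
  then show thesis using \<delta> R by (intro that[of \<delta>]) auto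
qed

section \<open>Superfunctions in the three categories\<close>

definition locally_polydisc :: "nat \<Rightarrow> (nat \<Rightarrow> 'k::real_normed_field) set \<Rightarrow> bool" where
  "locally_polydisc p D \<longleftrightarrow> (\<forall>x\<in>D. (\<forall>i\<ge>p. x i = 0) \<and> (\<exists>e>0. polydisc p x e \<subseteq> D))"

lemma openin_model_space_imp_locally_polydisc:
  fixes D :: "(nat \<Rightarrow> 'k::real_normed_field) set"
  assumes D: "openin (top_of_set (model_space cat p)) D" and cat: "cat \<noteq> Formal"
  shows "locally_polydisc p D"
proof -
  obtain T where T: "open T" "D = model_space cat p \<inter> T" using D by (auto simp: openin_open)
  have model: "model_space cat p = {x. \<forall>i\<ge>p. x i = (0::'k)}" using cat by (simp add: model_space_def)
  have "\<exists>e>0. polydisc p x e \<subseteq> D" if x: "x \<in> D" for x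
  proof -
    have "openin (product_topology (\<lambda>_. euclidean) UNIV) T"
      using T(1) by (simp add: euclidean_product_topology)
    then obtain X where X: "x \<in> (\<Pi>\<^sub>E i\<in>UNIV. X i)" "\<And>i. open (X i)" "(\<Pi>\<^sub>E i\<in>UNIV. X i) \<subseteq> T"
      using product_topology_open_contains_basis[of "\<lambda>_. euclidean" UNIV T x] x T(2) by auto
    have "\<forall>i. \<exists>e>0. ball (x i) e \<subseteq> X i"
      using X(1,2) open_contains_ball by (metis PiE_mem UNIV_I)
    then obtain e where e: "\<And>i. e i > 0" "\<And>i. ball (x i) (e i) \<subseteq> X i" by metis
    \<comment> \<open>Only the first p radii count, as the other coordinates are fixed at 0. The
      element 1 keeps the set nonempty for p = 0.\<close>
    define \<delta> where "\<delta> = Min (insert 1 (e ` {..<p}))"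
    have \<delta>: "\<delta> > 0" "\<And>i. i < p \<Longrightarrow> \<delta> \<le> e i" using e(1) by (auto simp: \<delta>_def)
    have "y \<in> D" if y: "y \<in> polydisc p x \<delta>" for y
    proof -
      have "y i \<in> X i" for i
      proof (cases "i < p")
        case True
        then have "y i \<in> ball (x i) (e i)"
          using y \<delta>(2)[OF True] by (auto simp: polydisc_def dist_norm norm_minus_commute intro: less_le_trans)
        then show ?thesis using e(2) by blast
      next
        case False
        then have "y i = x i" using y x T(2) model by (auto simp: polydisc_def)
        then show ?thesis using X(1) by auto
      qed
      then have "y \<in> T" using X(3) by auto
      then show ?thesis using y T(2) model by (auto simp: polydisc_def)
    qed
    then show ?thesis using \<delta>(1) by blast
  qed
  then show ?thesis using T(2) model by (auto simp: locally_polydisc_def)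
qed

lemma openin_polydisc:
  assumes "cat \<noteq> Formal"
  shows "openin (top_of_set (model_space cat p)) (polydisc p x0 e)"
proof -
  have "open {x. norm (x i - x0 i) < e}" for i
    by (intro open_Collect_less continuous_intros continuous_on_product_coordinates)
  then have "open (\<Inter>i<p. {x. norm (x i - x0 i) < e})" by (intro open_INT) auto
  moreover have "polydisc p x0 e = model_space cat p \<inter> (\<Inter>i<p. {x. norm (x i - x0 i) < e})"
    using assms by (auto simp: polydisc_def model_space_def)
  ultimately show ?thesis by (auto simp: openin_open)
qed

lemma superfunctions_iff:
  "f \<in> superfunctions cat p q D \<longleftrightarrow> sf_supported p q D f \<and> (cat \<noteq> Formal \<longrightarrow> smooth_jets p D f) \<and>
     (cat = Analytic \<longrightarrow> analytic_jets p D f)"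
  by (cases cat) (auto simp: superfunctions_def sf_supported_def analytic_jets_def)

lemma sf_bounded_subset: "sf_bounded p D f \<Longrightarrow> E \<subseteq> D \<Longrightarrow> sf_bounded p E f"
  unfolding sf_bounded_def by (meson subsetD)

lemma polydisc_mono: "d \<le> e \<Longrightarrow> polydisc p x d \<subseteq> polydisc p x e"
  by (force simp: polydisc_def)

lemma polydisc_center: "e > 0 \<Longrightarrow> (\<forall>i\<ge>p. x i = 0) \<Longrightarrow> x \<in> polydisc p x e"
  by (simp add: polydisc_def)

text \<open>The definition controls the expansion of the function itself; the bound controls all
  jets at all nearby points, and so passes to sums and derivatives without further convergence
  arguments.\<close>

lemma analytic_jets_iff:
  fixes f :: "'k::{real_normed_field,banach} sfun"
  assumes D: "locally_polydisc p D" and supp: "sf_supported p q D f"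
  shows "analytic_jets p D f \<longleftrightarrow> smooth_jets p D f \<and>
    (\<forall>x\<in>D. \<exists>\<delta>>0. polydisc p x \<delta> \<subseteq> D \<and> sf_bounded p (polydisc p x \<delta>) f)"
proof (intro iffI conjI ballI)
  assume f: "analytic_jets p D f"
  then show sm: "smooth_jets p D f" by (simp add: analytic_jets_def)
  fix x assume x: "x \<in> D"
  then obtain e where e: "e > 0" "polydisc p x e \<subseteq> D" "\<And>i. i \<ge> p \<Longrightarrow> x i = 0"
    using D by (auto simp: locally_polydisc_def)
  obtain \<rho> where \<rho>: "\<rho> > 0" "\<And>y I. y \<in> D \<Longrightarrow> (\<And>i. i < p \<Longrightarrow> norm (y i - x i) < \<rho>) \<Longrightarrow>
      ((\<lambda>\<alpha>. f x \<alpha> I * (\<Prod>i<p. (y i - x i) ^ mexp \<alpha> i)) has_sum f y 0 I) UNIV"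
    using f x unfolding analytic_jets_def by meson
  obtain \<delta> where \<delta>: "\<delta> > 0" "\<delta> \<le> e" "sf_bounded p (polydisc p x \<delta>) f"
    using analytic_imp_locally_bounded[OF sm supp e(2,1,3) \<rho>] by blast
  then show "\<exists>\<delta>>0. polydisc p x \<delta> \<subseteq> D \<and> sf_bounded p (polydisc p x \<delta>) f"
    using e(2) polydisc_mono[OF \<delta>(2)] by blast
next
  assume f: "smooth_jets p D f \<and> (\<forall>x\<in>D. \<exists>\<delta>>0. polydisc p x \<delta> \<subseteq> D \<and> sf_bounded p (polydisc p x \<delta>) f)"
  have "\<exists>\<rho>>0. \<forall>y\<in>D. (\<forall>i<p. norm (y i - x i) < \<rho>) \<longrightarrow>
      (\<forall>I. ((\<lambda>\<alpha>. f x \<alpha> I * (\<Prod>i<p. (y i - x i) ^ mexp \<alpha> i)) has_sum f y 0 I) UNIV)"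
    if x: "x \<in> D" for x
  proof -
    obtain \<delta> where \<delta>: "\<delta> > 0" "polydisc p x \<delta> \<subseteq> D" "sf_bounded p (polydisc p x \<delta>) f" using f x by blast
    have z: "\<forall>i\<ge>p. y i = 0" if "y \<in> D" for y using D that by (simp add: locally_polydisc_def)
    have sm: "smooth_jets p (polydisc p x \<delta>) f" using f \<delta>(2) by (blast intro: smooth_jets_subset)
    obtain \<rho> where \<rho>: "\<rho> > 0" "\<And>y I. y \<in> polydisc p x \<delta> \<Longrightarrow> (\<And>i. i < p \<Longrightarrow> norm (y i - x i) < \<rho>) \<Longrightarrow>
        ((\<lambda>\<alpha>. f x \<alpha> I * (\<Prod>i<p. (y i - x i) ^ mexp \<alpha> i)) has_sum f y 0 I) UNIV"
      using sf_bounded_expansion[OF sm \<delta>(3) supp polydisc_center[OF \<delta>(1) z[OF x]]] by blast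
    show ?thesis
    proof (intro exI[of _ "min \<rho> \<delta>"] conjI ballI impI allI)
      show "min \<rho> \<delta> > 0" using \<rho>(1) \<delta>(1) by simp
      fix y I assume y: "y \<in> D" "\<forall>i<p. norm (y i - x i) < min \<rho> \<delta>"
      then have "y \<in> polydisc p x \<delta>" using z[OF y(1)] by (simp add: polydisc_def)
      then show "((\<lambda>\<alpha>. f x \<alpha> I * (\<Prod>i<p. (y i - x i) ^ mexp \<alpha> i)) has_sum f y 0 I) UNIV"
        using y(2) by (intro \<rho>(2)) auto
    qed
  qed
  then show "analytic_jets p D f" using f by (simp add: analytic_jets_def)
qed

lemma superfunctions_iff_bounded:
  fixes f :: "'k::{real_normed_field,banach} sfun"
  assumes D: "cat \<noteq> Formal \<longrightarrow> locally_polydisc p D"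
  shows "f \<in> superfunctions cat p q D \<longleftrightarrow> sf_supported p q D f \<and> (cat \<noteq> Formal \<longrightarrow> smooth_jets p D f) \<and>
    (cat = Analytic \<longrightarrow> (\<forall>x\<in>D. \<exists>\<delta>>0. polydisc p x \<delta> \<subseteq> D \<and> sf_bounded p (polydisc p x \<delta>) f))"
proof (cases "cat = Analytic \<and> sf_supported p q D f")
  case True
  then show ?thesis using analytic_jets_iff[of p D q f] D by (auto simp: superfunctions_iff)
next
  case False
  then show ?thesis by (auto simp: superfunctions_iff)
qed

context
  fixes cat :: category and p q :: nat and D :: "(nat \<Rightarrow> 'k::{real_normed_field,banach}) set"
  assumes D: "cat \<noteq> Formal \<longrightarrow> locally_polydisc p D"
begin

lemma superfunctionsI:
  assumes "sf_supported p q D f" "cat \<noteq> Formal \<Longrightarrow> smooth_jets p D f"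
    and "\<And>x. cat = Analytic \<Longrightarrow> x \<in> D \<Longrightarrow> \<exists>\<delta>>0. polydisc p x \<delta> \<subseteq> D \<and> sf_bounded p (polydisc p x \<delta>) f"
  shows "f \<in> superfunctions cat p q D"
  using assms unfolding superfunctions_iff_bounded[OF D] by blast

lemma superfunctionsD:
  assumes "f \<in> superfunctions cat p q D"
  shows "sf_supported p q D f" "cat \<noteq> Formal \<Longrightarrow> smooth_jets p D f"
    and "cat = Analytic \<Longrightarrow> x \<in> D \<Longrightarrow> \<exists>\<delta>>0. polydisc p x \<delta> \<subseteq> D \<and> sf_bounded p (polydisc p x \<delta>) f"
  using assms unfolding superfunctions_iff_bounded[OF D] by blast+

lemma superfunctions_zero: "0 \<in> superfunctions cat p q D"
proof -
  have "smooth_jets p D 0" "analytic_jets p D 0" for D :: "(nat \<Rightarrow> 'k) set"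
    by (auto simp: smooth_jets_def analytic_jets_def intro: exI[of _ 1])
  then show ?thesis by (simp add: superfunctions_iff sf_supported_zero)
qed

lemma superfunctions_deriv:
  assumes f: "f \<in> superfunctions cat p q D"
  shows "sf_deriv p c f \<in> superfunctions cat p q D"
proof (rule superfunctionsI)
  show "sf_supported p q D (sf_deriv p c f)" "cat \<noteq> Formal \<Longrightarrow> smooth_jets p D (sf_deriv p c f)"
    using superfunctionsD(1,2)[OF f] by (simp_all add: sf_supported_deriv smooth_jets_deriv)
  show "\<exists>\<delta>>0. polydisc p x \<delta> \<subseteq> D \<and> sf_bounded p (polydisc p x \<delta>) (sf_deriv p c f)"
    if "cat = Analytic" "x \<in> D" for x
    using superfunctionsD(3)[OF f that] sf_bounded_deriv by blast
qed

lemma superfunctions_coeff_mult: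
  assumes f: "f \<in> superfunctions cat p q D"
  shows "(\<lambda>x \<alpha> I. k I * f x \<alpha> I) \<in> superfunctions cat p q D"
proof (rule superfunctionsI)
  show "sf_supported p q D (\<lambda>x \<alpha> I. k I * f x \<alpha> I)"
    using superfunctionsD(1)[OF f] unfolding sf_supported_def by force
  show "cat \<noteq> Formal \<Longrightarrow> smooth_jets p D (\<lambda>x \<alpha> I. k I * f x \<alpha> I)"
    using superfunctionsD(2)[OF f] by (rule smooth_jets_coeff_mult)
  fix x assume "cat = Analytic" "x \<in> D"
  then obtain \<delta> where "\<delta> > 0" "polydisc p x \<delta> \<subseteq> D" "sf_bounded p (polydisc p x \<delta>) f"
    using superfunctionsD(3)[OF f] by blast
  then show "\<exists>\<delta>>0. polydisc p x \<delta> \<subseteq> D \<and> sf_bounded p (polydisc p x \<delta>) (\<lambda>x \<alpha> I. k I * f x \<alpha> I)"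
    using sf_bounded_coeff_mult[of p "polydisc p x \<delta>" f k "\<lambda>I. I"] by blast
qed

lemma superfunctions_scale: "f \<in> superfunctions cat p q D \<Longrightarrow> sf_scale k f \<in> superfunctions cat p q D"
  unfolding sf_scale_def by (rule superfunctions_coeff_mult)

lemma superfunctions_twist: "f \<in> superfunctions cat p q D \<Longrightarrow> sf_twist a f \<in> superfunctions cat p q D"
  unfolding sf_twist_def by (rule superfunctions_coeff_mult)

lemma superfunctions_add:
  assumes f: "f \<in> superfunctions cat p q D" and g: "g \<in> superfunctions cat p q D"
  shows "f + g \<in> superfunctions cat p q D"
proof (rule superfunctionsI)
  show "sf_supported p q D (f + g)"
    by (rule sf_supported_add[OF superfunctionsD(1)[OF f] superfunctionsD(1)[OF g]])
  show "smooth_jets p D (f + g)" if "cat \<noteq> Formal"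
    by (rule smooth_jets_add[OF superfunctionsD(2)[OF f that] superfunctionsD(2)[OF g that]])
  fix x assume x: "cat = Analytic" "x \<in> D"
  obtain d where d: "d > 0" "polydisc p x d \<subseteq> D" "sf_bounded p (polydisc p x d) f"
    using superfunctionsD(3)[OF f x] by blast
  obtain e where e: "e > 0" "sf_bounded p (polydisc p x e) g"
    using superfunctionsD(3)[OF g x] by blast
  have sub: "polydisc p x (min d e) \<subseteq> polydisc p x d" "polydisc p x (min d e) \<subseteq> polydisc p x e"
    by (rule polydisc_mono, simp)+
  have "sf_bounded p (polydisc p x (min d e)) (f + g)"
    by (rule sf_bounded_add[OF sf_bounded_subset[OF d(3) sub(1)] sf_bounded_subset[OF e(2) sub(2)]])
  moreover have "min d e > 0" "polydisc p x (min d e) \<subseteq> D" using d e sub by auto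
  ultimately show "\<exists>\<delta>>0. polydisc p x \<delta> \<subseteq> D \<and> sf_bounded p (polydisc p x \<delta>) (f + g)" by blast
qed

lemma superfunctions_sum:
  "(\<And>a. a \<in> S \<Longrightarrow> f a \<in> superfunctions cat p q D) \<Longrightarrow> sum f S \<in> superfunctions cat p q D"
  by (induction S rule: infinite_finite_induct)
    (simp_all only: sum.infinite sum.empty sum.insert not_False_eq_True superfunctions_zero superfunctions_add insert_iff simp_thms)

end

lemma tame_imp_superfunctions:
  fixes f :: "'k::{real_normed_field,banach} sfun"
  assumes f: "tame cat p q D f" and D: "cat \<noteq> Formal \<Longrightarrow> D = polydisc p x0 e"
  shows "f \<in> superfunctions cat p q D"
proof -
  have "analytic_jets p D f" if "cat = Analytic"
  proof -
    have supp: "sf_supported p q D f" and sm: "smooth_jets p (polydisc p x0 e) f"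
      and bd: "sf_bounded p (polydisc p x0 e) f"
      using f D that by (auto simp: tame_def)
    have "\<exists>\<rho>>0. \<forall>y\<in>polydisc p x0 e. (\<forall>i<p. norm (y i - x i) < \<rho>) \<longrightarrow>
      (\<forall>I. ((\<lambda>\<alpha>. f x \<alpha> I * (\<Prod>i<p. (y i - x i) ^ mexp \<alpha> i)) has_sum f y 0 I) UNIV)"
      if "x \<in> polydisc p x0 e" for x
      by (rule sf_bounded_expansion[OF sm bd supp that]) blast
    then show ?thesis using sm D that by (auto simp: analytic_jets_def)
  qed
  then show ?thesis using f by (simp add: superfunctions_iff tame_def)
qed

lemma sf_restrict_deriv: "sf_deriv p c (sf_restrict E f) = sf_restrict E (sf_deriv p c f)"
  by (auto simp: sf_deriv_def sf_restrict_def fun_eq_iff)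

lemma sf_restrict_scale: "sf_scale k (sf_restrict E f) = sf_restrict E (sf_scale k f)"
  by (auto simp: sf_scale_def sf_restrict_def fun_eq_iff)

lemma sf_homogeneous_restrict: "sf_homogeneous d f \<Longrightarrow> sf_homogeneous d (sf_restrict E f)"
  by (auto simp: sf_homogeneous_def sf_restrict_def)

text \<open>The cutoff is harmless because along each coordinate direction the polydisc is an open
  disc.\<close>

lemma smooth_jets_restrict:
  assumes f: "smooth_jets p (polydisc p x0 e) f"
  shows "smooth_jets p (polydisc p x0 e) (sf_restrict (polydisc p x0 e) f)"
proof (rule smooth_jetsI)
  let ?E = "polydisc p x0 e"
  show "continuous_on ?E (\<lambda>x. sf_restrict ?E f x \<alpha> I)" for \<alpha> I
    by (rule continuous_on_eq[OF smooth_jetsD(1)[OF f]]) (simp add: sf_restrict_def)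
  fix \<alpha> I i x assume i: "i < p" and x: "x \<in> ?E"
  have "((\<lambda>u. sf_restrict ?E f (x(i := u)) \<alpha> I) has_field_derivative
      of_nat (mexp \<alpha> i + 1) * f x (\<alpha> + Poly_Mapping.single i 1) I) (at (x i))"
  proof (rule has_field_derivative_transform_within_open[OF smooth_jetsD(2)[OF f i x] open_ball polydisc_ball[OF x i]])
    show "f (x(i := u)) \<alpha> I = sf_restrict ?E f (x(i := u)) \<alpha> I" if "u \<in> ball (x0 i) e" for u
      using polydisc_upd[OF x i that] by (simp add: sf_restrict_def)
  qed
  then show "((\<lambda>u. sf_restrict ?E f (x(i := u)) \<alpha> I) has_field_derivative
      of_nat (mexp \<alpha> i + 1) * sf_restrict ?E f x (\<alpha> + Poly_Mapping.single i 1) I) (at (x i))"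
    using x by (simp add: sf_restrict_def)
qed

lemma finite_common_radius:
  fixes Q :: "'a \<Rightarrow> real \<Rightarrow> bool"
  assumes "finite S" "\<And>s. s \<in> S \<Longrightarrow> \<exists>e>0. Q s e" "\<And>s d e. Q s e \<Longrightarrow> 0 < d \<Longrightarrow> d \<le> e \<Longrightarrow> Q s d"
  shows "\<exists>e>0. \<forall>s\<in>S. Q s e"
  using assms(1,2)
proof (induction S rule: finite_induct)
  case empty
  show ?case by (rule exI[of _ 1]) simp
next
  case (insert s S)
  then obtain e where "e > 0" "\<forall>s\<in>S. Q s e" by auto
  moreover obtain d where "d > 0" "Q s d" using insert.prems by blast
  ultimately show ?case using assms(3) by (intro exI[of _ "min d e"]) (auto simp: min_def intro: less_imp_le)
qed

text \<open>Antiderivatives run along segments from a centre, so D is first shrunk to one polydisc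
  serving all components. In the formal category there is a single point and D itself can be
  kept.\<close>

lemma local_super_poincare:
  fixes \<omega> :: "nat \<Rightarrow> nat \<Rightarrow> 'k::{real_normed_field,banach} sfun"
  assumes D: "openin (top_of_set (model_space cat p)) D" and x0: "x0 \<in> D"
    and \<omega>: "\<And>b c. b < p + q \<Longrightarrow> c < n \<Longrightarrow> \<omega> b c \<in> superfunctions cat p q D"
    and hom: "\<And>b c. b < p + q \<Longrightarrow> c < n \<Longrightarrow> sf_homogeneous (d c \<noteq> odd (par p b)) (\<omega> b c)"
    and closed: "\<And>a b c. a < p + q \<Longrightarrow> b < p + q \<Longrightarrow> c < n \<Longrightarrow>
      sf_deriv p a (\<omega> b c) = sf_scale ((- 1) ^ (par p a * par p b)) (sf_deriv p b (\<omega> a c))"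
  obtains E A where "x0 \<in> E" "E \<subseteq> D" "openin (top_of_set (model_space cat p)) E"
    "\<And>c. c < n \<Longrightarrow> A c \<in> superfunctions cat p q E" "\<And>c. c < n \<Longrightarrow> sf_homogeneous (d c) (A c)"
    "\<And>b c. b < p + q \<Longrightarrow> c < n \<Longrightarrow> sf_deriv p b (A c) = sf_restrict E (\<omega> b c)"
proof -
  obtain E e where E: "x0 \<in> E" "E \<subseteq> D" "openin (top_of_set (model_space cat p)) E" "cat \<noteq> Formal \<Longrightarrow> E = polydisc p x0 e"
    and tame: "\<And>b c. b < p + q \<Longrightarrow> c < n \<Longrightarrow> tame cat p q E (sf_restrict E (\<omega> b c))"
  proof (cases "cat = Formal")
    case True
    have "sf_restrict D (\<omega> b c) = \<omega> b c" if "b < p + q" "c < n" for b c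
      using sf_supportedD(1)[OF superfunctions_supported[OF \<omega>[OF that]]]
      by (auto simp: sf_restrict_def fun_eq_iff)
    then have "tame cat p q D (sf_restrict D (\<omega> b c))" if "b < p + q" "c < n" for b c
      using superfunctions_supported[OF \<omega>[OF that]] True that by (simp add: tame_def)
    then show thesis using that[of D 1] x0 D True by blast
  next
    case False
    have lD: "locally_polydisc p D" by (rule openin_model_space_imp_locally_polydisc[OF D False])
    have D': "cat \<noteq> Formal \<longrightarrow> locally_polydisc p D" using lD ..
    \<comment> \<open>The analytic bounds hold on polydiscs depending on the component. They persist
      for smaller radii, and there are finitely many components.\<close>
    let ?Q = "\<lambda>(b, c) e. polydisc p x0 e \<subseteq> D \<and> (cat = Analytic \<longrightarrow> sf_bounded p (polydisc p x0 e) (\<omega> b c))"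
    obtain e0 where e0: "e0 > 0" "polydisc p x0 e0 \<subseteq> D" and xz: "\<forall>i\<ge>p. x0 i = 0"
      using lD x0 unfolding locally_polydisc_def by blast
    have "\<exists>e>0. \<forall>s\<in>{..<p + q} \<times> {..<n}. ?Q s e"
    proof (rule finite_common_radius)
      show "\<exists>e>0. ?Q s e" if "s \<in> {..<p + q} \<times> {..<n}" for s
      proof (cases "cat = Analytic")
        case True
        then show ?thesis using \<omega>[of "fst s" "snd s"] that x0 unfolding superfunctions_iff_bounded[OF D']
          by (cases s) auto
      next
        case False
        then show ?thesis using e0 by (cases s) auto
      qed
      show "?Q s d" if "?Q s e" "0 < d" "d \<le> e" for s d e
        using that polydisc_mono[of d e p x0] by (cases s) (auto intro: sf_bounded_subset)
    qed simp
    then obtain e1 where e1: "e1 > 0" "\<And>b c. b < p + q \<Longrightarrow> c < n \<Longrightarrow> cat = Analytic \<Longrightarrow> sf_bounded p (polydisc p x0 e1) (\<omega> b c)"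
      by fastforce
    define e where "e = min e0 e1"
    let ?E = "polydisc p x0 e"
    have e: "e > 0" "?E \<subseteq> D" using e0 e1 polydisc_mono[of e e0 p x0] by (auto simp: e_def)
    have "tame cat p q ?E (sf_restrict ?E (\<omega> b c))" if bc: "b < p + q" "c < n" for b c
    proof -
      have "sf_supported p q ?E (sf_restrict ?E (\<omega> b c))"
        using superfunctions_supported[OF \<omega>[OF bc]] unfolding sf_supported_def sf_restrict_def by auto
      moreover have "smooth_jets p ?E (sf_restrict ?E (\<omega> b c))"
        using \<omega>[OF bc] False e(2) by (intro smooth_jets_restrict) (auto simp: superfunctions_iff intro: smooth_jets_subset)
      moreover have "sf_bounded p ?E (sf_restrict ?E (\<omega> b c))" if "cat = Analytic"
        using sf_bounded_subset[OF e1(2)[OF bc that] polydisc_mono[of e e1]]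
        by (simp add: sf_bounded_def sf_restrict_def e_def cong: ball_cong)
      ultimately show ?thesis by (simp add: tame_def)
    qed
    then show thesis using that[of ?E e] polydisc_center[OF e(1) xz] e(2) openin_polydisc[OF False] by blast
  qed
  have "\<exists>A. A \<in> superfunctions cat p q E \<and> sf_homogeneous (d c) A \<and>
      (\<forall>b<p + q. sf_deriv p b A = sf_restrict E (\<omega> b c))" if c: "c < n" for c
  proof -
    have "cat = Formal \<or> E = polydisc p x0 e" using E(4) by blast
    from super_poincare[where \<omega> = "\<lambda>b. sf_restrict E (\<omega> b c)" and d = "d c", OF this tame[OF _ c]
        sf_homogeneous_restrict[OF hom[OF _ c]]]
    obtain A where "tame cat p q E A" "sf_homogeneous (d c) A" "\<And>b. b < p + q \<Longrightarrow> sf_deriv p b A = sf_restrict E (\<omega> b c)"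
      using closed c by (metis sf_restrict_deriv sf_restrict_scale)
    then show ?thesis using tame_imp_superfunctions[of cat p q E A x0 e] E(4) by blast
  qed
  then obtain A where "\<And>c. c < n \<Longrightarrow> A c \<in> superfunctions cat p q E \<and> sf_homogeneous (d c) (A c) \<and>
      (\<forall>b<p + q. sf_deriv p b (A c) = sf_restrict E (\<omega> b c))" by metis
  then show thesis using that[of E A] E(1-3) by blast
qed

section \<open>The multiplication defined by a primitive solution\<close>

lemma sf_deriv_const: "sf_deriv p c (sf_const D k) = 0"
proof -
  have "\<alpha> + Poly_Mapping.single c (Suc 0) \<noteq> 0" for \<alpha> :: "nat \<Rightarrow>\<^sub>0 nat"
    by (metis add_is_0 lookup_add lookup_single_eq lookup_zero nat.distinct(1))
  then show ?thesis by (auto simp: sf_deriv_def sf_const_def fun_eq_iff)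
qed

lemma sf_deriv_coord:
  "sf_deriv p a (sf_coord p D c) = (if a = c then sf_const D 1 else 0)"
proof -
  have 1: "\<alpha> + Poly_Mapping.single i (Suc 0) \<noteq> 0" for \<alpha> :: "nat \<Rightarrow>\<^sub>0 nat" and i
    by (metis add_is_0 lookup_add lookup_single_eq lookup_zero nat.distinct(1))
  have 2: "\<alpha> + Poly_Mapping.single a (Suc 0) = Poly_Mapping.single c (Suc 0) \<longleftrightarrow> \<alpha> = 0 \<and> a = c"
    for \<alpha> :: "nat \<Rightarrow>\<^sub>0 nat"
  proof
    assume eq: "\<alpha> + Poly_Mapping.single a (Suc 0) = Poly_Mapping.single c (Suc 0)"
    then have "mexp \<alpha> a + 1 = mexp (Poly_Mapping.single c (Suc 0)) a"
      by (metis Suc_eq_plus1 One_nat_def lookup_add lookup_single_eq)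
    then have "a = c" by (auto simp: lookup_single when_def split: if_splits)
    with eq show "\<alpha> = 0 \<and> a = c" by simp
  qed simp
  have 4: "Poly_Mapping.single i (Suc 0) \<noteq> 0" for i :: nat
    using 1[of 0 i] by simp
  have 3: "insert u I = {v} \<longleftrightarrow> I = {} \<and> u = v" if "u \<notin> I" for u v :: nat and I
    using that by auto
  show ?thesis
    by (auto simp: sf_deriv_def sf_coord_def sf_const_def fun_eq_iff 1 2 3 4)
qed

lemma sf_mult_uminus_left: "sf_mult (- f) g = - sf_mult f g"
  using sf_mult_scale_left[of "- 1" f g] by (simp add: sf_scale_minus_one)

lemma sf_twist_odd:
  assumes "sf_homogeneous (odd j) f"
  shows "sf_twist a f = sf_scale ((- 1) ^ (a * j)) f"
  using sf_twist_homogeneous[OF assms, of a] by (simp add: uminus_power_if)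

lemma sf_twist_const: "sf_twist a (sf_const D k) = sf_const D k"
  by (auto simp: sf_twist_def sf_const_def fun_eq_iff)

lemma sf_twist_even: "even a \<Longrightarrow> sf_twist a f = f"
  by (auto simp: sf_twist_def fun_eq_iff uminus_power_if)

text \<open>The algebraic facts that a chart transports from the structure sheaf, stated on the
  coordinate side. Sums, scalings and derivatives are absent because their closure follows from the
  local description of superfunctions.\<close>

locale superdomain =
  fixes cat :: category and r s :: nat and D :: "(nat \<Rightarrow> 'k::{real_normed_field,banach}) set"
  assumes locally_polydisc: "cat \<noteq> Formal \<longrightarrow> locally_polydisc r D"
    and mult_closed: "\<And>f g. f \<in> superfunctions cat r s D \<Longrightarrow> g \<in> superfunctions cat r s D \<Longrightarrow>
      sf_mult f g \<in> superfunctions cat r s D"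
    and mult_assoc: "\<And>f g h. f \<in> superfunctions cat r s D \<Longrightarrow> g \<in> superfunctions cat r s D \<Longrightarrow>
      h \<in> superfunctions cat r s D \<Longrightarrow> sf_mult (sf_mult f g) h = sf_mult f (sf_mult g h)"
    and one_closed: "sf_const D 1 \<in> superfunctions cat r s D"
    and mult_one_left: "\<And>f. f \<in> superfunctions cat r s D \<Longrightarrow> sf_mult (sf_const D 1) f = f"
    and mult_one_right: "\<And>f. f \<in> superfunctions cat r s D \<Longrightarrow> sf_mult f (sf_const D 1) = f"
    and mult_supercommute: "\<And>d d' f g. f \<in> superfunctions cat r s D \<Longrightarrow> g \<in> superfunctions cat r s D \<Longrightarrow>
      sf_homogeneous d f \<Longrightarrow> sf_homogeneous d' g \<Longrightarrow>
      sf_mult f g = (if d \<and> d' then - sf_mult g f else sf_mult g f)"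
    and decompose: "\<And>f. f \<in> superfunctions cat r s D \<Longrightarrow> \<exists>g h. g \<in> superfunctions cat r s D \<and>
      h \<in> superfunctions cat r s D \<and> sf_homogeneous False g \<and> sf_homogeneous True h \<and> f = g + h"
begin

abbreviation "S \<equiv> superfunctions cat r s D"
abbreviation "n \<equiv> r + s"
abbreviation "pr \<equiv> par r"

lemmas closed = mult_closed one_closed superfunctions_zero[OF locally_polydisc]
  superfunctions_scale[OF locally_polydisc] superfunctions_twist[OF locally_polydisc]
  superfunctions_deriv[OF locally_polydisc] superfunctions_sum[OF locally_polydisc]

lemma const_eq_scale: "sf_const D k = sf_scale k (sf_const D 1)"
  by (simp add: sf_scale_const)

lemma const_closed: "sf_const D k \<in> S"
  by (subst const_eq_scale) (intro closed)

lemma mult_const_left: "f \<in> S \<Longrightarrow> sf_mult (sf_const D k) f = sf_scale k f"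
  by (subst const_eq_scale) (simp add: sf_mult_scale_left mult_one_left)

lemma mult_swap:
  assumes "f \<in> S" "g \<in> S" "sf_homogeneous (odd i) f" "sf_homogeneous (odd j) g"
  shows "sf_mult f g = sf_scale ((- 1) ^ (i * j)) (sf_mult g f)"
  using mult_supercommute[OF assms] by (auto simp: uminus_power_if sf_scale_minus_one)

text \<open>Here g is arbitrary: after splitting it into even and odd parts, the twist distributes
  the two signs. Coefficients of general vector fields are moved in this way.\<close>

lemma mult_twist:
  assumes f: "f \<in> S" "sf_homogeneous (odd j) f" and g: "g \<in> S"
  shows "sf_mult f g = sf_mult (sf_twist j g) f"
proof -
  obtain g0 g1 where g01: "g0 \<in> S" "g1 \<in> S" "sf_homogeneous (odd (0::nat)) g0" "sf_homogeneous (odd (1::nat)) g1" "g = g0 + g1"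
    using decompose[OF g] by auto
  have "sf_twist j g = sf_scale ((- 1) ^ (j * 0)) g0 + sf_scale ((- 1) ^ (j * 1)) g1"
    unfolding g01(5) sf_twist_add by (simp only: sf_twist_odd[OF g01(3)] sf_twist_odd[OF g01(4)])
  then show ?thesis
    using mult_swap[OF f(1) g01(1) f(2) g01(3)] mult_swap[OF f(1) g01(2) f(2) g01(4)]
    unfolding g01(5) sf_mult_add_right by (simp only: sf_mult_add_left sf_mult_scale_left)
qed

end

text \<open>X is the matrix of B in the basis of the fiber given by the flat coordinate fields. Base
  and fiber thus have the same dimension r|s, and one parity function serves for both.\<close>

locale primitive_solution = superdomain cat r s D
  for cat :: category and r s :: nat and D :: "(nat \<Rightarrow> 'k::{real_normed_field,banach}) set" +
  fixes X :: "nat \<Rightarrow> nat \<Rightarrow> 'k sfun" and H a0 :: "nat \<Rightarrow> 'k"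
  assumes X_closed: "\<And>b c. b < r + s \<Longrightarrow> c < r + s \<Longrightarrow> X b c \<in> superfunctions cat r s D"
    and X_homogeneous: "\<And>b c. b < r + s \<Longrightarrow> c < r + s \<Longrightarrow> sf_homogeneous (odd (par r b + par r c)) (X b c)"
    and commutativity: "\<And>a b d c. a < r + s \<Longrightarrow> b < r + s \<Longrightarrow> d < r + s \<Longrightarrow> c < r + s \<Longrightarrow>
      endo_comp (r + s) (endo_deriv r r a X) (endo_deriv r r b X) d c =
      sf_scale ((- 1) ^ (par r a * par r b)) (endo_comp (r + s) (endo_deriv r r b X) (endo_deriv r r a X) d c)"
    and H_even: "\<And>c. c \<ge> r \<Longrightarrow> H c = 0"
    and flat: "\<And>c. c < r + s \<Longrightarrow> apply_const (r + s) X H c =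
      sf_scale ((- 1) ^ par r c) (sf_coord r D c + sf_const D (a0 c))"
begin

abbreviation "C a \<equiv> endo_deriv r r a X"

text \<open>The structure constants. The exponent (|b|+1)(|b|+|c|) of the potential equation is
  |c|(1+|b|) modulo 2, and the additional |a||c| cancels the sign inside
  \<open>endo_deriv\<close>.\<close>

definition K :: "nat \<Rightarrow> nat \<Rightarrow> nat \<Rightarrow> 'k sfun" where
  "K a b c = sf_scale ((- 1) ^ (pr c * (1 + pr a + pr b))) (C a b c)"

lemma C_closed: "b < n \<Longrightarrow> c < n \<Longrightarrow> C a b c \<in> S"
  unfolding endo_deriv_def by (intro closed X_closed)

lemma C_homogeneous:
  assumes "b < n" "c < n"
  shows "sf_homogeneous (odd (pr a + pr b + pr c)) (C a b c)"
proof -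
  have "sf_homogeneous (odd (pr b + pr c) \<noteq> odd (pr a)) (sf_deriv r a (X b c))"
    by (rule sf_homogeneous_deriv[OF superfunctions_supported[OF X_closed[OF assms]] X_homogeneous[OF assms]])
  also have "(odd (pr b + pr c) \<noteq> odd (pr a)) = odd (pr a + pr b + pr c)" by auto
  finally show ?thesis unfolding endo_deriv_def by (rule sf_homogeneous_scale)
qed

lemma K_closed: "b < n \<Longrightarrow> c < n \<Longrightarrow> K a b c \<in> S"
  unfolding K_def by (intro closed C_closed)

lemma K_homogeneous: "b < n \<Longrightarrow> c < n \<Longrightarrow> sf_homogeneous (odd (pr a + pr b + pr c)) (K a b c)"
  unfolding K_def by (intro sf_homogeneous_scale C_homogeneous)

text \<open>The sign of the left coefficients cancels the one in \<open>flat\<close>: the map has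
  components \<open>t\<^sup>c + a\<^sup>c\<close>, so its Jacobian is the identity.\<close>

lemma deriv_flat:
  assumes "a < n" "c < n"
  shows "sf_deriv r a (sf_scale ((- 1) ^ pr c) (apply_const n X H c)) = (if a = c then sf_const D 1 else 0)"
proof -
  have "(- 1) ^ pr c * (- 1) ^ pr c = (1::'k)" by (simp add: par_def)
  then show ?thesis
    by (simp only: flat[OF assms(2)] sf_scale_scale sf_scale_one sf_deriv_add sf_deriv_coord sf_deriv_const add_0_right)
qed

lemma C_H:
  assumes "a < n" "c < n"
  shows "(\<Sum>b<n. sf_scale (H b) (C a b c)) = (if a = c then sf_const D 1 else 0)"
proof -
  have "(\<Sum>b<n. sf_scale (H b) (C a b c)) =
      sf_scale ((- 1) ^ (pr a * pr c) * (- 1) ^ pr c) (sf_deriv r a (sf_scale ((- 1) ^ pr c) (apply_const n X H c)))"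
    unfolding apply_const_def endo_deriv_def sf_deriv_scale sf_deriv_sum sf_scale_sum sf_scale_scale
    by (intro sum.cong refl) (simp add: par_def mult_ac)
  \<comment> \<open>Only a = c survives, where the exponent |a||c| + |c| is even.\<close>
  also have "\<dots> = (if a = c then sf_const D 1 else 0)"
    unfolding deriv_flat[OF assms] by (auto simp: par_def)
  finally show ?thesis .
qed

text \<open>The value of \<open>\<partial>\<^sub>a B \<partial>\<^sub>b B\<close> on \<open>h\<close> is \<open>\<partial>\<^sub>a B(f\<^sub>b)\<close>, because \<open>\<partial>\<^sub>b B(h) = f\<^sub>b\<close>.\<close>

lemma C_symmetric:
  assumes "a < n" "b < n" "c < n"
  shows "C a b c = sf_scale ((- 1) ^ (pr a * pr b)) (C b a c)"
proof -
  have ev: "(\<Sum>d<n. sf_scale (H d) (endo_comp n (C a) (C b) d c)) = C a b c" if "a < n" "b < n" for a b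
  proof -
    have "(\<Sum>d<n. sf_scale (H d) (endo_comp n (C a) (C b) d c)) =
        (\<Sum>k<n. sf_mult (C a k c) (\<Sum>d<n. sf_scale (H d) (C b d k)))"
      unfolding endo_comp_def sf_scale_sum sf_mult_sum_right sf_mult_scale_right by (rule sum.swap)
    also have "\<dots> = (\<Sum>k<n. if k = b then C a b c else 0)"
      using C_H[OF that(2)] assms(3) that(2)
      by (intro sum.cong refl) (auto simp: mult_one_right C_closed)
    finally show ?thesis using that(2) by simp
  qed
  have "C a b c = (\<Sum>d<n. sf_scale (H d) (sf_scale ((- 1) ^ (pr a * pr b)) (endo_comp n (C b) (C a) d c)))"
    unfolding ev[OF assms(1,2), symmetric]
    by (intro sum.cong refl arg_cong[where f = "sf_scale _"] commutativity assms) simp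
  also have "\<dots> = sf_scale ((- 1) ^ (pr a * pr b)) (\<Sum>d<n. sf_scale (H d) (endo_comp n (C b) (C a) d c))"
    by (simp add: sf_scale_sum mult.commute)
  finally show ?thesis unfolding ev[OF assms(2,1)] .
qed

lemma K_symmetric:
  assumes "a < n" "b < n" "c < n"
  shows "K a b c = sf_scale ((- 1) ^ (pr a * pr b)) (K b a c)"
proof -
  have "(- 1) ^ (pr c * (1 + pr a + pr b)) * (- 1) ^ (pr a * pr b) =
      (- 1) ^ (pr a * pr b) * ((- 1) ^ (pr c * (1 + pr b + pr a)) :: 'k)"
    by (simp add: par_def)
  then show ?thesis by (simp only: K_def C_symmetric[OF assms] sf_scale_scale)
qed

text \<open>Up to signs the right side is \<open>C a\<close> applied to
  \<open>C b f\<^sub>d\<close>. The left side is \<open>C d\<close> applied to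
  \<open>C a f\<^sub>b\<close> by symmetry in c and d; supercommutativity makes this
  \<open>C a\<close> applied to \<open>C d f\<^sub>b\<close>, and symmetry in b and d
  finishes.\<close>

lemma K_associative:
  assumes "a < n" "b < n" "d < n" "e < n"
  shows "(\<Sum>c<n. sf_mult (K a b c) (K c d e)) = (\<Sum>c<n. sf_mult (sf_twist (pr a) (K b d c)) (K a c e))"
proof -
  \<comment> \<open>In the total sign the contraction index c cancels, so that the sign can be taken
    out of the sum.\<close>
  let ?\<sigma> = "(- 1) ^ (pr e * (1 + pr a + pr b + pr d)) :: 'k"
  have swap: "sf_mult (K i j k) (K i' j' k') =
      sf_scale ((- 1) ^ ((pr i + pr j + pr k) * (pr i' + pr j' + pr k'))) (sf_mult (K i' j' k') (K i j k))"
    if "j < n" "k < n" "j' < n" "k' < n" for i j k i' j' k'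
    using that by (intro mult_swap K_closed K_homogeneous)
  have "sf_mult (sf_twist (pr a) (K b d c)) (K a c e) = sf_scale ?\<sigma> (sf_mult (C a c e) (C b d c))" if c: "c < n" for c
  proof -
    have "sf_mult (sf_twist (pr a) (K b d c)) (K a c e) =
        sf_scale ((- 1) ^ (pr a * (pr b + pr d + pr c)) * ((- 1) ^ ((pr b + pr d + pr c) * (pr a + pr c + pr e)) *
          ((- 1) ^ (pr c * (1 + pr b + pr d)) * (- 1) ^ (pr e * (1 + pr a + pr c))))) (sf_mult (C a c e) (C b d c))"
      unfolding sf_twist_odd[OF K_homogeneous[OF assms(3) c]] sf_mult_scale_left swap[OF assms(3) c c assms(4)]
      unfolding K_def sf_mult_scale_left sf_mult_scale_right sf_scale_scale mult.assoc ..
    also have "(- 1) ^ (pr a * (pr b + pr d + pr c)) * ((- 1) ^ ((pr b + pr d + pr c) * (pr a + pr c + pr e)) *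
          ((- 1) ^ (pr c * (1 + pr b + pr d)) * (- 1) ^ (pr e * (1 + pr a + pr c)))) = ?\<sigma>"
      by (simp add: par_def)
    finally show ?thesis .
  qed
  then have R: "(\<Sum>c<n. sf_mult (sf_twist (pr a) (K b d c)) (K a c e)) = sf_scale ?\<sigma> (endo_comp n (C a) (C b) d e)"
    unfolding endo_comp_def sf_scale_sum by (intro sum.cong) auto
  let ?\<tau> = "(- 1) ^ (pr a * pr d) * ?\<sigma> * (- 1) ^ (pr b * pr d) :: 'k"
  have "sf_mult (K a b c) (K c d e) = sf_scale ?\<tau> (sf_mult (C d c e) (C a b c))" if c: "c < n" for c
  proof -
    have "sf_mult (K a b c) (K c d e) = sf_scale ((- 1) ^ (pr c * pr d) *
        ((- 1) ^ ((pr a + pr b + pr c) * (pr d + pr c + pr e)) *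
        ((- 1) ^ (pr c * (1 + pr a + pr b)) * (- 1) ^ (pr e * (1 + pr d + pr c))))) (sf_mult (C d c e) (C a b c))"
      unfolding K_symmetric[OF c assms(3,4)] sf_mult_scale_right swap[OF assms(2) c c assms(4)]
      unfolding K_def sf_mult_scale_left sf_mult_scale_right sf_scale_scale mult.assoc ..
    also have "(- 1) ^ (pr c * pr d) * ((- 1) ^ ((pr a + pr b + pr c) * (pr d + pr c + pr e)) *
        ((- 1) ^ (pr c * (1 + pr a + pr b)) * (- 1) ^ (pr e * (1 + pr d + pr c)))) = ?\<tau>"
      by (simp add: par_def)
    finally show ?thesis .
  qed
  then have "(\<Sum>c<n. sf_mult (K a b c) (K c d e)) = sf_scale ?\<tau> (endo_comp n (C d) (C a) b e)"
    unfolding endo_comp_def sf_scale_sum by (intro sum.cong) auto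
  also have "endo_comp n (C d) (C a) b e = sf_scale ((- 1) ^ (pr d * pr a)) (endo_comp n (C a) (C d) b e)"
    by (rule commutativity[OF assms(3,1,2,4)])
  also have "endo_comp n (C a) (C d) b e = sf_scale ((- 1) ^ (pr d * pr b)) (endo_comp n (C a) (C b) d e)"
    unfolding endo_comp_def sf_scale_sum
  proof (intro sum.cong refl)
    fix c assume "c \<in> {..<n}"
    then have c: "c < n" by simp
    show "sf_mult (C a c e) (C d b c) = sf_scale ((- 1) ^ (pr d * pr b)) (sf_mult (C a c e) (C b d c))"
      by (simp only: C_symmetric[OF assms(3,2) c] sf_mult_scale_right)
  qed
  also have "sf_scale ?\<tau> (sf_scale ((- 1) ^ (pr d * pr a)) (sf_scale ((- 1) ^ (pr d * pr b)) (endo_comp n (C a) (C b) d e))) =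
      sf_scale ?\<sigma> (endo_comp n (C a) (C b) d e)"
    unfolding sf_scale_scale by (simp add: par_def)
  finally show ?thesis unfolding R .
qed

text \<open>Since h is even, only even a contribute, and for these the symmetry of C is free of
  signs. It turns the sum into the known value of \<open>C b\<close> on h.\<close>

lemma K_H:
  assumes "b < n" "c < n"
  shows "(\<Sum>a<n. sf_scale (H a) (K a b c)) = (if b = c then sf_const D 1 else 0)"
proof -
  have "sf_scale (H a) (K a b c) = sf_scale ((- 1) ^ (pr c * (1 + pr b))) (sf_scale (H a) (C b a c))" if "a < n" for a
  proof (cases "a < r")
    case True
    then have "pr a = 0" by (simp add: par_def)
    then show ?thesis using C_symmetric[OF that assms] by (simp add: K_def mult.commute)
  next
    case False
    then show ?thesis using H_even by simp
  qed
  then have "(\<Sum>a<n. sf_scale (H a) (K a b c)) =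
      sf_scale ((- 1) ^ (pr c * (1 + pr b))) (\<Sum>a<n. sf_scale (H a) (C b a c))"
    unfolding sf_scale_sum by (intro sum.cong) auto
  then show ?thesis unfolding C_H[OF assms] by (auto simp: par_def)
qed

text \<open>The twist is the sign of moving \<open>\<partial>\<^sub>a\<close> past the coefficient \<open>Y b\<close>.\<close>

definition circ :: "(nat \<Rightarrow> 'k sfun) \<Rightarrow> (nat \<Rightarrow> 'k sfun) \<Rightarrow> nat \<Rightarrow> 'k sfun" where
  "circ U Y = (\<lambda>c. if c < n then
     \<Sum>a<n. \<Sum>b<n. sf_mult (U a) (sf_mult (sf_twist (pr a) (Y b)) (K a b c)) else 0)"

abbreviation "T \<equiv> vector_fields cat r s D"

lemma TD: "U \<in> T \<Longrightarrow> a < n \<Longrightarrow> U a \<in> S" "U \<in> T \<Longrightarrow> a \<ge> n \<Longrightarrow> U a = 0"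
  by (auto simp: vector_fields_def)

lemma circ_closed: "U \<in> T \<Longrightarrow> Y \<in> T \<Longrightarrow> circ U Y \<in> T"
  unfolding vector_fields_def circ_def by (auto intro!: closed K_closed)

lemma circ_add_left: "circ (U + V) Y = circ U Y + circ V Y"
  by (auto simp: circ_def fun_eq_iff sf_mult_add_left sum.distrib)

lemma circ_add_right: "circ U (V + Y) = circ U V + circ U Y"
  by (auto simp: circ_def fun_eq_iff sf_mult_add_left sf_mult_add_right sf_twist_add sum.distrib)

lemma circ_mult_left:
  assumes "f \<in> S" "U \<in> T" "Y \<in> T"
  shows "circ (vf_mult f U) Y = vf_mult f (circ U Y)"
proof
  fix c
  have "sf_mult (sf_mult f (U a)) (sf_mult (sf_twist (pr a) (Y b)) (K a b c)) =
      sf_mult f (sf_mult (U a) (sf_mult (sf_twist (pr a) (Y b)) (K a b c)))" if "a < n" "b < n" "c < n" for a b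
    using TD(1)[OF assms(2) that(1)] TD(1)[OF assms(3) that(2)] K_closed[OF that(2,3), of a] assms(1)
    by (intro mult_assoc closed)
  then show "circ (vf_mult f U) Y c = vf_mult f (circ U Y) c"
    by (simp add: circ_def vf_mult_def sf_mult_sum_right)
qed

lemma circ_mult_right:
  assumes f: "f \<in> S" "sf_homogeneous d f" and U: "U \<in> T" "vf_homogeneous r s d' U" and Y: "Y \<in> T"
  shows "circ U (vf_mult f Y) = vf_mult (if d \<and> d' then - f else f) (circ U Y)"
proof
  fix c
  let ?d = "of_bool d :: nat" and ?d' = "of_bool d' :: nat"
  have "sf_mult (U a) (sf_mult (sf_twist (pr a) (sf_mult f (Y b))) (K a b c)) =
      sf_scale ((- 1) ^ (?d * ?d')) (sf_mult f (sf_mult (U a) (sf_mult (sf_twist (pr a) (Y b)) (K a b c))))"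
    if abc: "a < n" "b < n" "c < n" for a b
  proof -
    let ?Z = "sf_mult (sf_twist (pr a) (Y b)) (K a b c)"
    have Ya: "sf_twist (pr a) (Y b) \<in> S" and Ua: "U a \<in> S" and Ka: "K a b c \<in> S" and Z: "?Z \<in> S"
      using TD(1)[OF U(1) abc(1)] TD(1)[OF Y abc(2)] K_closed[OF abc(2,3), of a] by (simp_all add: closed)
    have hf: "sf_homogeneous (odd ?d) f" and hU: "sf_homogeneous (odd (?d' + pr a)) (U a)"
      using f(2) U(2) abc(1) by (auto simp: vf_homogeneous_def)
    have "sf_mult (U a) (sf_mult (sf_twist (pr a) (sf_mult f (Y b))) (K a b c)) =
        sf_scale ((- 1) ^ (pr a * ?d)) (sf_mult (sf_mult (U a) f) ?Z)"
      unfolding sf_twist_mult sf_twist_odd[OF hf] sf_mult_scale_left sf_mult_scale_right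
        mult_assoc[OF f(1) Ya Ka] mult_assoc[OF Ua f(1) Z] ..
    also have "\<dots> = sf_scale ((- 1) ^ (pr a * ?d) * (- 1) ^ ((?d' + pr a) * ?d)) (sf_mult f (sf_mult (U a) ?Z))"
      unfolding mult_swap[OF Ua f(1) hU hf] sf_mult_scale_left sf_scale_scale mult_assoc[OF f(1) Ua Z] ..
    also have "(- 1) ^ (pr a * ?d) * (- 1) ^ ((?d' + pr a) * ?d) = ((- 1) ^ (?d * ?d') :: 'k)"
      by (simp add: par_def)
    finally show ?thesis .
  qed
  then have "circ U (vf_mult f Y) c = sf_scale ((- 1) ^ (?d * ?d')) (vf_mult f (circ U Y) c)"
    by (simp add: circ_def vf_mult_def sf_mult_sum_right sf_scale_sum)
  then show "circ U (vf_mult f Y) c = vf_mult (if d \<and> d' then - f else f) (circ U Y) c"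
    by (auto simp: vf_mult_def sf_mult_uminus_left sf_scale_minus_one)
qed

text \<open>All coefficient functions are moved to the front, the twists recording the symbols they
  pass. Both sides then have the same prefactor, and what remains is associativity for coordinate
  fields.\<close>

lemma circ_assoc:
  assumes U: "U \<in> T" and Y: "Y \<in> T" and Z: "Z \<in> T"
  shows "circ (circ U Y) Z = circ U (circ Y Z)"
proof
  fix e
  show "circ (circ U Y) Z e = circ U (circ Y Z) e"
  proof (cases "e < n")
    case e: True
    let ?u = "\<lambda>a b d. sf_mult (U a) (sf_mult (sf_twist (pr a) (Y b)) (sf_twist (pr a + pr b) (Z d)))"
    have mem: "U a \<in> S" "Y a \<in> S" "Z a \<in> S" if "a < n" for a using U Y Z that by (auto intro: TD)
    have l: "sf_mult (sf_mult (U a) (sf_mult (sf_twist (pr a) (Y b)) (K a b c))) (sf_mult (sf_twist (pr c) (Z d)) (K c d e)) =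
        sf_mult (?u a b d) (sf_mult (K a b c) (K c d e))" if "a < n" "b < n" "c < n" "d < n" for a b c d
    proof -
      note m = mem(1)[OF that(1)] closed(5)[OF mem(2)[OF that(2)], of "pr a"] closed(5)[OF mem(3)[OF that(4)]]
        K_closed[OF that(2,3), of a] K_closed[OF that(4) e, of c]
      \<comment> \<open>The parity of \<open>K a b c\<close> contains |c|, which cancels against the
        twist already present on \<open>Z d\<close>. The remaining |a| + |b| is independent of c, so
        the prefactor can leave the sum over c.\<close>
      have "sf_mult (K a b c) (sf_twist (pr c) (Z d)) = sf_mult (sf_twist (pr a + pr b + pr c) (sf_twist (pr c) (Z d))) (K a b c)"
        using that by (intro mult_twist K_closed K_homogeneous closed mem)
      also have "sf_twist (pr a + pr b + pr c) (sf_twist (pr c) (Z d)) = sf_twist (pr a + pr b) (Z d)"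
        unfolding sf_twist_twist by (rule sf_twist_cong) auto
      finally have sw: "sf_mult (K a b c) (sf_twist (pr c) (Z d)) = sf_mult (sf_twist (pr a + pr b) (Z d)) (K a b c)" .
      have "sf_mult (sf_mult (U a) (sf_mult (sf_twist (pr a) (Y b)) (K a b c))) (sf_mult (sf_twist (pr c) (Z d)) (K c d e)) =
          sf_mult (U a) (sf_mult (sf_twist (pr a) (Y b)) (sf_mult (sf_mult (K a b c) (sf_twist (pr c) (Z d))) (K c d e)))"
        using m by (simp add: mult_assoc closed)
      also have "\<dots> = sf_mult (?u a b d) (sf_mult (K a b c) (K c d e))"
        unfolding sw using m by (simp add: mult_assoc closed)
      finally show ?thesis .
    qed
    have rr: "sf_mult (U a) (sf_mult (sf_twist (pr a) (sf_mult (Y b) (sf_mult (sf_twist (pr b) (Z d)) (K b d c)))) (K a c e)) =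
        sf_mult (?u a b d) (sf_mult (sf_twist (pr a) (K b d c)) (K a c e))" if "a < n" "b < n" "c < n" "d < n" for a b c d
    proof -
      note m = mem(1)[OF that(1)] closed(5)[OF mem(2)[OF that(2)], of "pr a"] closed(5)[OF mem(3)[OF that(4)], of "pr a + pr b"]
        closed(5)[OF K_closed[OF that(4,3), of b], of "pr a"] K_closed[OF that(3) e, of a]
      show ?thesis
        unfolding sf_twist_mult sf_twist_twist using m by (simp add: mult_assoc closed)
    qed
    have "circ (circ U Y) Z e = (\<Sum>c<n. \<Sum>d<n. \<Sum>a<n. \<Sum>b<n. sf_mult (?u a b d) (sf_mult (K a b c) (K c d e)))"
      using e by (simp add: circ_def sf_mult_sum_left l)
    also have "\<dots> = (\<Sum>d<n. \<Sum>c<n. \<Sum>a<n. \<Sum>b<n. sf_mult (?u a b d) (sf_mult (K a b c) (K c d e)))"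
      by (rule sum.swap)
    also have "\<dots> = (\<Sum>d<n. \<Sum>a<n. \<Sum>c<n. \<Sum>b<n. sf_mult (?u a b d) (sf_mult (K a b c) (K c d e)))"
      by (intro sum.cong refl sum.swap)
    also have "\<dots> = (\<Sum>d<n. \<Sum>a<n. \<Sum>b<n. sf_mult (?u a b d) (\<Sum>c<n. sf_mult (K a b c) (K c d e)))"
      unfolding sf_mult_sum_right by (intro sum.cong refl sum.swap)
    also have "\<dots> = (\<Sum>d<n. \<Sum>a<n. \<Sum>b<n. sf_mult (?u a b d) (\<Sum>c<n. sf_mult (sf_twist (pr a) (K b d c)) (K a c e)))"
      using e by (intro sum.cong refl) (simp add: K_associative)
    also have "\<dots> = (\<Sum>a<n. \<Sum>d<n. \<Sum>b<n. \<Sum>c<n. sf_mult (?u a b d) (sf_mult (sf_twist (pr a) (K b d c)) (K a c e)))"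
      unfolding sf_mult_sum_right by (rule sum.swap)
    also have "\<dots> = (\<Sum>a<n. \<Sum>d<n. \<Sum>c<n. \<Sum>b<n. sf_mult (?u a b d) (sf_mult (sf_twist (pr a) (K b d c)) (K a c e)))"
      by (intro sum.cong refl sum.swap)
    also have "\<dots> = (\<Sum>a<n. \<Sum>c<n. \<Sum>d<n. \<Sum>b<n. sf_mult (?u a b d) (sf_mult (sf_twist (pr a) (K b d c)) (K a c e)))"
      by (intro sum.cong refl sum.swap)
    also have "\<dots> = (\<Sum>a<n. \<Sum>c<n. \<Sum>b<n. \<Sum>d<n. sf_mult (?u a b d) (sf_mult (sf_twist (pr a) (K b d c)) (K a c e)))"
      by (intro sum.cong refl sum.swap)
    also have "\<dots> = circ U (circ Y Z) e"
      using e by (simp add: circ_def sf_mult_sum_left sf_mult_sum_right sf_twist_sum rr)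
    finally show ?thesis .
  qed (simp add: circ_def)
qed

lemma circ_supercommute:
  assumes U: "U \<in> T" "vf_homogeneous r s d U" and Y: "Y \<in> T" "vf_homogeneous r s d' Y"
  shows "circ U Y = (if d \<and> d' then - circ Y U else circ Y U)"
proof -
  let ?d = "of_bool d :: nat" and ?d' = "of_bool d' :: nat"
  have "circ U Y c = sf_scale ((- 1) ^ (?d * ?d')) (circ Y U c)" for c
  proof (cases "c < n")
    case c: True
    have "sf_mult (U a) (sf_mult (sf_twist (pr a) (Y b)) (K a b c)) =
        sf_scale ((- 1) ^ (?d * ?d')) (sf_mult (Y b) (sf_mult (sf_twist (pr b) (U a)) (K b a c)))"
      if ab: "a < n" "b < n" for a b
    proof -
      have mem: "U a \<in> S" "Y b \<in> S" "K b a c \<in> S" using U Y ab c by (auto intro: TD K_closed)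
      have hU: "sf_homogeneous (odd (?d + pr a)) (U a)" and hY: "sf_homogeneous (odd (?d' + pr b)) (Y b)"
        using U Y ab by (auto simp: vf_homogeneous_def)
      have "sf_mult (U a) (sf_mult (sf_twist (pr a) (Y b)) (K a b c)) =
          sf_scale ((- 1) ^ (pr a * (?d' + pr b)) * ((- 1) ^ (pr a * pr b) * (- 1) ^ ((?d + pr a) * (?d' + pr b))))
            (sf_mult (Y b) (sf_mult (U a) (K b a c)))"
        unfolding sf_twist_odd[OF hY] K_symmetric[OF ab c] sf_mult_scale_left sf_mult_scale_right sf_scale_scale
          mult_assoc[OF mem(1,2,3), symmetric] mult_swap[OF mem(1,2) hU hY] mult_assoc[OF mem(2,1,3)]
        by (simp add: mult_ac)
      \<comment> \<open>Modulo 2 the exponents add up to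
        \<open>?d * ?d' + pr b * (?d + pr a)\<close>, whose second summand is the twist of
        \<open>U a\<close>.\<close>
      also have "(- 1) ^ (pr a * (?d' + pr b)) * ((- 1) ^ (pr a * pr b) * (- 1) ^ ((?d + pr a) * (?d' + pr b))) =
          ((- 1) ^ (?d * ?d') * (- 1) ^ (pr b * (?d + pr a)) :: 'k)"
        by (simp add: par_def)
      also have "sf_scale \<dots> (sf_mult (Y b) (sf_mult (U a) (K b a c))) =
          sf_scale ((- 1) ^ (?d * ?d')) (sf_mult (Y b) (sf_mult (sf_twist (pr b) (U a)) (K b a c)))"
        unfolding sf_twist_odd[OF hU] sf_mult_scale_left sf_mult_scale_right sf_scale_scale ..
      finally show ?thesis .
    qed
    then have "circ U Y c = (\<Sum>a<n. \<Sum>b<n. sf_scale ((- 1) ^ (?d * ?d')) (sf_mult (Y b) (sf_mult (sf_twist (pr b) (U a)) (K b a c))))"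
      using c by (simp add: circ_def)
    also have "\<dots> = sf_scale ((- 1) ^ (?d * ?d')) (circ Y U c)"
      using c unfolding circ_def if_P[OF c] sf_scale_sum by (intro sum.swap)
    finally show ?thesis .
  qed (simp add: circ_def)
  then show ?thesis by (auto simp: fun_eq_iff sf_scale_minus_one)
qed

lemma super_multiplication_circ: "super_multiplication cat r s D circ"
  unfolding super_multiplication_def Let_def
  by (intro conjI ballI allI impI)
    (blast intro: circ_closed circ_add_left circ_add_right circ_mult_left circ_mult_right circ_assoc circ_supercommute)+

lemma circ_coord_field:
  assumes "a < n" "b < n"
  shows "circ (coord_field D a) (coord_field D b) c = (if c < n then K a b c else 0)"
proof (cases "c < n")
  case True
  have "sf_mult (coord_field D a a') (sf_mult (sf_twist (pr a') (coord_field D b b')) (K a' b' c)) =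
      (if a' = a then if b' = b then K a b c else 0 else 0)" if "a' < n" "b' < n" for a' b'
    using that True by (auto simp: coord_field_def sf_twist_const mult_one_left K_closed)
  then have "circ (coord_field D a) (coord_field D b) c =
      (\<Sum>a'<n. \<Sum>b'<n. if a' = a then if b' = b then K a b c else 0 else 0)"
    using True by (simp add: circ_def)
  also have "\<dots> = (\<Sum>a'<n. if a' = a then K a b c else 0)"
    using assms(2) by (intro sum.cong refl) (simp add: sum.delta)
  finally show ?thesis using True assms(1) by (simp add: sum.delta)
qed (simp add: circ_def)

end

section \<open>Vector potentials and the flat identity\<close>

context primitive_solution
begin

lemma deriv_potential:
  "sf_deriv r a (sf_scale ((- 1) ^ ((pr b + 1) * (pr b + pr c))) (X b c)) = K a b c"
proof -
  have "(- 1) ^ ((pr b + 1) * (pr b + pr c)) = ((- 1) ^ (pr c * (1 + pr a + pr b)) * (- 1) ^ (pr a * pr c) :: 'k)"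
    by (simp add: par_def)
  then show ?thesis by (simp only: K_def endo_deriv_def sf_deriv_scale sf_scale_scale)
qed

lemma oriented_associativity_circ:
  assumes A: "vector_potential cat r s D X A"
  shows "oriented_associativity cat r s D A circ"
  unfolding oriented_associativity_def
proof (intro conjI allI impI super_multiplication_circ)
  show AT: "A \<in> T" "vf_homogeneous r s False A" using A by (simp_all add: vector_potential_def)
  fix a b assume ab: "a < n" "b < n"
  show "circ (coord_field D a) (coord_field D b) = (\<lambda>c. sf_deriv r a (sf_deriv r b (A c)))"
  proof
    fix c
    show "circ (coord_field D a) (coord_field D b) c = sf_deriv r a (sf_deriv r b (A c))"
    proof (cases "c < n")
      case True
      then have "sf_deriv r b (A c) = sf_scale ((- 1) ^ ((pr b + 1) * (pr b + pr c))) (X b c)"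
        using A ab by (simp add: vector_potential_def)
      then show ?thesis using True by (simp only: circ_coord_field[OF ab] deriv_potential if_True)
    next
      case False
      then show ?thesis using TD(2)[OF AT(1), of c] by (simp add: circ_coord_field[OF ab])
    qed
  qed
qed

definition identity_field :: "nat \<Rightarrow> 'k sfun" where
  "identity_field = (\<lambda>c. if c < n then sf_const D (H c) else 0)"

lemma identity_field_closed: "identity_field \<in> T"
  by (auto simp: identity_field_def vector_fields_def const_closed)

text \<open>The Jacobian of t -> B(t)h is the identity matrix in flat coordinates, so the
  pulled-back field has the constant coefficients of h. Existence and uniqueness come
  together.\<close>

lemma pullback_iff: "pullback_of_vector cat r s D X H e \<longleftrightarrow> e = identity_field"
proof -
  have "(\<Sum>a<n. sf_mult (e a) (sf_deriv r a (sf_scale ((- 1) ^ pr c) (apply_const n X H c)))) = e c"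
    if "e \<in> T" "c < n" for e c
  proof -
    have "(\<Sum>a<n. sf_mult (e a) (sf_deriv r a (sf_scale ((- 1) ^ pr c) (apply_const n X H c)))) =
        (\<Sum>a<n. if a = c then e c else 0)"
      using that by (intro sum.cong refl) (auto simp: deriv_flat mult_one_right TD)
    then show ?thesis using that(2) by (simp add: sum.delta)
  qed
  then have "pullback_of_vector cat r s D X H e \<longleftrightarrow> e \<in> T \<and> (\<forall>c<n. e c = sf_const D (H c))"
    unfolding pullback_of_vector_def by auto
  also have "\<dots> \<longleftrightarrow> e = identity_field"
  proof
    assume e: "e \<in> T \<and> (\<forall>c<n. e c = sf_const D (H c))"
    show "e = identity_field"
    proof
      show "e c = identity_field c" for c
        using e TD(2)[of e c] by (cases "c < n") (auto simp: identity_field_def)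
    qed
  next
    assume "e = identity_field"
    then show "e \<in> T \<and> (\<forall>c<n. e c = sf_const D (H c))"
      using identity_field_closed by (simp add: identity_field_def)
  qed
  finally show ?thesis .
qed

lemma circ_identity_field:
  assumes Y: "Y \<in> T"
  shows "circ identity_field Y = Y"
proof
  fix c
  show "circ identity_field Y c = Y c"
  proof (cases "c < n")
    case c: True
    have tm: "sf_mult (identity_field a) (sf_mult (sf_twist (pr a) (Y b)) (K a b c)) =
        sf_mult (Y b) (sf_scale (H a) (K a b c))" if ab: "a < n" "b < n" for a b
    proof -
      have mem: "sf_mult (sf_twist (pr a) (Y b)) (K a b c) \<in> S"
        using TD(1)[OF Y ab(2)] K_closed[OF ab(2) c, of a] by (simp add: closed)
      have "sf_mult (identity_field a) (sf_mult (sf_twist (pr a) (Y b)) (K a b c)) =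
          sf_scale (H a) (sf_mult (sf_twist (pr a) (Y b)) (K a b c))"
        using ab(1) by (simp add: identity_field_def mult_const_left[OF mem])
      also have "\<dots> = sf_scale (H a) (sf_mult (Y b) (K a b c))"
      \<comment> \<open>For even a the twist is trivial, and for odd a both sides vanish because h
        is even.\<close>
      proof (cases "a < r")
        case True
        then show ?thesis by (simp add: par_def sf_twist_even)
      next
        case False
        then show ?thesis by (simp add: H_even)
      qed
      finally show ?thesis by (simp only: sf_mult_scale_right)
    qed
    have "circ identity_field Y c = (\<Sum>a<n. \<Sum>b<n. sf_mult (Y b) (sf_scale (H a) (K a b c)))"
      using c tm by (simp add: circ_def)
    also have "\<dots> = (\<Sum>b<n. \<Sum>a<n. sf_mult (Y b) (sf_scale (H a) (K a b c)))" by (rule sum.swap)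
    also have "\<dots> = (\<Sum>b<n. sf_mult (Y b) (if b = c then sf_const D 1 else 0))"
      using c by (intro sum.cong refl) (simp add: K_H flip: sf_mult_sum_right)
    also have "\<dots> = (\<Sum>b<n. if b = c then Y c else 0)"
      using c by (intro sum.cong refl) (auto simp: mult_one_right TD(1)[OF Y])
    finally show ?thesis using c by (simp add: sum.delta)
  next
    case False
    then show ?thesis using TD(2)[OF Y] by (simp add: circ_def)
  qed
qed

lemma flat_identity_circ: "flat_identity cat r s D circ identity_field"
  unfolding flat_identity_def
proof (intro conjI allI impI ballI identity_field_closed circ_identity_field)
  have z: "sf_const D (0::'k) = 0" by (auto simp: sf_const_def fun_eq_iff)
  show "vf_homogeneous r s False identity_field"
    unfolding vf_homogeneous_def identity_field_def
    by (auto simp: par_def H_even z sf_homogeneous_const)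
  show "\<exists>k. identity_field c = sf_const D k" if "c < n" for c
    using that by (auto simp: identity_field_def)
qed

lemma local_vector_potential:
  assumes "openin (top_of_set (model_space cat r)) D" "x0 \<in> D"
  obtains E A where "x0 \<in> E" "E \<subseteq> D" "openin (top_of_set (model_space cat r)) E"
    "vector_potential cat r s E (\<lambda>b c. sf_restrict E (X b c)) A"
proof -
  let ?\<omega> = "\<lambda>b c. sf_scale ((- 1) ^ ((pr b + 1) * (pr b + pr c))) (X b c)"
  obtain E A where E: "x0 \<in> E" "E \<subseteq> D" "openin (top_of_set (model_space cat r)) E"
    and A: "\<And>c. c < n \<Longrightarrow> A c \<in> superfunctions cat r s E" "\<And>c. c < n \<Longrightarrow> sf_homogeneous (odd (pr c)) (A c)"
      "\<And>b c. b < n \<Longrightarrow> c < n \<Longrightarrow> sf_deriv r b (A c) = sf_restrict E (?\<omega> b c)"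
  proof (rule local_super_poincare[where \<omega> = ?\<omega> and d = "\<lambda>c. odd (pr c)" and n = n and q = s, OF assms])
    fix b c assume bc: "b < n" "c < n"
    show "?\<omega> b c \<in> S" by (intro closed X_closed bc)
    have "(odd (pr c) \<noteq> odd (pr b)) = odd (pr b + pr c)" by auto
    then show "sf_homogeneous (odd (pr c) \<noteq> odd (pr b)) (?\<omega> b c)"
      by (simp only: sf_homogeneous_scale X_homogeneous bc)
    \<comment> \<open>Each derivative of the form is a structure constant, so closedness is exactly
      the supersymmetry of K in its lower indices.\<close>
    show "sf_deriv r a (?\<omega> b c) = sf_scale ((- 1) ^ (pr a * pr b)) (sf_deriv r b (?\<omega> a c))" if "a < n" for a
      unfolding deriv_potential by (rule K_symmetric[OF that bc])
  qed blast
  let ?A = "\<lambda>c. if c < n then A c else 0"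
  have "vector_potential cat r s E (\<lambda>b c. sf_restrict E (X b c)) ?A"
    unfolding vector_potential_def vector_fields_def vf_homogeneous_def
    using A by (auto simp: sf_restrict_scale)
  with E show thesis by (rule that)
qed

end

section \<open>Change of basis in the fiber\<close>

lemma endo_deriv_matrix_in_basis:
  assumes "even_matrix r s Q"
  shows "endo_deriv r r a (matrix_in_basis n P Q L) = matrix_in_basis n P Q (endo_deriv r r a L)"
proof (intro ext)
  fix b c x \<alpha> I
  \<comment> \<open>The sign of the derivative depends on the parity of the output index only, which
    Q preserves.\<close>
  have "sf_scale ((- 1) ^ (par r a * par r c)) (sf_scale (P b d * Q e c) Z) =
      sf_scale (P b d * Q e c) (sf_scale ((- 1) ^ (par r a * par r e)) Z)" for d e Z
    using assms by (cases "Q e c = 0") (auto simp: even_matrix_def mult.commute)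
  then show "endo_deriv r r a (matrix_in_basis n P Q L) b c x \<alpha> I = matrix_in_basis n P Q (endo_deriv r r a L) b c x \<alpha> I"
    unfolding endo_deriv_def matrix_in_basis_def sf_deriv_sum sf_scale_sum sf_deriv_scale by (simp only:)
qed

lemma endo_comp_matrix_in_basis:
  assumes "inverse_matrices n P Q" "d < n" "c < n"
  shows "endo_comp n (matrix_in_basis n P Q L) (matrix_in_basis n P Q N) d c =
    matrix_in_basis n P Q (endo_comp n L N) d c"
proof -
  \<comment> \<open>Each matrix is transformed on its outer side only. Between the two halves the
    product Q P = 1 remains and contracts the inner sum.\<close>
  define Lc where "Lc l = (\<Sum>m<n. sf_scale (Q m c) (L l m))" for l
  define Nd where "Nd v = (\<Sum>u<n. sf_scale (P d u) (N u v))" for v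
  have L: "matrix_in_basis n P Q L k c = (\<Sum>l<n. sf_scale (P k l) (Lc l))" for k
    by (simp add: matrix_in_basis_def Lc_def sf_scale_sum)
  have N: "matrix_in_basis n P Q N d k = (\<Sum>v<n. sf_scale (Q v k) (Nd v))" for k
    unfolding matrix_in_basis_def Nd_def sf_scale_sum sf_scale_scale
    by (subst sum.swap) (simp add: mult.commute)
  have "endo_comp n (matrix_in_basis n P Q L) (matrix_in_basis n P Q N) d c =
      (\<Sum>k<n. \<Sum>l<n. \<Sum>v<n. sf_scale (Q v k * P k l) (sf_mult (Lc l) (Nd v)))"
    unfolding endo_comp_def L N sf_mult_sum_left
    unfolding sf_mult_sum_right
    unfolding sf_mult_scale_left sf_mult_scale_right sf_scale_scale
    by (simp add: mult.commute)
  also have "\<dots> = (\<Sum>l<n. \<Sum>k<n. \<Sum>v<n. sf_scale (Q v k * P k l) (sf_mult (Lc l) (Nd v)))" by (rule sum.swap)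
  also have "\<dots> = (\<Sum>l<n. \<Sum>v<n. sf_scale (\<Sum>k<n. Q v k * P k l) (sf_mult (Lc l) (Nd v)))"
    unfolding sf_scale_sum_left by (intro sum.cong refl sum.swap)
  also have "\<dots> = (\<Sum>l<n. \<Sum>v<n. if v = l then sf_mult (Lc l) (Nd l) else 0)"
    using assms(1) by (intro sum.cong refl) (auto simp: inverse_matrices_def)
  also have "\<dots> = (\<Sum>l<n. sf_mult (Lc l) (Nd l))"
    by (intro sum.cong refl) (simp add: sum.delta)
  also have "\<dots> = (\<Sum>l<n. \<Sum>m<n. \<Sum>u<n. sf_scale (P d u * Q m c) (sf_mult (L l m) (N u l)))"
    unfolding Lc_def Nd_def sf_mult_sum_left
    unfolding sf_mult_sum_right
    unfolding sf_mult_scale_left sf_mult_scale_right sf_scale_scale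
    by (simp add: mult.commute)
  also have "\<dots> = (\<Sum>m<n. \<Sum>l<n. \<Sum>u<n. sf_scale (P d u * Q m c) (sf_mult (L l m) (N u l)))" by (rule sum.swap)
  also have "\<dots> = (\<Sum>m<n. \<Sum>u<n. \<Sum>l<n. sf_scale (P d u * Q m c) (sf_mult (L l m) (N u l)))"
    by (intro sum.cong refl sum.swap)
  also have "\<dots> = (\<Sum>u<n. \<Sum>m<n. \<Sum>l<n. sf_scale (P d u * Q m c) (sf_mult (L l m) (N u l)))" by (rule sum.swap)
  also have "\<dots> = matrix_in_basis n P Q (endo_comp n L N) d c"
    by (simp add: matrix_in_basis_def endo_comp_def sf_scale_sum)
  finally show ?thesis .
qed

section \<open>Restriction of charts and the superdomains they define\<close>

lemma chart_subset:
  assumes ch: "chart cat M p q V \<phi> \<Phi>" and W: "openin (space_of M) W" "W \<subseteq> V"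
  shows "chart cat M p q W \<phi> \<Phi>"
proof -
  have V: "openin (space_of M) V" "openin (top_of_set (model_space cat p)) (\<phi> ` V)"
    and hm: "homeomorphic_map (subtopology (space_of M) V) (top_of_set (\<phi> ` V)) \<phi>"
    using ch by (auto simp: chart_def)
  have "openin (subtopology (space_of M) V) W" using W V by (simp add: openin_open_subtopology)
  then have "openin (top_of_set (\<phi> ` V)) (\<phi> ` W)"
    using homeomorphic_imp_open_map[OF hm] by (simp add: open_map_def)
  then have o: "openin (top_of_set (model_space cat p)) (\<phi> ` W)" using V(2) by (rule openin_trans)
  have VW: "V \<inter> W = W" "\<phi> ` V \<inter> \<phi> ` W = \<phi> ` W" using W(2) by auto
  have top: "topspace (subtopology (space_of M) V) = V" using openin_subset[OF V(1)] by auto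
  have "homeomorphic_map (subtopology (subtopology (space_of M) V) W) (subtopology (top_of_set (\<phi> ` V)) (\<phi> ` W)) \<phi>"
  proof (rule homeomorphic_map_subtopologies[OF hm])
    show "\<phi> ` (topspace (subtopology (space_of M) V) \<inter> W) = topspace (top_of_set (\<phi> ` V)) \<inter> \<phi> ` W"
      unfolding top by (simp add: VW)
  qed
  then have "homeomorphic_map (subtopology (space_of M) W) (top_of_set (\<phi> ` W)) \<phi>"
    by (simp only: subtopology_subtopology VW)
  then show ?thesis
    using ch W o unfolding chart_def by (meson order_trans)
qed

lemma graded_subset_carrier:
  assumes "superalgebra_at M U"
  shows "graded M U d \<subseteq> carrier (sheaf M U)"
proof -
  have "additive_subgroup (graded M U d) (sheaf M U)" using assms by (simp add: superalgebra_at_def)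
  then show ?thesis by (rule additive_subgroup.a_subset)
qed

lemma superdomain_chart:
  fixes M :: "('p, 'f, 'k::{real_normed_field, banach}) superspace"
  assumes M: "super_ringed_space M" and ch: "chart cat M r s V \<phi> \<Phi>"
  shows "superdomain cat r s (\<phi> ` V)"
proof -
  let ?R = "sheaf M V" and ?S = "superfunctions cat r s (\<phi> ` V)" and ?h = "\<Phi> V"
  have V: "openin (space_of M) V" using ch by (simp add: chart_def)
  have alg: "superalgebra_at M V" using M V by (simp add: super_ringed_space_def)
  then interpret R: ring ?R by (simp add: superalgebra_at_def)
  have iso: "?h \<in> ring_iso ?R (superdomain_ring cat r s (\<phi> ` V))"
    and hom_iff: "\<And>f d. f \<in> carrier ?R \<Longrightarrow> f \<in> graded M V d \<longleftrightarrow> sf_homogeneous d (?h f)"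
    using ch V by (auto simp: chart_def)
  have im: "?h ` carrier ?R = ?S"
    using iso by (auto simp: ring_iso_def bij_betw_def superdomain_ring_def)
  have memb: "?h f \<in> ?S" if "f \<in> carrier ?R" for f using im that by blast
  have pre: "\<exists>f'\<in>carrier ?R. f = ?h f'" if "f \<in> ?S" for f using im that by blast
  have mult: "?h (f \<otimes>\<^bsub>?R\<^esub> g) = sf_mult (?h f) (?h g)" if "f \<in> carrier ?R" "g \<in> carrier ?R" for f g
    using ring_iso_memE(2)[OF iso that] by (simp add: superdomain_ring_def)
  have add: "?h (f \<oplus>\<^bsub>?R\<^esub> g) = ?h f + ?h g" if "f \<in> carrier ?R" "g \<in> carrier ?R" for f g
    using ring_iso_memE(3)[OF iso that] by (simp add: superdomain_ring_def)
  have one: "?h \<one>\<^bsub>?R\<^esub> = sf_const (\<phi> ` V) 1"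
    using ring_iso_memE(4)[OF iso] by (simp add: superdomain_ring_def)
  \<comment> \<open>\<open>superdomain_ring\<close> is not known to be a ring at this point.
    Compatibility with zero and negatives is therefore obtained from additivity by cancelling in the
    group of all jets.\<close>
  have "?h \<zero>\<^bsub>?R\<^esub> + ?h \<zero>\<^bsub>?R\<^esub> = ?h \<zero>\<^bsub>?R\<^esub>" using add[of "\<zero>\<^bsub>?R\<^esub>" "\<zero>\<^bsub>?R\<^esub>"] by simp
  then have zero: "?h \<zero>\<^bsub>?R\<^esub> = 0" by (rule add_cancel_right_right[THEN iffD1, OF sym])
  have minus: "?h (\<ominus>\<^bsub>?R\<^esub> f) = - ?h f" if "f \<in> carrier ?R" for f
  proof -
    have "?h (\<ominus>\<^bsub>?R\<^esub> f) + ?h f = 0" using add[of "\<ominus>\<^bsub>?R\<^esub> f" f] that zero by (simp add: R.l_neg)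
    then show ?thesis by (simp only: eq_neg_iff_add_eq_0)
  qed
  have gr: "graded M V d \<subseteq> carrier ?R" for d
    using alg by (rule graded_subset_carrier)
  show ?thesis
  proof
    show "cat \<noteq> Formal \<longrightarrow> locally_polydisc r (\<phi> ` V)"
      using ch openin_model_space_imp_locally_polydisc by (auto simp: chart_def)
    fix f g h assume fgh: "f \<in> ?S" "g \<in> ?S" "h \<in> ?S"
    obtain f' g' h' where eq: "f = ?h f'" "g = ?h g'" "h = ?h h'"
      and mem: "f' \<in> carrier ?R" "g' \<in> carrier ?R" "h' \<in> carrier ?R"
      using pre fgh by meson
    show "sf_mult (sf_mult f g) h = sf_mult f (sf_mult g h)"
      unfolding eq using mem by (simp flip: mult add: R.m_assoc)
  next
    fix f g assume fg: "f \<in> ?S" "g \<in> ?S"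
    obtain f' g' where eq: "f = ?h f'" "g = ?h g'" and mem: "f' \<in> carrier ?R" "g' \<in> carrier ?R"
      using pre fg by meson
    show "sf_mult f g \<in> ?S" unfolding eq using mem by (simp flip: mult add: memb)
  next
    fix d d' f g assume fg: "f \<in> ?S" "g \<in> ?S" "sf_homogeneous d f" "sf_homogeneous d' g"
    obtain f' g' where eq: "f = ?h f'" "g = ?h g'" and mem: "f' \<in> carrier ?R" "g' \<in> carrier ?R"
      using pre fg by meson
    have "f' \<in> graded M V d" "g' \<in> graded M V d'" using hom_iff mem fg(3,4) eq by auto
    then have "f' \<otimes>\<^bsub>?R\<^esub> g' = (if d \<and> d' then \<ominus>\<^bsub>?R\<^esub> (g' \<otimes>\<^bsub>?R\<^esub> f') else g' \<otimes>\<^bsub>?R\<^esub> f')"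
      using alg unfolding superalgebra_at_def by blast
    then have "?h (f' \<otimes>\<^bsub>?R\<^esub> g') = (if d \<and> d' then - ?h (g' \<otimes>\<^bsub>?R\<^esub> f') else ?h (g' \<otimes>\<^bsub>?R\<^esub> f'))"
      using mem by (simp add: minus)
    then show "sf_mult f g = (if d \<and> d' then - sf_mult g f else sf_mult g f)"
      unfolding eq mult[OF mem] mult[OF mem(2,1)] .
  next
    show "sf_const (\<phi> ` V) 1 \<in> ?S" using memb[OF R.one_closed] one by simp
  next
    fix f assume "f \<in> ?S"
    then obtain f' where f': "f' \<in> carrier ?R" "f = ?h f'" using pre by blast
    show "sf_mult (sf_const (\<phi> ` V) 1) f = f" "sf_mult f (sf_const (\<phi> ` V) 1) = f"
      unfolding f'(2) one[symmetric] using f'(1) by (simp_all flip: mult)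
    have "\<forall>f\<in>carrier ?R. \<exists>!g. g \<in> graded M V False \<times> graded M V True \<and> f = fst g \<oplus>\<^bsub>?R\<^esub> snd g"
      using alg unfolding superalgebra_at_def by (elim conjE)
    from ex1_implies_ex[OF bspec[OF this f'(1)]]
    obtain g where g: "g \<in> graded M V False \<times> graded M V True" "f' = fst g \<oplus>\<^bsub>?R\<^esub> snd g" by blast
    have mem: "fst g \<in> graded M V False" "snd g \<in> graded M V True" using g(1) by auto
    have car: "fst g \<in> carrier ?R" "snd g \<in> carrier ?R" using mem gr by blast+
    show "\<exists>g h. g \<in> ?S \<and> h \<in> ?S \<and> sf_homogeneous False g \<and> sf_homogeneous True h \<and> f = g + h"
    proof (intro exI conjI)
      show "?h (fst g) \<in> ?S" "?h (snd g) \<in> ?S" by (intro memb car)+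
      show "sf_homogeneous False (?h (fst g))" "sf_homogeneous True (?h (snd g))"
        using hom_iff[OF car(1)] hom_iff[OF car(2)] mem by blast+
      show "f = ?h (fst g) + ?h (snd g)" unfolding f'(2) g(2) by (rule add[OF car])
    qed
  qed
qed

section \<open>Charts and flat coordinates\<close>

lemma sf_restrict_sum: "sf_restrict E (sum f A) = (\<Sum>a\<in>A. sf_restrict E (f a))"
proof (induction A rule: infinite_finite_induct)
  case (insert a A)
  have "sf_restrict E (g + h) = sf_restrict E g + sf_restrict E h" for g h :: "'a sfun"
    by (auto simp: sf_restrict_def fun_eq_iff)
  then show ?case by (simp only: sum.insert[OF insert.hyps] insert.IH)
qed (auto simp: sf_restrict_def fun_eq_iff)

lemma matrix_in_basis_restrict:
  assumes "\<And>d e. d < n \<Longrightarrow> e < n \<Longrightarrow> L d e = sf_restrict E (N d e)"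
  shows "matrix_in_basis n P Q L b c = sf_restrict E (matrix_in_basis n P Q N b c)"
proof -
  have "matrix_in_basis n P Q L b c = (\<Sum>d<n. \<Sum>e<n. sf_scale (P b d * Q e c) (sf_restrict E (N d e)))"
    unfolding matrix_in_basis_def by (intro sum.cong refl) (simp add: assms)
  then show ?thesis by (simp only: matrix_in_basis_def sf_restrict_sum sf_restrict_scale)
qed

lemma apply_const_restrict:
  assumes "\<And>b. b < n \<Longrightarrow> L b c = sf_restrict E (N b c)"
  shows "apply_const n L H c = sf_restrict E (apply_const n N H c)"
proof -
  have "apply_const n L H c = (\<Sum>b<n. sf_scale (H b) (sf_restrict E (N b c)))"
    unfolding apply_const_def by (intro sum.cong refl) (simp add: assms)
  then show ?thesis by (simp only: apply_const_def sf_restrict_sum sf_restrict_scale)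
qed

lemma sf_restrict_coord:
  "E \<subseteq> D \<Longrightarrow> sf_restrict E (sf_scale k (sf_coord p D c + sf_const D a)) = sf_scale k (sf_coord p E c + sf_const E a)"
  by (auto simp: sf_restrict_def sf_scale_def sf_coord_def sf_const_def fun_eq_iff)

lemma super_ringed_space_restr:
  assumes M: "super_ringed_space M" and UV: "openin (space_of M) U" "openin (space_of M) V" "V \<subseteq> U"
  shows "restr M U V \<in> ring_hom (sheaf M U) (sheaf M V)"
    and "f \<in> graded M U d \<Longrightarrow> restr M U V f \<in> graded M V d"
    and "openin (space_of M) W \<Longrightarrow> W \<subseteq> V \<Longrightarrow> f \<in> carrier (sheaf M U) \<Longrightarrow>
      restr M V W (restr M U V f) = restr M U W f"
proof -
  have "\<forall>U V. openin (space_of M) U \<and> openin (space_of M) V \<and> V \<subseteq> U \<longrightarrow>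
        restr M U V \<in> ring_hom (sheaf M U) (sheaf M V) \<and>
        (\<forall>k. restr M U V (scalar M U k) = scalar M V k) \<and>
        (\<forall>d. restr M U V ` graded M U d \<subseteq> graded M V d) \<and>
        (\<forall>W f. openin (space_of M) W \<and> W \<subseteq> V \<and> f \<in> carrier (sheaf M U) \<longrightarrow>
           restr M V W (restr M U V f) = restr M U W f)"
    using M unfolding super_ringed_space_def by (elim conjE)
  with UV have UV': "restr M U V \<in> ring_hom (sheaf M U) (sheaf M V)"
      "\<forall>d. restr M U V ` graded M U d \<subseteq> graded M V d"
      "\<forall>W f. openin (space_of M) W \<and> W \<subseteq> V \<and> f \<in> carrier (sheaf M U) \<longrightarrow>
           restr M V W (restr M U V f) = restr M U W f"
    by simp_all
  show "restr M U V \<in> ring_hom (sheaf M U) (sheaf M V)" by (rule UV'(1))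
  show "restr M U V f \<in> graded M V d" if "f \<in> graded M U d" using UV'(2) that by blast
  show "restr M V W (restr M U V f) = restr M U W f"
    if "openin (space_of M) W" "W \<subseteq> V" "f \<in> carrier (sheaf M U)" using UV'(3) that by blast
qed

lemma super_ringed_space_graded_carrier:
  assumes "super_ringed_space M" "openin (space_of M) U" "f \<in> graded M U d"
  shows "f \<in> carrier (sheaf M U)"
proof -
  have "superalgebra_at M U" using assms by (simp add: super_ringed_space_def)
  then show ?thesis using graded_subset_carrier assms(3) by blast
qed

lemma even_section_graded:
  assumes "even_section M r s F B" "i \<in> frames F" "b < r + s" "c < r + s"
  shows "B i b c \<in> graded M (patch F i) (odd (par r b + par r c))"
  using assms by (simp add: even_section_def)

lemma local_system_patch_open: "local_system M r s F \<Longrightarrow> i \<in> frames F \<Longrightarrow> openin (space_of M) (patch F i)"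
  by (simp add: local_system_def)

lemma chart_open: "chart cat M p q V \<phi> \<Phi> \<Longrightarrow> openin (space_of M) V"
  unfolding chart_def by blast

lemma local_matrix_restrict:
  assumes M: "super_ringed_space M" and F: "openin (space_of M) (patch F i)" and f: "B i b c \<in> carrier (sheaf M (patch F i))"
    and ch: "chart cat M p q V \<phi> \<Phi>" "V \<subseteq> patch F i" and W: "openin (space_of M) W" "W \<subseteq> V"
  shows "local_matrix M F B i \<Phi> W b c = sf_restrict (\<phi> ` W) (local_matrix M F B i \<Phi> V b c)"
proof -
  have V: "openin (space_of M) V" using ch(1) by (rule chart_open)
  have "restr M (patch F i) V \<in> ring_hom (sheaf M (patch F i)) (sheaf M V)"
    by (rule super_ringed_space_restr(1)[OF M F V ch(2)])
  then have "restr M (patch F i) V (B i b c) \<in> carrier (sheaf M V)"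
    using f by (rule ring_hom_closed)
  then have "\<Phi> W (restr M V W (restr M (patch F i) V (B i b c))) =
      sf_restrict (\<phi> ` W) (\<Phi> V (restr M (patch F i) V (B i b c)))"
    using ch(1) V W unfolding chart_def by blast
  then show ?thesis unfolding local_matrix_def super_ringed_space_restr(3)[OF M F V ch(2) W f] .
qed

lemma chart_graded:
  assumes M: "super_ringed_space M" and ch: "chart cat M p q V \<phi> \<Phi>" and f: "f \<in> graded M V d"
  shows "\<Phi> V f \<in> superfunctions cat p q (\<phi> ` V)" "sf_homogeneous d (\<Phi> V f)"
proof -
  have V: "openin (space_of M) V" using ch by (rule chart_open)
  have fc: "f \<in> carrier (sheaf M V)" by (rule super_ringed_space_graded_carrier[OF M V f])
  have iso: "\<Phi> V \<in> ring_iso (sheaf M V) (superdomain_ring cat p q (\<phi> ` V))"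
    using ch V unfolding chart_def by blast
  show "\<Phi> V f \<in> superfunctions cat p q (\<phi> ` V)"
    using ring_iso_memE(1)[OF iso fc] by (simp add: superdomain_ring_def)
  show "sf_homogeneous d (\<Phi> V f)" using ch V f fc unfolding chart_def by blast
qed

text \<open>The same basis and constants stay valid on smaller open sets, so a potential on any W
  inside V can be treated as one on a whole flat chart.\<close>

lemma flat_coordinates_subset:
  assumes M: "super_ringed_space M" and F: "local_system M r s F" and B: "even_section M r s F B"
    and i: "i \<in> frames F" and fc: "flat_coordinates cat M r s F B h i V \<phi> \<Phi> H P Q a"
    and W: "openin (space_of M) W" "W \<subseteq> V"
  shows "flat_coordinates cat M r s F B h i W \<phi> \<Phi> H P Q a"
    and "matrix_in_basis (r + s) P Q (local_matrix M F B i \<Phi> W) b c =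
      sf_restrict (\<phi> ` W) (matrix_in_basis (r + s) P Q (local_matrix M F B i \<Phi> V) b c)"
proof -
  note Fi = local_system_patch_open[OF F i]
  have V: "V \<subseteq> patch F i" "chart cat M r s V \<phi> \<Phi>" using fc by (auto simp: flat_coordinates_def)
  have "local_matrix M F B i \<Phi> W d e = sf_restrict (\<phi> ` W) (local_matrix M F B i \<Phi> V d e)"
    if "d < r + s" "e < r + s" for d e
    by (rule local_matrix_restrict[OF M Fi _ V(2,1) W])
      (rule super_ringed_space_graded_carrier[OF M Fi even_section_graded[OF B i that]])
  then have mib: "matrix_in_basis (r + s) P Q (local_matrix M F B i \<Phi> W) b c =
      sf_restrict (\<phi> ` W) (matrix_in_basis (r + s) P Q (local_matrix M F B i \<Phi> V) b c)" for b c
    by (rule matrix_in_basis_restrict)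
  then show "matrix_in_basis (r + s) P Q (local_matrix M F B i \<Phi> W) b c =
      sf_restrict (\<phi> ` W) (matrix_in_basis (r + s) P Q (local_matrix M F B i \<Phi> V) b c)" .
  have "apply_const (r + s) (matrix_in_basis (r + s) P Q (local_matrix M F B i \<Phi> W)) (vector_in_basis (r + s) Q H) c =
      sf_scale ((-1) ^ par r c) (sf_coord r (\<phi> ` W) c + sf_const (\<phi> ` W) (a c))" if c: "c < r + s" for c
  proof -
    have "apply_const (r + s) (matrix_in_basis (r + s) P Q (local_matrix M F B i \<Phi> W)) (vector_in_basis (r + s) Q H) c =
        sf_restrict (\<phi> ` W) (apply_const (r + s) (matrix_in_basis (r + s) P Q (local_matrix M F B i \<Phi> V)) (vector_in_basis (r + s) Q H) c)"
      by (rule apply_const_restrict) (rule mib)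
    also have "\<dots> = sf_restrict (\<phi> ` W) (sf_scale ((-1) ^ par r c) (sf_coord r (\<phi> ` V) c + sf_const (\<phi> ` V) (a c)))"
      using fc c unfolding flat_coordinates_def by metis
    also have "\<dots> = sf_scale ((-1) ^ par r c) (sf_coord r (\<phi> ` W) c + sf_const (\<phi> ` W) (a c))"
      using W(2) by (intro sf_restrict_coord) auto
    finally show ?thesis .
  qed
  then show "flat_coordinates cat M r s F B h i W \<phi> \<Phi> H P Q a"
    using fc chart_subset[OF V(2) W] W(2) unfolding flat_coordinates_def by blast
qed

lemma vector_in_basis_even:
  assumes "even_matrix r s Q" "\<And>c. c \<ge> r \<Longrightarrow> H c = 0" "c \<ge> r"
  shows "vector_in_basis (r + s) Q H c = 0"
  unfolding vector_in_basis_def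
proof (intro sum.neutral ballI)
  fix d
  show "H d * Q d c = 0"
  proof (cases "Q d c = 0")
    case False
    then have "par r d = par r c" using assms(1) by (auto simp: even_matrix_def)
    then have "d \<ge> r" using assms(3) by (simp add: par_def split: if_splits)
    then show ?thesis using assms(2) by simp
  qed simp
qed

lemma matrix_in_basis_homogeneous:
  assumes P: "even_matrix r s P" and Q: "even_matrix r s Q"
    and L: "\<And>d e. d < r + s \<Longrightarrow> e < r + s \<Longrightarrow> sf_homogeneous (odd (par r d + par r e)) (L d e)"
  shows "sf_homogeneous (odd (par r b + par r c)) (matrix_in_basis (r + s) P Q L b c)"
  unfolding matrix_in_basis_def
proof (intro sf_homogeneous_sum)
  fix d e assume "d \<in> {..<r + s}" "e \<in> {..<r + s}"
  then have Lde: "sf_homogeneous (odd (par r d + par r e)) (L d e)" using L by simp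
  show "sf_homogeneous (odd (par r b + par r c)) (sf_scale (P b d * Q e c) (L d e))"
  proof (cases "P b d * Q e c = 0")
    case True
    then show ?thesis by (simp only: sf_scale_zero_left sf_homogeneous_zero)
  next
    case False
    then have "par r b = par r d" "par r e = par r c" using P Q by (auto simp: even_matrix_def)
    then show ?thesis using Lde by (simp only: sf_homogeneous_scale)
  qed
qed

text \<open>H' is the coefficient vector of h unless W is empty. In that case H is not tied to any
  value of h and might fail to be even; the zero vector then replaces it without changing the
  pull-back condition.\<close>

lemma primitive_solution_flat_coordinates:
  fixes M :: "('p, 'f, 'k::{real_normed_field, banach}) superspace"
  assumes M: "super_ringed_space M" and F: "local_system M r s F" and B: "commutativity_solution cat M r s F B"
    and h: "even_flat_section M r s F h" and i: "i \<in> frames F"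
    and fc: "flat_coordinates cat M r s F B h i W \<phi> \<Phi> H P Q a"
  defines "X \<equiv> matrix_in_basis (r + s) P Q (local_matrix M F B i \<Phi> W)"
  obtains H' where "primitive_solution cat r s (\<phi> ` W) X H' a"
    "\<And>e. pullback_of_vector cat r s (\<phi> ` W) X (vector_in_basis (r + s) Q H) e \<longleftrightarrow> pullback_of_vector cat r s (\<phi> ` W) X H' e"
proof -
  let ?D = "\<phi> ` W" and ?L = "local_matrix M F B i \<Phi> W" and ?hv = "vector_in_basis (r + s) Q H"
  have W: "W \<subseteq> patch F i" and ch: "chart cat M r s W \<phi> \<Phi>" and hW: "\<forall>y\<in>W. h i y = H"
    and P: "even_matrix r s P" and Q: "even_matrix r s Q" and PQ: "inverse_matrices (r + s) P Q"
    and flat: "\<And>c. c < r + s \<Longrightarrow> apply_const (r + s) X ?hv c = sf_scale ((-1) ^ par r c) (sf_coord r ?D c + sf_const ?D (a c))"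
    using fc by (auto simp: flat_coordinates_def X_def)
  have es: "even_section M r s F B" using B by (simp add: commutativity_solution_def)
  interpret superdomain cat r s ?D by (rule superdomain_chart[OF M ch])
  note Fi = local_system_patch_open[OF F i]
  have L: "?L d e \<in> superfunctions cat r s ?D" "sf_homogeneous (odd (par r d + par r e)) (?L d e)"
    if "d < r + s" "e < r + s" for d e
    unfolding local_matrix_def
    using chart_graded[OF M ch super_ringed_space_restr(2)[OF M Fi chart_open[OF ch] W even_section_graded[OF es i that]]] by simp_all
  have Xc: "X b c \<in> superfunctions cat r s ?D" for b c
    unfolding X_def matrix_in_basis_def by (intro closed L) auto
  have Xh: "sf_homogeneous (odd (par r b + par r c)) (X b c)" for b c
    unfolding X_def by (rule matrix_in_basis_homogeneous[OF P Q L(2)])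
  have comm: "endo_comp (r + s) (endo_deriv r r a X) (endo_deriv r r b X) d c =
      sf_scale ((- 1) ^ (par r a * par r b)) (endo_comp (r + s) (endo_deriv r r b X) (endo_deriv r r a X) d c)"
    if "a < r + s" "b < r + s" "d < r + s" "c < r + s" for a b d c
  proof -
    have "endo_comp (r + s) (endo_deriv r r a ?L) (endo_deriv r r b ?L) d c =
        sf_scale ((- 1) ^ (par r a * par r b)) (endo_comp (r + s) (endo_deriv r r b ?L) (endo_deriv r r a ?L) d c)"
      if "d < r + s" "c < r + s" for d c
      using B i ch W \<open>a < r + s\<close> \<open>b < r + s\<close> that unfolding commutativity_solution_def Let_def by blast
    then show ?thesis
      unfolding X_def endo_deriv_matrix_in_basis[OF Q] endo_comp_matrix_in_basis[OF PQ that(3,4)]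
      unfolding matrix_in_basis_def sf_scale_sum sf_scale_scale
      by (intro sum.cong refl) (simp add: mult.commute)
  qed
  have ps: "primitive_solution cat r s ?D X H' a"
    if "\<And>c. c \<ge> r \<Longrightarrow> H' c = 0"
      "\<And>c. c < r + s \<Longrightarrow> apply_const (r + s) X H' c = sf_scale ((-1) ^ par r c) (sf_coord r ?D c + sf_const ?D (a c))" for H'
    by (intro primitive_solution.intro primitive_solution_axioms.intro superdomain_axioms Xc Xh comm that)
  show thesis
  proof (cases "W = {}")
    case False
    then obtain y where y: "y \<in> W" by blast
    have "h i y c = 0" if "c \<ge> r" for c using h i y W that unfolding even_flat_section_def by blast
    moreover have "h i y = H" using hW y by blast
    ultimately have H0: "H c = 0" if "c \<ge> r" for c using that by blast
    show thesis by (rule that[OF ps[OF vector_in_basis_even[OF Q H0] flat] refl])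
  next
    \<comment> \<open>Every superfunction over the empty set is 0, so the conditions on the vector
      reduce to 0 = 0.\<close>
    case True
    have X0: "X b c = 0" for b c
    proof (intro ext)
      show "X b c x \<alpha> I = 0 x \<alpha> I" for x \<alpha> I
        using sf_supportedD(1)[OF superfunctions_supported[OF Xc[of b c]], of x \<alpha> I] True by simp
    qed
    have ac: "apply_const (r + s) X G c = 0" for G c
      unfolding apply_const_def X0 sf_scale_zero by (rule sum.neutral_const)
    have "sf_const ?D k = 0" for k using True by (auto simp: sf_const_def fun_eq_iff)
    then have "pullback_of_vector cat r s ?D X ?hv e \<longleftrightarrow> pullback_of_vector cat r s ?D X (\<lambda>_. 0) e" for e
      unfolding pullback_of_vector_def ac by simp
    moreover have "primitive_solution cat r s ?D X (\<lambda>_. 0) a" using flat unfolding ac by (intro ps) (simp_all only: ac)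
    ultimately show thesis using that by blast
  qed
qed

lemma primitive_flat_coordinates:
  assumes h: "primitive cat M r s F B h" and i: "i \<in> frames F" and x: "x \<in> patch F i"
  shows "\<exists>V \<phi> \<Phi> H P Q a. x \<in> V \<and> flat_coordinates cat M r s F B h i V \<phi> \<Phi> H P Q a"
proof -
  obtain V \<phi> \<Phi> H a where V: "x \<in> V" "V \<subseteq> patch F i" "chart cat M r s V \<phi> \<Phi>" "\<forall>y\<in>V. h i y = H"
    and flat: "\<And>c. c < r + s \<Longrightarrow> apply_const (r + s) (local_matrix M F B i \<Phi> V) H c =
      sf_scale ((-1) ^ par r c) (sf_coord r (\<phi> ` V) c + sf_const (\<phi> ` V) (a c))"
    using h i x unfolding primitive_def by meson
  let ?n = "r + s" and ?L = "local_matrix M F B i \<Phi> V"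
  \<comment> \<open>The fiber frame itself serves as basis. The identity matrix is cut off because
    \<open>even_matrix\<close> requires entries outside the range to vanish.\<close>
  define E :: "nat \<Rightarrow> nat \<Rightarrow> 'c" where "E b c = (if b = c \<and> b < ?n then 1 else 0)" for b c
  have sumE: "(\<Sum>d<?n. E b d * g d) = g b" "(\<Sum>d<?n. g d * E d b) = g b" if "b < ?n" for b and g :: "nat \<Rightarrow> 'c"
    using that by (simp_all add: E_def if_distrib if_distribR sum.delta sum.delta' cong: if_cong)
  have m: "matrix_in_basis ?n E E ?L b c = ?L b c" if "b < ?n" "c < ?n" for b c
  proof -
    have "matrix_in_basis ?n E E ?L b c = (\<Sum>d<?n. if d = b then ?L b c else 0)"
      unfolding matrix_in_basis_def
    proof (intro sum.cong refl)
      fix d assume "d \<in> {..<?n}"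
      have "(\<Sum>e<?n. sf_scale (E b d * E e c) (?L d e)) = (\<Sum>e<?n. if e = c then (if d = b then ?L b c else 0) else 0)"
        using that by (intro sum.cong refl) (auto simp: E_def)
      then show "(\<Sum>e<?n. sf_scale (E b d * E e c) (?L d e)) = (if d = b then ?L b c else 0)"
        using that(2) by (simp add: sum.delta)
    qed
    then show ?thesis using that(1) by (simp add: sum.delta)
  qed
  have v: "vector_in_basis ?n E H c = H c" if "c < ?n" for c
    unfolding vector_in_basis_def by (rule sumE(2)[OF that])
  have "apply_const ?n (matrix_in_basis ?n E E ?L) (vector_in_basis ?n E H) c = apply_const ?n ?L H c" if "c < ?n" for c
    unfolding apply_const_def using that by (intro sum.cong refl) (simp add: m v)
  moreover have "even_matrix r s E" by (auto simp: even_matrix_def E_def)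
  moreover have "inverse_matrices ?n E E"
    unfolding inverse_matrices_def by (auto simp: sumE) (auto simp: E_def)
  ultimately have "flat_coordinates cat M r s F B h i V \<phi> \<Phi> H E E a"
    using V flat unfolding flat_coordinates_def by simp
  then show ?thesis using V(1) by blast
qed

theorem proposition5p3p3:
  fixes cat :: category
    and M :: "('p, 'f, 'k::{real_normed_field, banach}) superspace"
    and r s :: nat
    and F :: "('j, 'p, 'k) local_system"
    and B :: "'j \<Rightarrow> nat \<Rightarrow> nat \<Rightarrow> 'f"
    and h :: "'j \<Rightarrow> 'p \<Rightarrow> nat \<Rightarrow> 'k"
  assumes "supermanifold cat M"
    and "local_system M r s F"
    and "commutativity_solution cat M r s F B"
    and "primitive cat M r s F B h"
  shows
    "(\<forall>i\<in>frames F. \<forall>x\<in>patch F i. \<exists>V \<phi> \<Phi> H P Q a.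
        x \<in> V \<and> flat_coordinates cat M r s F B h i V \<phi> \<Phi> H P Q a) \<and>
     (\<forall>i\<in>frames F. \<forall>V \<phi> \<Phi> H P Q a. flat_coordinates cat M r s F B h i V \<phi> \<Phi> H P Q a \<longrightarrow>
        (let BM = (\<lambda>W. matrix_in_basis (r + s) P Q (local_matrix M F B i \<Phi> W));
             hv = vector_in_basis (r + s) Q H
         in (\<forall>x\<in>V. \<exists>W A. openin (space_of M) W \<and> x \<in> W \<and> W \<subseteq> V \<and>
               vector_potential cat r s (\<phi> ` W) (BM W) A) \<and>
            (\<forall>W A. openin (space_of M) W \<and> W \<subseteq> V \<and>
               vector_potential cat r s (\<phi> ` W) (BM W) A \<longrightarrow>
               (\<exists>m. oriented_associativity cat r s (\<phi> ` W) A m \<and>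
                    (\<exists>!e. pullback_of_vector cat r s (\<phi> ` W) (BM W) hv e) \<and>
                    (\<forall>e. pullback_of_vector cat r s (\<phi> ` W) (BM W) hv e \<longrightarrow>
                       flat_identity cat r s (\<phi> ` W) m e)))))"
proof (intro conjI ballI allI impI)
  show "\<exists>V \<phi> \<Phi> H P Q a. x \<in> V \<and> flat_coordinates cat M r s F B h i V \<phi> \<Phi> H P Q a"
    if "i \<in> frames F" "x \<in> patch F i" for i x
    by (rule primitive_flat_coordinates[OF assms(4) that])
next
  have M: "super_ringed_space M" using assms(1) by (simp add: supermanifold_def)
  have es: "even_section M r s F B" using assms(3) by (simp add: commutativity_solution_def)
  have h: "even_flat_section M r s F h" using assms(4) by (simp add: primitive_def)
  fix i V \<phi> \<Phi> H P Q a
  assume i: "i \<in> frames F" and fc: "flat_coordinates cat M r s F B h i V \<phi> \<Phi> H P Q a"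
  let ?BM = "\<lambda>W. matrix_in_basis (r + s) P Q (local_matrix M F B i \<Phi> W)"
  let ?hv = "vector_in_basis (r + s) Q H"
  have ch: "chart cat M r s V \<phi> \<Phi>" using fc by (simp add: flat_coordinates_def)
  note restrict = flat_coordinates_subset[OF M assms(2) es i fc]
  note solution = primitive_solution_flat_coordinates[OF M assms(2,3) h i]
  have "\<exists>W A. openin (space_of M) W \<and> x \<in> W \<and> W \<subseteq> V \<and> vector_potential cat r s (\<phi> ` W) (?BM W) A"
    if x: "x \<in> V" for x
  proof -
    have V: "openin (space_of M) V" "openin (top_of_set (model_space cat r)) (\<phi> ` V)"
      and hm: "homeomorphic_map (subtopology (space_of M) V) (top_of_set (\<phi> ` V)) \<phi>"
      using ch by (simp_all add: chart_def)
    obtain H' where "primitive_solution cat r s (\<phi> ` V) (?BM V) H' a" using solution[OF fc] by blast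
    then interpret primitive_solution cat r s "\<phi> ` V" "?BM V" H' a .
    obtain E A where E: "\<phi> x \<in> E" "E \<subseteq> \<phi> ` V" "openin (top_of_set (model_space cat r)) E"
      and A: "vector_potential cat r s E (\<lambda>b c. sf_restrict E (?BM V b c)) A"
      using local_vector_potential[OF V(2), of "\<phi> x"] x by blast
    \<comment> \<open>E lies in the coordinate domain; its preimage under the homeomorphism is open,
      and there the matrix of B is the restriction of the one on V.\<close>
    define W where "W = {w \<in> V. \<phi> w \<in> E}"
    have W: "W \<subseteq> V" "\<phi> ` W = E" "x \<in> W" using E x by (auto simp: W_def)
    have "openin (top_of_set (\<phi> ` V)) E"
      using E(3,2) openin_imp_subset[OF V(2)] by (rule openin_subset_trans)
    then have "openin (subtopology (space_of M) V) {w \<in> topspace (subtopology (space_of M) V). \<phi> w \<in> E}"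
      by (rule openin_continuous_map_preimage[OF homeomorphic_imp_continuous_map[OF hm]])
    also have "{w \<in> topspace (subtopology (space_of M) V). \<phi> w \<in> E} = W"
      using openin_subset[OF V(1)] by (auto simp: W_def)
    finally have oW: "openin (space_of M) W" using V(1) by (rule openin_trans_full)
    have "?BM W = (\<lambda>b c. sf_restrict E (?BM V b c))"
      using restrict(2)[OF oW W(1)] unfolding W(2) by (intro ext) metis
    then have "vector_potential cat r s (\<phi> ` W) (?BM W) A" using A W(2) by simp
    then show ?thesis using oW W by blast
  qed
  moreover have "\<exists>m. oriented_associativity cat r s (\<phi> ` W) A m \<and>
      (\<exists>!e. pullback_of_vector cat r s (\<phi> ` W) (?BM W) ?hv e) \<and>
      (\<forall>e. pullback_of_vector cat r s (\<phi> ` W) (?BM W) ?hv e \<longrightarrow> flat_identity cat r s (\<phi> ` W) m e)"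
    if W: "openin (space_of M) W" "W \<subseteq> V" and A: "vector_potential cat r s (\<phi> ` W) (?BM W) A" for W A
  proof -
    \<comment> \<open>A is an arbitrary potential on an arbitrary open part of V, so the flat
      coordinates are restricted to W and the product is formed there.\<close>
    obtain H' where ps: "primitive_solution cat r s (\<phi> ` W) (?BM W) H' a"
      and pb: "\<And>e. pullback_of_vector cat r s (\<phi> ` W) (?BM W) ?hv e \<longleftrightarrow> pullback_of_vector cat r s (\<phi> ` W) (?BM W) H' e"
      using solution[OF restrict(1)[OF W]] by blast
    interpret primitive_solution cat r s "\<phi> ` W" "?BM W" H' a by (rule ps)
    show ?thesis
      unfolding pb pullback_iff using oriented_associativity_circ[OF A] flat_identity_circ by blast
  qed
  ultimately show "let BM = ?BM; hv = ?hv
         in (\<forall>x\<in>V. \<exists>W A. openin (space_of M) W \<and> x \<in> W \<and> W \<subseteq> V \<and>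
               vector_potential cat r s (\<phi> ` W) (BM W) A) \<and>
            (\<forall>W A. openin (space_of M) W \<and> W \<subseteq> V \<and>
               vector_potential cat r s (\<phi> ` W) (BM W) A \<longrightarrow>
               (\<exists>m. oriented_associativity cat r s (\<phi> ` W) A m \<and>
                    (\<exists>!e. pullback_of_vector cat r s (\<phi> ` W) (BM W) hv e) \<and>
                    (\<forall>e. pullback_of_vector cat r s (\<phi> ` W) (BM W) hv e \<longrightarrow>
                       flat_identity cat r s (\<phi> ` W) m e)))"
    unfolding Let_def by blast
qed

end
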